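(* Let $\mu_j=\mu_{j+1}\in\sigma(A_1)\cap\sigma(\hat A_2)$ be a double eigenvalue of $\mathcal{A}$, let $\pi\subset L_2(a,b)$ be the (two-dimensional) root subspace of $\mathcal{A}$ corresponding to $\mu_j$, and let $\pi(\varepsilon)\subset L_2(a,b)$ be the linear span of the two eigenfunctions $u_\varepsilon^-=u_{\varepsilon,j}$ and $u_\varepsilon^+=u_{\varepsilon,j+1}$ of (P$_\varepsilon$) corresponding to the eigenvalues $\lambda_\varepsilon^-=\lambda_j^\varepsilon$ and $\lambda_\varepsilon^+=\lambda_{j+1}^\varepsilon$. Then $\pi$ is the limit position of the plane $\pi(\varepsilon)$ as $\varepsilon\to0$, namely $$\|P_{\pi(\varepsilon)}-P_\pi\|\to0\quad\text{as }\varepsilon\to0,$$ where $P_{\pi(\varepsilon)}$ and $P_\pi$ are the orthogonal projectors onto $\pi(\varepsilon)$ and $\pi$ respectively.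
   Context: Let $a<0<b$, $I_a=(a,0)$, $I_b=(0,b)$. Let $k,r$ be smooth positive functions on $[a,0]$ and $\kappa,\rho$ smooth positive functions on $[0,b]$. Let $R=r$ on $I_a$ and $R=\rho$ on $I_b$. Perturbed problem (P$_\varepsilon$), $\varepsilon>0$: $(k u_\varepsilon')'+\varepsilon^{-1}\lambda^\varepsilon r u_\varepsilon=0$ in $I_a$; $\ \varepsilon(\kappa u_\varepsilon')'+\lambda^\varepsilon\rho u_\varepsilon=0$ in $I_b$; $\ u_\varepsilon(-0)=u_\varepsilon(+0)$, $\ (ku_\varepsilon')(-0)=\varepsilon(\kappa u_\varepsilon')(+0)$; $\ u_\varepsilon(a)=0$, $u_\varepsilon(b)=0$. Its spectrum is real, discrete and simple, $0<\lambda_1^\varepsilon<\lambda_2^\varepsilon<\dots\to\infty$. The corresponding real-valued eigenfunctions $u_{\varepsilon,j}$ are normalized by $\int_a^b R\,u_{\varepsilon,j}^2\,dx=1$ and $u_{\varepsilon,j}'(b)>0$. Operators: $A_1=-\frac1r\frac{d}{dx}k\frac{d}{dx}$ in $L_2(r,I_a)$ with domain $\{u\in H^2(I_a):u(a)=0,\ u'(0)=0\}$; $\hat A_2=-\frac1\rho\frac{d}{dx}\kappa\frac{d}{dx}$ in $L_2(\rho,I_b)$ with domain $\{u\in H^2(I_b):u(0)=u(b)=0\}$; $\mathcal{A}(u_1,u_2)=\bigl(-\frac1r(ku_1')',-\frac1\rho(\kappa u_2')'\bigr)$ in $\mathcal{L}=L_2(r,I_a)\oplus L_2(\rho,I_b)$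 with domain $\{(u_1,u_2)\in H^2(I_a)\oplus H^2(I_b): u_1(a)=u_1'(0)=0,\ u_2(b)=0,\ u_1(0)=u_2(0)\}$. A pair $(u_1,u_2)\in\mathcal{L}$ is identified with the function on $(a,b)$ equal to $u_1$ on $I_a$ and $u_2$ on $I_b$. The spectrum of $\mathcal{A}$ is real and discrete and equals $\sigma(A_1)\cup\sigma(\hat A_2)$; $\mu_1\le\mu_2\le\cdots$ are the eigenvalues of $\mathcal{A}$ in increasing order, repeated according to algebraic multiplicity; the eigenvalues of algebraic multiplicity $2$ are exactly the points of $\sigma(A_1)\cap\sigma(\hat A_2)$, and all others are simple. The root subspace of $\mu$ is $\bigcup_{n\ge1}\ker(\mathcal{A}-\mu\mathcal{I})^n$. *)

theory Defs
  imports "HOL-Analysis.Analysis"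
begin

text \<open>Derivatives at the end points of a closed interval \<^term>\<open>S\<close> are one-sided.\<close>

definition smooth_on :: "real set \<Rightarrow> (real \<Rightarrow> real) \<Rightarrow> bool" where
  "smooth_on S f \<longleftrightarrow> (\<exists>F :: nat \<Rightarrow> real \<Rightarrow> real. F 0 = f \<and>
     (\<forall>n. \<forall>x\<in>S. (F n has_real_derivative F (Suc n) x) (at x within S)))"


section \<open>Weighted complex \<open>L\<^sub>2\<close> spaces\<close>

text \<open>Elements are functions, not classes: equality in \<open>L\<^sub>2\<close> is \<^term>\<open>ae_eq\<close>, and all
  subspaces and operator graphs below are closed under it.\<close>

definition ae_eq :: "real set \<Rightarrow> (real \<Rightarrow> complex) \<Rightarrow> (real \<Rightarrow> complex) \<Rightarrow> bool" where
  "ae_eq S f g \<longleftrightarrow> (AE x in lebesgue_on S. f x = g x)"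

definition L2 :: "(real \<Rightarrow> real) \<Rightarrow> real set \<Rightarrow> (real \<Rightarrow> complex) set" where
  "L2 w S = {f. f \<in> borel_measurable (lebesgue_on S) \<and>
                integrable (lebesgue_on S) (\<lambda>x. w x * (cmod (f x))\<^sup>2)}"

definition L2_inner ::
  "(real \<Rightarrow> real) \<Rightarrow> real set \<Rightarrow> (real \<Rightarrow> complex) \<Rightarrow> (real \<Rightarrow> complex) \<Rightarrow> complex" where
  "L2_inner w S f g = (\<integral>x. of_real (w x) * f x * cnj (g x) \<partial>lebesgue_on S)"

definition L2_norm :: "(real \<Rightarrow> real) \<Rightarrow> real set \<Rightarrow> (real \<Rightarrow> complex) \<Rightarrow> real" where
  "L2_norm w S f = sqrt (\<integral>x. w x * (cmod (f x))\<^sup>2 \<partial>lebesgue_on S)"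

abbreviation unweighted :: "real \<Rightarrow> real" where
  "unweighted \<equiv> (\<lambda>_. 1)"

definition L2_span ::
  "real set \<Rightarrow> (nat \<Rightarrow> real \<Rightarrow> complex) \<Rightarrow> nat set \<Rightarrow> (real \<Rightarrow> complex) set" where
  "L2_span S e I =
     {f \<in> L2 unweighted S. \<exists>c :: nat \<Rightarrow> complex. ae_eq S f (\<lambda>x. \<Sum>i\<in>I. c i * e i x)}"

text \<open>The subspace \<^term>\<open>V\<close>, modulo null functions, has complex dimension \<^term>\<open>n\<close>.\<close>

definition has_dimension :: "real set \<Rightarrow> (real \<Rightarrow> complex) set \<Rightarrow> nat \<Rightarrow> bool" where
  "has_dimension S V n \<longleftrightarrow> (\<exists>e :: nat \<Rightarrow> real \<Rightarrow> complex.
     (\<forall>i<n. e i \<in> V) \<and>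
     (\<forall>c :: nat \<Rightarrow> complex. ae_eq S (\<lambda>x. \<Sum>i<n. c i * e i x) (\<lambda>_. 0) \<longrightarrow> (\<forall>i<n. c i = 0)) \<and>
     (\<forall>f\<in>V. \<exists>c :: nat \<Rightarrow> complex. ae_eq S f (\<lambda>x. \<Sum>i<n. c i * e i x)))"

text \<open>For a closed subspace \<^term>\<open>V\<close> and \<^term>\<open>f \<in> L2 unweighted S\<close>, the chosen function is
  unique up to a null function.\<close>

definition orth_proj ::
  "real set \<Rightarrow> (real \<Rightarrow> complex) set \<Rightarrow> (real \<Rightarrow> complex) \<Rightarrow> (real \<Rightarrow> complex)" where
  "orth_proj S V f =
     (SOME g. g \<in> V \<and> (\<forall>h\<in>V. L2_inner unweighted S (\<lambda>x. f x - g x) h = 0))"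

text \<open>Meaningful for bounded operators only: the supremum is taken in the reals.\<close>

definition op_norm ::
  "real set \<Rightarrow> ((real \<Rightarrow> complex) \<Rightarrow> (real \<Rightarrow> complex)) \<Rightarrow> real" where
  "op_norm S T =
     (SUP f\<in>{f \<in> L2 unweighted S. L2_norm unweighted S f \<le> 1}. L2_norm unweighted S (T f))"


section \<open>Unbounded operators, given by their graphs\<close>

text \<open>\<^term>\<open>T u f\<close> reads: \<^term>\<open>u\<close> is in the domain of \<^term>\<open>T\<close> and \<^term>\<open>f\<close> is its image.\<close>

type_synonym operator = "(real \<Rightarrow> complex) \<Rightarrow> (real \<Rightarrow> complex) \<Rightarrow> bool"

definition op_shift :: "operator \<Rightarrow> complex \<Rightarrow> operator" where
  "op_shift T z u g \<longleftrightarrow> (\<exists>f. T u f \<and> g = (\<lambda>x. f x - z * u x))"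

text \<open>\<open>T - z\<close> maps onto \<open>L\<^sub>2(w, S)\<close> and has a bounded inverse; the estimate includes injectivity.\<close>

definition resolvent_set :: "(real \<Rightarrow> real) \<Rightarrow> real set \<Rightarrow> operator \<Rightarrow> complex set" where
  "resolvent_set w S T = {z.
     (\<forall>f\<in>L2 w S. \<exists>u. op_shift T z u f) \<and>
     (\<exists>C. \<forall>u f. op_shift T z u f \<longrightarrow> L2_norm w S u \<le> C * L2_norm w S f)}"

definition op_spectrum :: "(real \<Rightarrow> real) \<Rightarrow> real set \<Rightarrow> operator \<Rightarrow> complex set" where
  "op_spectrum w S T = - resolvent_set w S T"

definition op_kernel :: "real set \<Rightarrow> operator \<Rightarrow> (real \<Rightarrow> complex) set" where
  "op_kernel S T = {u. \<exists>f. T u f \<and> ae_eq S f (\<lambda>_. 0)}"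

definition root_subspace :: "real set \<Rightarrow> operator \<Rightarrow> complex \<Rightarrow> (real \<Rightarrow> complex) set" where
  "root_subspace S T z = (\<Union>n\<in>{1..}. op_kernel S (op_shift T z ^^ n))"


section \<open>Sobolev functions and Sturm--Liouville operators\<close>

text \<open>\<^term>\<open>u\<close> is (the continuous representative on \<open>[c, d]\<close> of) an \<open>H\<^sup>1(c, d)\<close> function whose
  derivative is the \<open>L\<^sub>2\<close> function \<^term>\<open>v\<close>: \<^term>\<open>u\<close> is absolutely continuous and \<open>u' = v\<close> a.e.\<close>

definition H1_deriv :: "real \<Rightarrow> real \<Rightarrow> (real \<Rightarrow> complex) \<Rightarrow> (real \<Rightarrow> complex) \<Rightarrow> bool" where
  "H1_deriv c d u v \<longleftrightarrow> v \<in> L2 unweighted {c<..<d} \<and>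
     (\<forall>x\<in>{c..d}. (v has_integral (u x - u c)) {c..x})"

text \<open>\<open>u \<in> H\<^sup>2(c, d)\<close>, \<^term>\<open>v\<close> is its derivative (the continuous one, as \<^term>\<open>v\<close> is itself in
  \<open>H\<^sup>1\<close>), and \<open>f = - (1/q) (p u')'\<close>.\<close>

definition sl_expr ::
  "real \<Rightarrow> real \<Rightarrow> (real \<Rightarrow> real) \<Rightarrow> (real \<Rightarrow> real) \<Rightarrow>
   (real \<Rightarrow> complex) \<Rightarrow> (real \<Rightarrow> complex) \<Rightarrow> (real \<Rightarrow> complex) \<Rightarrow> bool" where
  "sl_expr c d p q u v f \<longleftrightarrow>
     H1_deriv c d u v \<and> (\<exists>g. H1_deriv c d v g) \<and>
     (\<exists>h. H1_deriv c d (\<lambda>x. of_real (p x) * v x) h \<and>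
          ae_eq {c<..<d} f (\<lambda>x. - (1 / of_real (q x)) * h x))"

definition op_A1 :: "real \<Rightarrow> (real \<Rightarrow> real) \<Rightarrow> (real \<Rightarrow> real) \<Rightarrow> operator" where
  "op_A1 a k r U F \<longleftrightarrow> (\<exists>u v. ae_eq {a<..<0} U u \<and> sl_expr a 0 k r u v F \<and> u a = 0 \<and> v 0 = 0)"

definition op_A2_hat :: "real \<Rightarrow> (real \<Rightarrow> real) \<Rightarrow> (real \<Rightarrow> real) \<Rightarrow> operator" where
  "op_A2_hat b \<kappa> \<rho> U F \<longleftrightarrow> (\<exists>u v. ae_eq {0<..<b} U u \<and> sl_expr 0 b \<kappa> \<rho> u v F \<and> u 0 = 0 \<and> u b = 0)"

text \<open>A pair in \<open>L\<^sub>2(r, (a, 0)) \<oplus> L\<^sub>2(\<rho>, (0, b))\<close> is identified with a function on \<open>(a, b)\<close>.\<close>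

definition op_A :: "real \<Rightarrow> real \<Rightarrow> (real \<Rightarrow> real) \<Rightarrow> (real \<Rightarrow> real) \<Rightarrow>
    (real \<Rightarrow> real) \<Rightarrow> (real \<Rightarrow> real) \<Rightarrow> operator" where
  "op_A a b k r \<kappa> \<rho> U F \<longleftrightarrow> (\<exists>u\<^sub>1 v\<^sub>1 u\<^sub>2 v\<^sub>2.
     ae_eq {a<..<0} U u\<^sub>1 \<and> ae_eq {0<..<b} U u\<^sub>2 \<and>
     sl_expr a 0 k r u\<^sub>1 v\<^sub>1 F \<and> sl_expr 0 b \<kappa> \<rho> u\<^sub>2 v\<^sub>2 F \<and>
     u\<^sub>1 a = 0 \<and> v\<^sub>1 0 = 0 \<and> u\<^sub>2 b = 0 \<and> u\<^sub>1 0 = u\<^sub>2 0)"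

text \<open>\<open>\<mu> 1 \<le> \<mu> 2 \<le> \<dots>\<close> lists the eigenvalues of \<^term>\<open>T\<close>, each repeated according to its algebraic
  multiplicity, i.e. the dimension of its root subspace (which is 0 for non-eigenvalues). The index
  0 is unused.\<close>

definition enumerates_eigenvalues :: "real set \<Rightarrow> operator \<Rightarrow> (nat \<Rightarrow> real) \<Rightarrow> bool" where
  "enumerates_eigenvalues S T \<mu> \<longleftrightarrow> mono_on {1..} \<mu> \<and>
     (\<forall>z. finite {i\<in>{1..}. complex_of_real (\<mu> i) = z} \<and>
          has_dimension S (root_subspace S T z) (card {i\<in>{1..}. complex_of_real (\<mu> i) = z}))"


section \<open>The perturbed problem\<close>

definition R_weight :: "(real \<Rightarrow> real) \<Rightarrow> (real \<Rightarrow> real) \<Rightarrow> real \<Rightarrow> real" where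
  "R_weight r \<rho> x = (if x < 0 then r x else \<rho> x)"

text \<open>Classical solutions up to the boundary; \<^term>\<open>v\<close> and \<^term>\<open>w\<close> are the derivatives of
  \<^term>\<open>u\<close> on \<open>[a, 0]\<close> and on \<open>[0, b]\<close>, one-sided at the end points. That \<open>u(-0) = u(+0)\<close> is built
  in, as both equations use the same value \<^term>\<open>u 0\<close>.\<close>

definition P_eigenfunction ::
  "real \<Rightarrow> real \<Rightarrow> (real \<Rightarrow> real) \<Rightarrow> (real \<Rightarrow> real) \<Rightarrow> (real \<Rightarrow> real) \<Rightarrow> (real \<Rightarrow> real) \<Rightarrow>
   real \<Rightarrow> complex \<Rightarrow> (real \<Rightarrow> complex) \<Rightarrow> bool" where
  "P_eigenfunction a b k r \<kappa> \<rho> \<epsilon> \<Lambda> u \<longleftrightarrow> (\<exists>x\<in>{a..b}. u x \<noteq> 0) \<and> (\<exists>v w.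
     (\<forall>x\<in>{a..0}. (u has_vector_derivative v x) (at x within {a..0}) \<and>
        (\<exists>D. ((\<lambda>y. of_real (k y) * v y) has_vector_derivative D) (at x within {a..0}) \<and>
             D + of_real (1 / \<epsilon>) * \<Lambda> * of_real (r x) * u x = 0)) \<and>
     (\<forall>x\<in>{0..b}. (u has_vector_derivative w x) (at x within {0..b}) \<and>
        (\<exists>D. ((\<lambda>y. of_real (\<kappa> y) * w y) has_vector_derivative D) (at x within {0..b}) \<and>
             of_real \<epsilon> * D + \<Lambda> * of_real (\<rho> x) * u x = 0)) \<and>
     of_real (k 0) * v 0 = of_real \<epsilon> * (of_real (\<kappa> 0) * w 0) \<and>
     u a = 0 \<and> u b = 0)"

definition P_spectrum ::
  "real \<Rightarrow> real \<Rightarrow> (real \<Rightarrow> real) \<Rightarrow> (real \<Rightarrow> real) \<Rightarrow> (real \<Rightarrow> real) \<Rightarrow> (real \<Rightarrow> real) \<Rightarrow>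
   real \<Rightarrow> complex set" where
  "P_spectrum a b k r \<kappa> \<rho> \<epsilon> = {\<Lambda>. \<exists>u. P_eigenfunction a b k r \<kappa> \<rho> \<epsilon> \<Lambda> u}"

text \<open>\<^term>\<open>u\<close> is the normalized real-valued eigenfunction for \<^term>\<open>\<Lambda>\<close>.\<close>

definition P_normalized ::
  "real \<Rightarrow> real \<Rightarrow> (real \<Rightarrow> real) \<Rightarrow> (real \<Rightarrow> real) \<Rightarrow> (real \<Rightarrow> real) \<Rightarrow> (real \<Rightarrow> real) \<Rightarrow>
   real \<Rightarrow> real \<Rightarrow> (real \<Rightarrow> real) \<Rightarrow> bool" where
  "P_normalized a b k r \<kappa> \<rho> \<epsilon> \<Lambda> u \<longleftrightarrow>
     P_eigenfunction a b k r \<kappa> \<rho> \<epsilon> (of_real \<Lambda>) (\<lambda>x. of_real (u x)) \<and>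
     ((\<lambda>x. R_weight r \<rho> x * (u x)\<^sup>2) has_integral 1) {a..b} \<and>
     (\<exists>d>0. (u has_real_derivative d) (at b within {0..b}))"

end

theory Submission
  imports Defs
begin

text \<open>
  Put \<open>\<omega> = \<lambda> / \<epsilon>\<close>. Both equations of the perturbed problem become \<open>- (p u')' = \<omega> q u\<close>, and \<open>\<epsilon>\<close> survives only in
  the flux condition at \<open>0\<close>. Shooting from \<open>a\<close> and from \<open>b\<close> gives solutions \<open>y\<^sub>1(\<omega>, x)\<close>, \<open>y\<^sub>2(\<omega>, x)\<close> with fluxes
  \<open>w\<^sub>1\<close>, \<open>w\<^sub>2\<close>, which are entire power series in \<open>\<omega>\<close>. The eigenvalues are the roots of \<open>\<epsilon> A(\<omega>) = B(\<omega>)\<close> with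
  \<open>A = y\<^sub>1 w\<^sub>2\<close> and \<open>B = w\<^sub>1 y\<^sub>2\<close>, taken at \<open>x = 0\<close> (\<open>P_spectrum_iff\<close>). The zeros of \<open>w\<^sub>1\<close> are the spectrum of \<open>A\<^sub>1\<close>,
  and those of \<open>y\<^sub>2\<close> are the spectrum of the Dirichlet operator on the right.

  Wronskian identities show that all zeros of \<open>w\<^sub>1\<close> and \<open>y\<^sub>2\<close> are simple, and they fix the signs of the derivatives.
  Hence a simple zero of \<open>B\<close> persists for small \<open>\<epsilon>\<close>, while a double one splits into exactly two real roots
  (\<open>root_count_near\<close>). The multiplicity of a zero of \<open>B\<close> agrees with the dimension of the root subspace
  (\<open>root_subspace_dimension\<close>), there are no nonpositive roots, and none escape between the zeros of \<open>B\<close>. Counting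
  roots from below therefore matches the indices, and \<open>\<lambda>\<^sub>j / \<epsilon>\<close> and \<open>\<lambda>\<^sub>j\<^sub>+\<^sub>1 / \<epsilon>\<close> both tend to \<open>\<mu>\<^sub>j\<close>
  (\<open>ordered_roots_converge\<close>).

  Near \<open>\<mu>\<^sub>j\<close> every eigenfunction is a multiple of \<open>Y(\<omega>) = (y\<^sub>2(\<omega>, 0) y\<^sub>1(\<omega>, x), y\<^sub>1(\<omega>, 0) y\<^sub>2(\<omega>, x))\<close>. Both
  eigenfunctions have the same limit direction \<open>Y(\<mu>\<^sub>j)\<close>, so the plane must be described by a better basis:
  \<open>Y(\<omega>)\<close> and the divided difference of \<open>Y\<close> between the two roots. This basis converges uniformly to \<open>Y(\<mu>\<^sub>j)\<close> and
  \<open>Y'(\<mu>\<^sub>j)\<close> (\<open>family_uniform_limit\<close>). These are exactly the eigenfunction and the generalized eigenfunction that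
  span the root subspace (\<open>root_subspace_double\<close>). Finally, the projection onto a plane is an integral operator
  whose kernel depends continuously on the basis (\<open>projections_converge\<close>).
\<close>

section \<open>Power series for the Cauchy problem\<close>

definition antideriv :: "real \<Rightarrow> real \<Rightarrow> (real \<Rightarrow> real) \<Rightarrow> real \<Rightarrow> real" where
  "antideriv c s f x = integral {c..x} f - integral {c..s} f"

lemma antideriv_base [simp]: "antideriv c s f s = 0"
  by (simp add: antideriv_def)

lemma antideriv_has_derivative:
  assumes "continuous_on {c..d} f" "x \<in> {c..d}"
  shows "(antideriv c s f has_real_derivative f x) (at x within {c..d})"
proof -
  have "((\<lambda>x. integral {c..x} f) has_real_derivative f x) (at x within {c..d})"
    by (rule integral_has_real_derivative[OF assms])
  then show ?thesis
    unfolding antideriv_def by (auto intro!: derivative_eq_intros)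
qed

text \<open>The point \<open>s\<close> may be either end of the interval: the left problem is integrated forwards from \<open>a\<close>, the
  right one backwards from \<open>b\<close>.\<close>

lemma growth_from_derivative_bound:
  fixes F f :: "real \<Rightarrow> real"
  assumes D: "\<And>x. x \<in> {c..d} \<Longrightarrow> (F has_real_derivative f x) (at x within {c..d})"
    and s: "s \<in> {c..d}" and x: "x \<in> {c..d}" and F: "F s = 0"
    and f: "\<And>x. x \<in> {c..d} \<Longrightarrow> \<bar>f x\<bar> \<le> K * \<bar>x - s\<bar> ^ n"
  shows "\<bar>F x\<bar> \<le> K * \<bar>x - s\<bar> ^ Suc n / Suc n"
proof -
  have cont: "continuous_on {c..d} F"
    by (meson D DERIV_continuous continuous_on_eq_continuous_within)
  have Dv: "(F has_vector_derivative f t) (at t)" if "c < t" "t < d" for t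
    using D[of t] that at_within_Icc_at[of c t d]
    by (simp add: has_real_derivative_iff_has_vector_derivative)
  show ?thesis
  proof (cases x s rule: linorder_cases)
    case equal
    then show ?thesis using F by simp
  next
    case greater
    have "norm (F x - F s) \<le> K * (x - s) ^ Suc n / Suc n - K * (s - s) ^ Suc n / Suc n"
    proof (rule differentiable_bound_general[OF greater, where f' = f
          and \<phi>' = "\<lambda>t. K * (t - s) ^ n"])
      show "continuous_on {s..x} F"
        using cont s x by (auto intro: continuous_on_subset)
      show "continuous_on {s..x} (\<lambda>t. K * (t - s) ^ Suc n / Suc n)"
        by (intro continuous_intros) auto
      show "(F has_vector_derivative f t) (at t)" if "s < t" "t < x" for t
        using Dv[of t] that s x by auto
      show "((\<lambda>t. K * (t - s) ^ Suc n / Suc n) has_vector_derivative K * (t - s) ^ n) (at t)"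
        for t
        unfolding has_real_derivative_iff_has_vector_derivative[symmetric]
        by (rule derivative_eq_intros refl | simp add: field_simps del: of_nat_Suc)+
      show "norm (f t) \<le> K * (t - s) ^ n" if "s < t" "t < x" for t
        using f[of t] that s x by auto
    qed
    then show ?thesis using greater F by simp
  next
    case less
    have "norm (F s - F x) \<le> - K * (s - s) ^ Suc n / Suc n - (- K * (s - x) ^ Suc n / Suc n)"
    proof (rule differentiable_bound_general[OF less, where f' = f
          and \<phi>' = "\<lambda>t. K * (s - t) ^ n"])
      show "continuous_on {x..s} F"
        using cont s x by (auto intro: continuous_on_subset)
      show "continuous_on {x..s} (\<lambda>t. - K * (s - t) ^ Suc n / Suc n)"
        by (intro continuous_intros) auto
      show "(F has_vector_derivative f t) (at t)" if "x < t" "t < s" for t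
        using Dv[of t] that s x by auto
      show "((\<lambda>t. - K * (s - t) ^ Suc n / Suc n) has_vector_derivative K * (s - t) ^ n) (at t)"
        for t
        unfolding has_real_derivative_iff_has_vector_derivative[symmetric]
        by (rule derivative_eq_intros refl | simp add: field_simps del: of_nat_Suc)+
      show "norm (f t) \<le> K * (s - t) ^ n" if "x < t" "t < s" for t
        using f[of t] that s x by auto
    qed
    then show ?thesis using less F by simp
  qed
qed

text \<open>With \<open>w = p y'\<close>, the equation \<open>(p y')' + \<omega> q y = 0\<close> with \<open>y(s) = 0\<close>, \<open>w(s) = 1\<close> is the system
  \<open>y = \<integral> w / p\<close>, \<open>w = 1 - \<omega> \<integral> q y\<close>. Substituting power series in \<open>\<omega>\<close> gives this recursion for the
  coefficients of \<open>w\<close>.\<close>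

primrec flux_coeff :: "real \<Rightarrow> real \<Rightarrow> (real \<Rightarrow> real) \<Rightarrow> (real \<Rightarrow> real) \<Rightarrow> nat \<Rightarrow> real \<Rightarrow> real" where
  "flux_coeff c s p q 0 = (\<lambda>x. 1)"
| "flux_coeff c s p q (Suc n) =
     antideriv c s (\<lambda>x. - q x * antideriv c s (\<lambda>t. flux_coeff c s p q n t / p t) x)"

lemma entire_coeffs_diffs:
  fixes a :: "nat \<Rightarrow> real"
  assumes "\<And>R. summable (\<lambda>n. a n * R ^ n)"
  shows "summable (\<lambda>n. diffs a n * R ^ n)"
  using termdiff_converges_all[of a R] assms by auto

text \<open>Half of the transmission problem. The continuous derivative of \<open>p\<close> places solutions in
  \<open>H\<^sup>2\<close>, as the domains of the operators demand.\<close>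

locale sl =
  fixes c d s :: real and p q :: "real \<Rightarrow> real"
  assumes cd: "c < d" and s: "s \<in> {c..d}"
    and p_pos: "\<And>x. x \<in> {c..d} \<Longrightarrow> 0 < p x" and q_pos: "\<And>x. x \<in> {c..d} \<Longrightarrow> 0 < q x"
    and p_C1: "\<exists>p'. continuous_on {c..d} p' \<and>
      (\<forall>x\<in>{c..d}. (p has_real_derivative p' x) (at x within {c..d}))"
    and q_cont: "continuous_on {c..d} q"
begin

lemma p_cont: "continuous_on {c..d} p"
  using p_C1 by (meson DERIV_continuous continuous_on_eq_continuous_within)

lemma weights_bounded:
  obtains M Q where "M > 0" "Q > 0" "\<And>x. x \<in> {c..d} \<Longrightarrow> \<bar>1 / p x\<bar> \<le> M" "\<And>x. x \<in> {c..d} \<Longrightarrow> \<bar>q x\<bar> \<le> Q"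
proof -
  have "\<forall>x\<in>{c..d}. p x \<noteq> 0" using p_pos by fastforce
  then have "bounded ((\<lambda>x. 1 / p x) ` {c..d})"
    by (intro compact_imp_bounded compact_continuous_image continuous_on_divide p_cont) auto
  then obtain M where M: "M > 0" "\<And>x. x \<in> {c..d} \<Longrightarrow> \<bar>1 / p x\<bar> \<le> M"
    by (auto simp: bounded_pos)
  have "bounded (q ` {c..d})"
    by (intro compact_imp_bounded compact_continuous_image q_cont) auto
  then obtain Q where Q: "Q > 0" "\<And>x. x \<in> {c..d} \<Longrightarrow> \<bar>q x\<bar> \<le> Q"
    by (auto simp: bounded_pos)
  show ?thesis by (rule that[OF M(1) Q(1) M(2) Q(2)])
qed

definition wc :: "nat \<Rightarrow> real \<Rightarrow> real" where "wc = flux_coeff c s p q"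
definition yc :: "nat \<Rightarrow> real \<Rightarrow> real" where "yc n = antideriv c s (\<lambda>t. wc n t / p t)"

lemma wc_0: "wc 0 = (\<lambda>x. 1)" and wc_Suc: "wc (Suc n) = antideriv c s (\<lambda>x. - q x * yc n x)"
  by (auto simp: wc_def yc_def)

lemma yc_deriv: "x \<in> {c..d} \<Longrightarrow> (yc n has_real_derivative wc n x / p x) (at x within {c..d})"
  and wc_deriv: "x \<in> {c..d} \<Longrightarrow> (wc (Suc n) has_real_derivative - q x * yc n x) (at x within {c..d})"
proof -
  have p0: "\<forall>x\<in>{c..d}. p x \<noteq> 0" using p_pos by fastforce
  have yd: "(yc n has_real_derivative wc n x / p x) (at x within {c..d})"
    if "continuous_on {c..d} (wc n)" "x \<in> {c..d}" for n x
    unfolding yc_def using that p0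
    by (intro antideriv_has_derivative continuous_on_divide p_cont) auto
  have yct: "continuous_on {c..d} (yc n)" if "continuous_on {c..d} (wc n)" for n
    using yd[OF that] by (meson DERIV_continuous continuous_on_eq_continuous_within)
  have wd: "(wc (Suc n) has_real_derivative - q x * yc n x) (at x within {c..d})"
    if "continuous_on {c..d} (wc n)" "x \<in> {c..d}" for n x
    unfolding wc_Suc using that yct[OF that(1)]
    by (intro antideriv_has_derivative continuous_intros q_cont) auto
  have wct: "continuous_on {c..d} (wc n)" for n
  proof (induction n)
    case 0
    then show ?case by (simp add: wc_0)
  next
    case (Suc n)
    then show ?case
      using wd[OF Suc] by (meson DERIV_continuous continuous_on_eq_continuous_within)
  qed
  show "x \<in> {c..d} \<Longrightarrow> (yc n has_real_derivative wc n x / p x) (at x within {c..d})"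
    by (rule yd[OF wct])
  show "x \<in> {c..d} \<Longrightarrow> (wc (Suc n) has_real_derivative - q x * yc n x) (at x within {c..d})"
    by (rule wd[OF wct])
qed

lemma yc_cont: "continuous_on {c..d} (yc n)"
  using yc_deriv by (meson DERIV_continuous continuous_on_eq_continuous_within)

text \<open>Each iterated integral gains a factor \<open>K \<bar>x - s\<bar> / n\<close>, so the coefficients decay like \<open>(K (d - c))\<^sup>n / n!\<close>
  uniformly in \<open>x\<close>. Hence all power series below are entire in \<open>\<omega>\<close>, and so are their termwise derivatives.\<close>

lemma coeff_bounds:
  obtains C :: "nat \<Rightarrow> real" where
    "\<And>n x. x \<in> {c..d} \<Longrightarrow> \<bar>wc n x\<bar> \<le> C n" "\<And>n x. x \<in> {c..d} \<Longrightarrow> \<bar>yc n x\<bar> \<le> C n"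
    "\<And>R. summable (\<lambda>n. C n * R ^ n)"
proof -
  obtain M Q where M: "M > 0" "\<And>x. x \<in> {c..d} \<Longrightarrow> \<bar>1 / p x\<bar> \<le> M"
    and Q: "Q > 0" "\<And>x. x \<in> {c..d} \<Longrightarrow> \<bar>q x\<bar> \<le> Q" by (rule weights_bounded) blast
  define L where "L = d - c"
  have L: "L > 0" using cd by (simp add: L_def)
  define K where "K = Q * M * L"
  have K: "K > 0" using L M Q by (simp add: K_def)
  have dist: "\<bar>x - s\<bar> \<le> L" if "x \<in> {c..d}" for x
    using that s by (auto simp: L_def)
  have y_from_w: "\<bar>yc n x\<bar> \<le> M * L * (K ^ n / fact n * \<bar>x - s\<bar> ^ n)"
    if w: "\<And>x. x \<in> {c..d} \<Longrightarrow> \<bar>wc n x\<bar> \<le> K ^ n / fact n * \<bar>x - s\<bar> ^ n" and x: "x \<in> {c..d}" for n x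
  proof -
    have "\<bar>yc n x\<bar> \<le> (M * (K ^ n / fact n)) * \<bar>x - s\<bar> ^ Suc n / Suc n"
    proof (rule growth_from_derivative_bound[OF yc_deriv s x])
      show "yc n s = 0" by (simp add: yc_def)
      show "\<bar>wc n x / p x\<bar> \<le> M * (K ^ n / fact n) * \<bar>x - s\<bar> ^ n" if "x \<in> {c..d}" for x
        using mult_mono[OF M(2)[OF that] w[OF that]] M(1) by (simp add: abs_mult)
    qed
    also have "\<dots> \<le> (M * (K ^ n / fact n)) * (\<bar>x - s\<bar> ^ n * L)"
    proof -
      have "\<bar>x - s\<bar> ^ Suc n / Suc n \<le> \<bar>x - s\<bar> ^ Suc n"
        using divide_left_mono[of 1 "real (Suc n)" "\<bar>x - s\<bar> ^ Suc n"] by simp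
      also have "\<dots> \<le> \<bar>x - s\<bar> ^ n * L"
        using mult_left_mono[OF dist[OF x], of "\<bar>x - s\<bar> ^ n"] by (simp add: mult.commute)
      finally show ?thesis
        using K M by (simp only: times_divide_eq_right[symmetric]) (intro mult_left_mono, auto)
    qed
    finally show ?thesis by (simp add: mult_ac)
  qed
  have w: "x \<in> {c..d} \<Longrightarrow> \<bar>wc n x\<bar> \<le> K ^ n / fact n * \<bar>x - s\<bar> ^ n" for n x
  proof (induction n arbitrary: x)
    case 0
    then show ?case by (simp add: wc_0)
  next
    case (Suc n)
    have "\<bar>wc (Suc n) x\<bar> \<le> (K * (K ^ n / fact n)) * \<bar>x - s\<bar> ^ Suc n / Suc n"
    proof (rule growth_from_derivative_bound[OF wc_deriv s Suc.prems])
      show "wc (Suc n) s = 0" by (simp add: wc_Suc)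
      show "\<bar>- q x * yc n x\<bar> \<le> K * (K ^ n / fact n) * \<bar>x - s\<bar> ^ n" if "x \<in> {c..d}" for x
        using mult_mono[OF Q(2)[OF that] y_from_w[OF Suc.IH that]] Q(1)
        by (simp add: abs_mult K_def mult_ac)
    qed
    also have "\<dots> = K ^ Suc n / fact (Suc n) * \<bar>x - s\<bar> ^ Suc n"
      by (simp add: field_simps)
    finally show ?case .
  qed
  define C where "C n = (1 + M * L) * ((K * L) ^ n / fact n)" for n
  have dn: "K ^ n / fact n * \<bar>x - s\<bar> ^ n \<le> (K * L) ^ n / fact n" if "x \<in> {c..d}" for n x
    using power_mono[OF dist[OF that], of n] K
    by (simp add: power_mult_distrib divide_right_mono mult_left_mono)
  have pos: "0 \<le> (K * L) ^ n / fact n" for n using K L by simp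
  show ?thesis
  proof
    show "\<bar>wc n x\<bar> \<le> C n" if "x \<in> {c..d}" for n x
    proof -
      have "\<bar>wc n x\<bar> \<le> (K * L) ^ n / fact n" using w[OF that, of n] dn[OF that, of n] by linarith
      also have "\<dots> \<le> C n"
        using mult_right_mono[OF _ pos, of 1 "1 + M * L" n] M L by (simp add: C_def)
      finally show ?thesis .
    qed
    show "\<bar>yc n x\<bar> \<le> C n" if "x \<in> {c..d}" for n x
    proof -
      have "\<bar>yc n x\<bar> \<le> M * L * ((K * L) ^ n / fact n)"
        using y_from_w[OF w that, of n] mult_left_mono[OF dn[OF that, of n], of "M * L"] M L
        by simp
      also have "\<dots> \<le> C n"
        unfolding C_def by (rule mult_right_mono[OF _ pos]) simp
      finally show ?thesis .
    qed
    show "summable (\<lambda>n. C n * R ^ n)" for R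
    proof -
      have "summable (\<lambda>n. (1 + M * L) * (inverse (fact n) * (K * L * R) ^ n))"
        by (intro summable_mult summable_exp)
      then show ?thesis
        by (simp add: C_def field_simps power_mult_distrib)
    qed
  qed
qed

end

lemma series_has_derivative_Icc:
  fixes F G :: "nat \<Rightarrow> real \<Rightarrow> real"
  assumes D: "\<And>n x. x \<in> {c..d} \<Longrightarrow> (F n has_real_derivative G n x) (at x within {c..d})"
    and B: "\<And>n x. x \<in> {c..d} \<Longrightarrow> \<bar>G n x\<bar> \<le> B n" and "summable B"
    and s: "s \<in> {c..d}" "summable (\<lambda>n. F n s)" and x: "x \<in> {c..d}"
  shows "((\<lambda>x. \<Sum>n. F n x) has_real_derivative (\<Sum>n. G n x)) (at x within {c..d})"
proof -
  have ul: "uniform_limit {c..d} (\<lambda>n x. \<Sum>i<n. G i x) (\<lambda>x. \<Sum>i. G i x) sequentially"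
    by (rule Weierstrass_m_test[OF _ \<open>summable B\<close>]) (use B in auto)
  obtain g where g: "\<And>x. x \<in> {c..d} \<Longrightarrow> (\<lambda>n. F n x) sums g x"
      "\<And>x. x \<in> {c..d} \<Longrightarrow> (g has_real_derivative (\<Sum>i. G i x)) (at x within {c..d})"
    using has_field_derivative_series[OF _ D ul s] by fastforce
  show ?thesis
    by (rule has_field_derivative_transform_within[OF g(2)[OF x] zero_less_one x])
       (use g(1) sums_unique in blast)
qed

lemma series_jointly_continuous:
  fixes a :: "nat \<Rightarrow> real \<Rightarrow> real"
  assumes a: "\<And>n. continuous_on I (a n)" and B: "\<And>n x. x \<in> I \<Longrightarrow> \<bar>a n x\<bar> \<le> B n"
    and sm: "\<And>R. summable (\<lambda>n. B n * R ^ n)"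
  shows "continuous_on (I \<times> {-R..R}) (\<lambda>(x, \<omega>). \<Sum>n. a n x * \<omega> ^ n)"
proof -
  have ul: "uniform_limit (I \<times> {-R..R}) (\<lambda>N z. \<Sum>n<N. a n (fst z) * snd z ^ n)
          (\<lambda>z. \<Sum>n. a n (fst z) * snd z ^ n) sequentially"
  proof (rule Weierstrass_m_test[OF _ sm])
    fix n and z :: "real \<times> real" assume z: "z \<in> I \<times> {-R..R}"
    then have "\<bar>snd z\<bar> ^ n \<le> R ^ n" by (intro power_mono) auto
    moreover have "\<bar>a n (fst z)\<bar> \<le> B n" using z B by auto
    moreover from this have "0 \<le> B n" by linarith
    ultimately show "norm (a n (fst z) * snd z ^ n) \<le> B n * R ^ n"
      by (simp add: abs_mult power_abs mult_mono)
  qed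
  have "continuous_on (I \<times> {-R..R}) (\<lambda>z. \<Sum>n. a n (fst z) * snd z ^ n)"
  proof (rule uniform_limit_theorem[OF _ ul])
    show "\<forall>\<^sub>F N in sequentially. continuous_on (I \<times> {-R..R}) (\<lambda>z. \<Sum>n<N. a n (fst z) * snd z ^ n)"
    proof (intro always_eventually allI continuous_intros)
      show "continuous_on (I \<times> {-R..R}) (\<lambda>z. a n (fst z))" for n
        by (rule continuous_on_compose2[OF a[of n]]) (auto intro: continuous_intros)
    qed
  qed auto
  then show ?thesis by (simp add: case_prod_beta)
qed

lemma entire_series_C1:
  fixes a :: "nat \<Rightarrow> real"
  assumes sm: "\<And>R. summable (\<lambda>n. a n * R ^ n)"
  shows "\<exists>D. (\<forall>\<omega>. ((\<lambda>\<omega>. \<Sum>n. a n * \<omega> ^ n) has_real_derivative D \<omega>) (at \<omega>)) \<and> continuous_on UNIV D"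
proof (intro exI conjI allI)
  show "((\<lambda>\<omega>. \<Sum>n. a n * \<omega> ^ n) has_real_derivative (\<Sum>n. diffs a n * \<omega> ^ n)) (at \<omega>)" for \<omega>
    by (rule termdiffs_strong_converges_everywhere[OF sm])
  show "continuous_on UNIV (\<lambda>\<omega>. \<Sum>n. diffs a n * \<omega> ^ n)"
    by (rule DERIV_continuous_on, rule has_field_derivative_at_within,
        rule termdiffs_strong_converges_everywhere, rule entire_coeffs_diffs[OF sm])
qed

context sl
begin

text \<open>The solution \<open>y\<close> vanishing at \<open>s\<close>, its flux \<open>w = p y'\<close>, and their derivatives \<open>yd\<close>, \<open>wd\<close> with respect
  to the spectral parameter \<open>\<omega>\<close>.\<close>

definition y :: "real \<Rightarrow> real \<Rightarrow> real" where "y \<omega> x = (\<Sum>n. yc n x * \<omega> ^ n)"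
definition w :: "real \<Rightarrow> real \<Rightarrow> real" where "w \<omega> x = (\<Sum>n. wc n x * \<omega> ^ n)"
definition yd :: "real \<Rightarrow> real \<Rightarrow> real" where "yd \<omega> x = (\<Sum>n. diffs (\<lambda>n. yc n x) n * \<omega> ^ n)"
definition wd :: "real \<Rightarrow> real \<Rightarrow> real" where "wd \<omega> x = (\<Sum>n. diffs (\<lambda>n. wc n x) n * \<omega> ^ n)"

lemma coeffs_summable:
  assumes "x \<in> {c..d}"
  shows "summable (\<lambda>n. yc n x * R ^ n)" "summable (\<lambda>n. wc n x * R ^ n)"
proof -
  obtain C where C: "\<And>n x. x \<in> {c..d} \<Longrightarrow> \<bar>wc n x\<bar> \<le> C n" "\<And>n x. x \<in> {c..d} \<Longrightarrow> \<bar>yc n x\<bar> \<le> C n"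
    "\<And>R. summable (\<lambda>n. C n * R ^ n)" by (rule coeff_bounds) blast
  show "summable (\<lambda>n. yc n x * R ^ n)"
    by (rule summable_comparison_test'[OF C(3)[of "\<bar>R\<bar>"], of 0])
       (use C assms in \<open>auto simp: abs_mult power_abs intro!: mult_right_mono\<close>)
  show "summable (\<lambda>n. wc n x * R ^ n)"
    by (rule summable_comparison_test'[OF C(3)[of "\<bar>R\<bar>"], of 0])
       (use C assms in \<open>auto simp: abs_mult power_abs intro!: mult_right_mono\<close>)
qed

lemma y_omega: "x \<in> {c..d} \<Longrightarrow> ((\<lambda>\<omega>. y \<omega> x) has_real_derivative yd \<omega> x) (at \<omega>)"
  unfolding y_def yd_def
  by (rule termdiffs_strong_converges_everywhere) (rule coeffs_summable)

lemma w_omega: "x \<in> {c..d} \<Longrightarrow> ((\<lambda>\<omega>. w \<omega> x) has_real_derivative wd \<omega> x) (at \<omega>)"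
  unfolding w_def wd_def
  by (rule termdiffs_strong_converges_everywhere) (rule coeffs_summable)

lemma
  assumes x: "x \<in> {c..d}"
  shows yd_C1: "\<exists>D. (\<forall>\<omega>. ((\<lambda>\<omega>. yd \<omega> x) has_real_derivative D \<omega>) (at \<omega>)) \<and> continuous_on UNIV D"
    and wd_C1: "\<exists>D. (\<forall>\<omega>. ((\<lambda>\<omega>. wd \<omega> x) has_real_derivative D \<omega>) (at \<omega>)) \<and> continuous_on UNIV D"
  unfolding yd_def wd_def by (intro entire_series_C1 entire_coeffs_diffs coeffs_summable[OF x])+

lemma yc_base: "yc n s = 0" by (simp add: yc_def)
lemma wc_base: "wc n s = (if n = 0 then 1 else 0)" by (cases n) (auto simp: wc_0 wc_Suc)

lemma initial: "y \<omega> s = 0" "w \<omega> s = 1" "yd \<omega> s = 0" "wd \<omega> s = 0"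
proof -
  have "(\<Sum>n. wc n s * \<omega> ^ n) = (\<Sum>n\<in>{0}. wc n s * \<omega> ^ n)"
    by (rule suminf_finite) (auto simp: wc_base)
  then show "w \<omega> s = 1" by (simp add: w_def wc_base)
qed (simp_all add: y_def yd_def wd_def yc_base wc_base diffs_def)

text \<open>Termwise differentiation of the power series in \<open>x\<close> turns the recursion for the coefficients
  into the differential equations.\<close>

lemma
  assumes x: "x \<in> {c..d}"
  shows y_deriv: "(y \<omega> has_real_derivative w \<omega> x / p x) (at x within {c..d})"
    and w_deriv: "(w \<omega> has_real_derivative - q x * (\<omega> * y \<omega> x)) (at x within {c..d})"
    and yd_deriv: "(yd \<omega> has_real_derivative wd \<omega> x / p x) (at x within {c..d})"
    and wd_deriv: "(wd \<omega> has_real_derivative - q x * (\<omega> * yd \<omega> x + y \<omega> x)) (at x within {c..d})"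
proof -
  obtain C where C: "\<And>n x. x \<in> {c..d} \<Longrightarrow> \<bar>wc n x\<bar> \<le> C n" "\<And>n x. x \<in> {c..d} \<Longrightarrow> \<bar>yc n x\<bar> \<le> C n"
    "\<And>R. summable (\<lambda>n. C n * R ^ n)" by (rule coeff_bounds) blast
  have Cd: "summable (\<lambda>n. diffs C n * R ^ n)" for R by (rule entire_coeffs_diffs) (rule C(3))
  have C0: "0 \<le> C n" for n using C(1)[OF s, of n] by linarith
  obtain M Q where M: "M > 0" "\<And>x. x \<in> {c..d} \<Longrightarrow> \<bar>1 / p x\<bar> \<le> M"
    and Q: "Q > 0" "\<And>x. x \<in> {c..d} \<Longrightarrow> \<bar>q x\<bar> \<le> Q" by (rule weights_bounded) blast
  have Wb: "\<bar>wc n x / p x * m\<bar> \<le> C n * \<bar>m\<bar> * M" if "x \<in> {c..d}" for n x m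
    using mult_mono[OF mult_right_mono[OF C(1)[OF that, of n], of "\<bar>m\<bar>"] M(2)[OF that]] C0[of n]
    by (simp add: abs_mult mult_ac)
  have Yb: "\<bar>- q x * yc n x * m\<bar> \<le> C n * \<bar>m\<bar> * Q" if "x \<in> {c..d}" for n x m
    using mult_mono[OF mult_right_mono[OF C(2)[OF that, of n], of "\<bar>m\<bar>"] Q(2)[OF that]] C0[of n]
    by (simp add: abs_mult mult_ac)
  note sy = coeffs_summable(1)[OF x] and sw = coeffs_summable(2)[OF x]
  have syd: "summable (\<lambda>n. diffs (\<lambda>n. yc n x) n * R ^ n)"
    and swd: "summable (\<lambda>n. diffs (\<lambda>n. wc n x) n * R ^ n)" if "x \<in> {c..d}" for R x
    by (rule entire_coeffs_diffs, rule coeffs_summable[OF that])+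

  have "((\<lambda>x. \<Sum>n. yc n x * \<omega> ^ n) has_real_derivative (\<Sum>n. wc n x / p x * \<omega> ^ n)) (at x within {c..d})"
  proof (rule series_has_derivative_Icc[where s = s, OF _ _ _ s _ x, where F = "\<lambda>n x. yc n x * \<omega> ^ n"
        and B = "\<lambda>n. C n * \<bar>\<omega>\<bar> ^ n * M"
        and G = "\<lambda>n x. wc n x / p x * \<omega> ^ n"])
    show "summable (\<lambda>n. yc n s * \<omega> ^ n)" by (rule coeffs_summable(1)[OF s])
    show "((\<lambda>x. yc n x * \<omega> ^ n) has_real_derivative wc n x / p x * \<omega> ^ n) (at x within {c..d})"
      if "x \<in> {c..d}" for n x by (rule DERIV_cmult_right[OF yc_deriv[OF that]])
    show "\<bar>wc n x / p x * \<omega> ^ n\<bar> \<le> C n * \<bar>\<omega>\<bar> ^ n * M" if "x \<in> {c..d}" for n x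
      using Wb[OF that, of n "\<omega> ^ n"] by (simp add: power_abs)
    show "summable (\<lambda>n. C n * \<bar>\<omega>\<bar> ^ n * M)" by (rule summable_mult2[OF C(3)])
  qed
  moreover have "(\<Sum>n. wc n x / p x * \<omega> ^ n) = w \<omega> x / p x"
    using suminf_divide[OF sw[of \<omega>], of "p x"] by (simp add: w_def)
  ultimately show "(y \<omega> has_real_derivative w \<omega> x / p x) (at x within {c..d})"
    unfolding y_def by simp

  have "((\<lambda>x. \<Sum>n. diffs (\<lambda>n. yc n x) n * \<omega> ^ n) has_real_derivative
          (\<Sum>n. diffs (\<lambda>n. wc n x / p x) n * \<omega> ^ n)) (at x within {c..d})"
  proof (rule series_has_derivative_Icc[where s = s, OF _ _ _ s _ x, where F = "\<lambda>n x. diffs (\<lambda>n. yc n x) n * \<omega> ^ n"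
        and B = "\<lambda>n. diffs C n * \<bar>\<omega>\<bar> ^ n * M"
        and G = "\<lambda>n x. diffs (\<lambda>n. wc n x / p x) n * \<omega> ^ n"])
    show "summable (\<lambda>n. diffs (\<lambda>n. yc n s) n * \<omega> ^ n)" by (rule syd[OF s])
    show "((\<lambda>x. diffs (\<lambda>n. yc n x) n * \<omega> ^ n) has_real_derivative diffs (\<lambda>n. wc n x / p x) n * \<omega> ^ n)
            (at x within {c..d})" if "x \<in> {c..d}" for n x
      unfolding diffs_def by (rule DERIV_cmult_right[OF DERIV_cmult[OF yc_deriv[OF that]]])
    show "\<bar>diffs (\<lambda>n. wc n x / p x) n * \<omega> ^ n\<bar> \<le> diffs C n * \<bar>\<omega>\<bar> ^ n * M" if "x \<in> {c..d}" for n x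
      using Wb[OF that, of "Suc n" "Suc n * \<omega> ^ n"] by (simp add: diffs_def power_abs abs_mult mult_ac)
    show "summable (\<lambda>n. diffs C n * \<bar>\<omega>\<bar> ^ n * M)" by (rule summable_mult2[OF Cd])
  qed
  moreover have "(\<Sum>n. diffs (\<lambda>n. wc n x / p x) n * \<omega> ^ n) = wd \<omega> x / p x"
    using suminf_divide[OF swd[OF x, of \<omega>], of "p x"] by (simp add: wd_def diffs_def)
  ultimately show "(yd \<omega> has_real_derivative wd \<omega> x / p x) (at x within {c..d})"
    unfolding yd_def by simp

  let ?G = "\<lambda>n x. case n of 0 \<Rightarrow> 0 | Suc m \<Rightarrow> - q x * yc m x * \<omega> ^ Suc m"
  have "((\<lambda>x. \<Sum>n. wc n x * \<omega> ^ n) has_real_derivative (\<Sum>n. ?G n x)) (at x within {c..d})"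
  proof (rule series_has_derivative_Icc[where s = s, OF _ _ _ s _ x, where F = "\<lambda>n x. wc n x * \<omega> ^ n"
        and B = "\<lambda>n. case n of 0 \<Rightarrow> 0 | Suc m \<Rightarrow> C m * \<bar>\<omega>\<bar> ^ Suc m * Q"
        and G = "\<lambda>n x. ?G n x"])
    show "summable (\<lambda>n. wc n s * \<omega> ^ n)" by (rule coeffs_summable(2)[OF s])
    show "((\<lambda>x. wc n x * \<omega> ^ n) has_real_derivative ?G n x) (at x within {c..d})"
      if "x \<in> {c..d}" for n x
    proof (cases n)
      case (Suc m)
      then show ?thesis using DERIV_cmult_right[OF wc_deriv[OF that, of m], of "\<omega> ^ n"] by simp
    qed (simp add: wc_0)
    let ?B = "\<lambda>n. case n of 0 \<Rightarrow> 0 | Suc m \<Rightarrow> C m * \<bar>\<omega>\<bar> ^ Suc m * Q"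
    show "\<bar>?G n x\<bar> \<le> ?B n" if "x \<in> {c..d}" for n x
      using Yb[OF that, of "n - 1" "\<omega> ^ n"] by (cases n) (auto simp: power_abs abs_mult)
    have "summable (\<lambda>n. C n * \<bar>\<omega>\<bar> ^ n * (\<bar>\<omega>\<bar> * Q))" by (rule summable_mult2[OF C(3)])
    then have "summable (\<lambda>n. ?B (Suc n))" by (simp add: mult_ac)
    then show "summable ?B" by (subst (asm) summable_Suc_iff)
  qed
  moreover have "(\<Sum>n. ?G n x) = - q x * (\<omega> * y \<omega> x)"
  proof -
    have "(\<lambda>n. - q x * \<omega> * (yc n x * \<omega> ^ n)) sums (- q x * \<omega> * y \<omega> x)"
      unfolding y_def by (intro sums_mult summable_sums sy)
    then have "(\<lambda>n. ?G (Suc n) x) sums (- q x * \<omega> * y \<omega> x)" by (simp add: mult_ac)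
    then have "(\<lambda>n. ?G n x) sums (- q x * \<omega> * y \<omega> x)"
      using sums_Suc_iff[of "\<lambda>n. ?G n x" "- q x * \<omega> * y \<omega> x"] by simp
    from sums_unique[OF this] show ?thesis by (simp only: mult.assoc)
  qed
  ultimately show "(w \<omega> has_real_derivative - q x * (\<omega> * y \<omega> x)) (at x within {c..d})"
    unfolding w_def by simp

  let ?H = "\<lambda>n x. - q x * yc n x * (Suc n * \<omega> ^ n)"
  have "((\<lambda>x. \<Sum>n. diffs (\<lambda>n. wc n x) n * \<omega> ^ n) has_real_derivative (\<Sum>n. ?H n x)) (at x within {c..d})"
  proof (rule series_has_derivative_Icc[where s = s, OF _ _ _ s _ x, where F = "\<lambda>n x. diffs (\<lambda>n. wc n x) n * \<omega> ^ n"
        and B = "\<lambda>n. (C n * (Suc n * \<bar>\<omega>\<bar> ^ n)) * Q"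
        and G = "\<lambda>n x. ?H n x"])
    show "summable (\<lambda>n. diffs (\<lambda>n. wc n s) n * \<omega> ^ n)" by (rule swd[OF s])
    show "((\<lambda>x. diffs (\<lambda>n. wc n x) n * \<omega> ^ n) has_real_derivative ?H n x) (at x within {c..d})"
      if "x \<in> {c..d}" for n x
      using DERIV_cmult_right[OF wc_deriv[OF that, of n], of "Suc n * \<omega> ^ n"]
      by (simp add: diffs_def mult_ac)
    show "\<bar>?H n x\<bar> \<le> (C n * (Suc n * \<bar>\<omega>\<bar> ^ n)) * Q" if "x \<in> {c..d}" for n x
      using Yb[OF that, of n "Suc n * \<omega> ^ n"] by (simp add: power_abs abs_mult)
    have "(\<lambda>n. diffs C n * \<bar>\<omega>\<bar> ^ n * \<bar>\<omega>\<bar>) = (\<lambda>n. (\<lambda>n. C n * (n * \<bar>\<omega>\<bar> ^ n)) (Suc n))"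
      by (simp add: diffs_def mult_ac)
    with summable_mult2[OF Cd, of "\<bar>\<omega>\<bar>" "\<bar>\<omega>\<bar>"] have "summable (\<lambda>n. C n * (n * \<bar>\<omega>\<bar> ^ n))"
      by (subst summable_Suc_iff[symmetric]) simp
    from summable_add[OF this C(3)[of "\<bar>\<omega>\<bar>"]]
    show "summable (\<lambda>n. (C n * (Suc n * \<bar>\<omega>\<bar> ^ n)) * Q)"
      by (intro summable_mult2) (simp add: algebra_simps)
  qed
  moreover have "(\<Sum>n. ?H n x) = - q x * (\<omega> * yd \<omega> x + y \<omega> x)"
  proof -
    have "(\<lambda>n. \<omega> * (diffs (\<lambda>n. yc n x) n * \<omega> ^ n)) sums (\<omega> * yd \<omega> x)"
      unfolding yd_def by (intro sums_mult summable_sums syd[OF x])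
    moreover have "(\<lambda>n. \<omega> * (diffs (\<lambda>n. yc n x) n * \<omega> ^ n)) = (\<lambda>n. (\<lambda>n. yc n x * (n * \<omega> ^ n)) (Suc n))"
      by (simp add: diffs_def mult_ac)
    ultimately have "(\<lambda>n. yc n x * (n * \<omega> ^ n)) sums (\<omega> * yd \<omega> x)"
      using sums_Suc_iff[of "\<lambda>n. yc n x * (n * \<omega> ^ n)" "\<omega> * yd \<omega> x"] by simp
    from sums_mult[OF sums_add[OF this summable_sums[OF sy[of \<omega>]]], of "- q x"]
    have "(\<lambda>n. - q x * (yc n x * (n * \<omega> ^ n) + yc n x * \<omega> ^ n)) sums (- q x * (\<omega> * yd \<omega> x + y \<omega> x))"
      by (simp only: y_def)
    moreover have "?H n x = - q x * (yc n x * (n * \<omega> ^ n) + yc n x * \<omega> ^ n)" for n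
      by (simp add: algebra_simps)
    ultimately show ?thesis by (simp only: sums_unique[symmetric])
  qed
  ultimately show "(wd \<omega> has_real_derivative - q x * (\<omega> * yd \<omega> x + y \<omega> x)) (at x within {c..d})"
    unfolding wd_def by simp
qed

lemma y_joint: "continuous_on ({c..d} \<times> {-R..R}) (\<lambda>(x, \<omega>). y \<omega> x)"
  and yd_joint: "continuous_on ({c..d} \<times> {-R..R}) (\<lambda>(x, \<omega>). yd \<omega> x)"
proof -
  obtain C where C: "\<And>n x. x \<in> {c..d} \<Longrightarrow> \<bar>wc n x\<bar> \<le> C n" "\<And>n x. x \<in> {c..d} \<Longrightarrow> \<bar>yc n x\<bar> \<le> C n"
    "\<And>R. summable (\<lambda>n. C n * R ^ n)" by (rule coeff_bounds) blast
  show "continuous_on ({c..d} \<times> {-R..R}) (\<lambda>(x, \<omega>). y \<omega> x)"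
    unfolding y_def by (rule series_jointly_continuous[OF yc_cont C(2,3)])
  show "continuous_on ({c..d} \<times> {-R..R}) (\<lambda>(x, \<omega>). yd \<omega> x)"
    unfolding yd_def
  proof (rule series_jointly_continuous)
    show "continuous_on {c..d} (\<lambda>x. diffs (\<lambda>n. yc n x) n)" for n
      unfolding diffs_def by (intro continuous_intros yc_cont)
    show "\<bar>diffs (\<lambda>n. yc n x) n\<bar> \<le> diffs C n" if "x \<in> {c..d}" for n x
      using mult_left_mono[OF C(2)[OF that, of "Suc n"], of "real (Suc n)"]
      by (simp add: diffs_def abs_mult)
    show "summable (\<lambda>n. diffs C n * R ^ n)" for R
      by (rule entire_coeffs_diffs) (rule C(3))
  qed
qed

end

section \<open>Uniqueness, Wronskians and energy\<close>

text \<open>Multiplication by \<open>exp (- C x)\<close> makes \<open>E\<close> nonincreasing to the right of \<open>s\<close>, and by \<open>exp (C x)\<close>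
  nondecreasing to the left of it.\<close>

lemma gronwall_zero:
  fixes E E' :: "real \<Rightarrow> real"
  assumes D: "\<And>x. x \<in> {c..d} \<Longrightarrow> (E has_real_derivative E' x) (at x within {c..d})"
    and le: "\<And>x. x \<in> {c..d} \<Longrightarrow> \<bar>E' x\<bar> \<le> C * E x" and pos: "\<And>x. 0 \<le> E x"
    and s: "s \<in> {c..d}" "E s = 0" and x: "x \<in> {c..d}"
  shows "E x = 0"
proof -
  have cont: "continuous_on {c..d} E"
    by (meson D DERIV_continuous continuous_on_eq_continuous_within)
  have Dv: "(E has_real_derivative E' t) (at t)" if "c < t" "t < d" for t
    using D[of t] that at_within_Icc_at[of c t d] by simp
  show ?thesis
  proof (cases "s \<le> x")
    case True
    have "E x * exp (- C * x) \<le> E s * exp (- C * s)"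
    proof (rule DERIV_nonpos_imp_decreasing_open[OF True])
      show "continuous_on {s..x} (\<lambda>t. E t * exp (- C * t))"
        using s x by (intro continuous_intros continuous_on_subset[OF cont]) auto
      fix t assume t: "s < t" "t < x"
      have "((\<lambda>t. E t * exp (- C * t)) has_real_derivative (E' t - C * E t) * exp (- C * t)) (at t)"
        using Dv[of t] t s x by (auto intro!: derivative_eq_intros simp: algebra_simps)
      moreover have "(E' t - C * E t) * exp (- C * t) \<le> 0"
        using le[of t] t s x by (intro mult_nonpos_nonneg) auto
      ultimately show "\<exists>y. ((\<lambda>t. E t * exp (- C * t)) has_real_derivative y) (at t) \<and> y \<le> 0" by blast
    qed
    then have "E x * exp (- C * x) \<le> 0" using s by simp
    then show ?thesis using pos[of x] by (simp add: mult_le_0_iff)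
  next
    case False
    have "E x * exp (C * x) \<le> E s * exp (C * s)"
    proof (rule DERIV_nonneg_imp_increasing_open[where f = "\<lambda>t. E t * exp (C * t)" and a = x and b = s])
      show "x \<le> s" using False by simp
      show "continuous_on {x..s} (\<lambda>t. E t * exp (C * t))"
        using s x by (intro continuous_intros continuous_on_subset[OF cont]) auto
      fix t assume t: "x < t" "t < s"
      have "((\<lambda>t. E t * exp (C * t)) has_real_derivative (E' t + C * E t) * exp (C * t)) (at t)"
        using Dv[of t] t s x by (auto intro!: derivative_eq_intros simp: algebra_simps)
      moreover have "0 \<le> (E' t + C * E t) * exp (C * t)"
        using le[of t] t s x by (intro mult_nonneg_nonneg) auto
      ultimately show "\<exists>y. ((\<lambda>t. E t * exp (C * t)) has_real_derivative y) (at t) \<and> 0 \<le> y" by blast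
    qed
    then have "E x * exp (C * x) \<le> 0" using s by simp
    then show ?thesis using pos[of x] by (simp add: mult_le_0_iff)
  qed
qed

lemma decreasing_strict_Icc:
  fixes N N' :: "real \<Rightarrow> real"
  assumes D: "\<And>x. x \<in> {c..d} \<Longrightarrow> (N has_real_derivative N' x) (at x within {c..d})"
    and le: "\<And>x. x \<in> {c..d} \<Longrightarrow> N' x \<le> 0" and x: "c < x" "x < d" "N' x \<noteq> 0"
  shows "N d < N c"
proof (rule ccontr)
  assume nl: "\<not> N d < N c"
  have cont: "continuous_on {c..d} N"
    by (meson D DERIV_continuous continuous_on_eq_continuous_within)
  have Dv: "(N has_real_derivative N' t) (at t)" if "c < t" "t < d" for t
    using D[of t] that at_within_Icc_at[of c t d] by simp
  have dec: "N t \<le> N r" if "c \<le> r" "r \<le> t" "t \<le> d" for r t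
  proof (rule DERIV_nonpos_imp_decreasing_open[OF that(2)])
    show "continuous_on {r..t} N" by (rule continuous_on_subset[OF cont]) (use that in auto)
    show "\<exists>y. (N has_real_derivative y) (at z) \<and> y \<le> 0" if "r < z" "z < t" for z
      using Dv[of z] le[of z] that \<open>c \<le> r\<close> \<open>t \<le> d\<close> by auto
  qed
  have const: "N t = N c" if "t \<in> {c<..<d}" for t
    using dec[of c t] dec[of t d] nl that by auto
  have "((\<lambda>_. N c) has_real_derivative N' x) (at x)"
    by (rule has_field_derivative_transform_within_open[OF Dv[OF x(1,2)], of "{c<..<d}"])
       (use x const in auto)
  then have "N' x = 0" using DERIV_const DERIV_unique by blast
  then show False using x by simp
qed

context sl
begin

text \<open>A solution with vanishing Cauchy data vanishes, by Gronwall's inequality for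
  \<open>\<bar>U\<bar>\<^sup>2 + \<bar>W\<bar>\<^sup>2\<close>.\<close>

lemma solution_unique:
  fixes U W :: "real \<Rightarrow> 'a::real_inner"
  assumes U: "\<And>x. x \<in> {c..d} \<Longrightarrow> (U has_vector_derivative (1 / p x) *\<^sub>R W x) (at x within {c..d})"
    and W: "\<And>x. x \<in> {c..d} \<Longrightarrow> (W has_vector_derivative (- q x * \<omega>) *\<^sub>R U x) (at x within {c..d})"
    and init: "U s = 0" "W s = 0" and x: "x \<in> {c..d}"
  shows "U x = 0 \<and> W x = 0"
proof -
  define m where "m x = 1 / p x - q x * \<omega>" for x
  define E where "E x = U x \<bullet> U x + W x \<bullet> W x" for x
  obtain M Q where M: "M > 0" "\<And>x. x \<in> {c..d} \<Longrightarrow> \<bar>1 / p x\<bar> \<le> M"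
    and Q: "Q > 0" "\<And>x. x \<in> {c..d} \<Longrightarrow> \<bar>q x\<bar> \<le> Q" by (rule weights_bounded) blast
  define C where "C = M + Q * \<bar>\<omega>\<bar>"
  have C: "0 \<le> C" using M Q by (simp add: C_def)
  have mC: "\<bar>m x\<bar> \<le> C" if "x \<in> {c..d}" for x
  proof -
    have "\<bar>m x\<bar> \<le> \<bar>1 / p x\<bar> + \<bar>q x * \<omega>\<bar>" unfolding m_def by (rule abs_triangle_ineq4)
    also have "\<dots> \<le> C"
      unfolding C_def abs_mult by (intro add_mono M(2) mult_right_mono Q(2) that) simp
    finally show ?thesis .
  qed
  have "E x = 0"
  proof (rule gronwall_zero[where E' = "\<lambda>x. 2 * m x * (U x \<bullet> W x)" and C = C, OF _ _ _ s _ x])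
    show "(E has_real_derivative 2 * m x * (U x \<bullet> W x)) (at x within {c..d})" if "x \<in> {c..d}" for x
    proof -
      have *: "((\<lambda>x. f x \<bullet> f x) has_real_derivative 2 * (f x \<bullet> f')) (at x within {c..d})"
        if "(f has_vector_derivative f') (at x within {c..d})" for f :: "real \<Rightarrow> 'a" and f'
      proof -
        have "((\<lambda>x. f x \<bullet> f x) has_derivative (\<lambda>h. f x \<bullet> (h *\<^sub>R f') + (h *\<^sub>R f') \<bullet> f x)) (at x within {c..d})"
          using that unfolding has_vector_derivative_def by (intro has_derivative_inner)
        then show ?thesis
          unfolding has_field_derivative_def
          by (rule has_derivative_eq_rhs) (auto simp: inner_commute algebra_simps)
      qed
      show ?thesis
        unfolding E_def
        by (rule derivative_eq_intros *[OF U[OF that]] *[OF W[OF that]] refl)+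
           (simp add: m_def inner_commute algebra_simps)
    qed
    show "\<bar>2 * m x * (U x \<bullet> W x)\<bar> \<le> C * E x" if "x \<in> {c..d}" for x
    proof -
      have "0 \<le> (norm (U x) - norm (W x))\<^sup>2" by simp
      then have "2 * (norm (U x) * norm (W x)) \<le> E x"
        by (simp add: E_def power2_diff dot_square_norm)
      with Cauchy_Schwarz_ineq2[of "U x" "W x"] have "\<bar>2 * (U x \<bullet> W x)\<bar> \<le> E x"
        by (simp add: abs_mult)
      from mult_mono[OF mC[OF that] this] C show ?thesis by (simp add: abs_mult mult_ac)
    qed
    show "0 \<le> E x" for x by (simp add: E_def)
    show "E s = 0" by (simp add: E_def init)
  qed
  then show ?thesis
    unfolding E_def using inner_ge_zero[of "U x"] inner_ge_zero[of "W x"]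
    by (metis add_nonneg_eq_0_iff inner_eq_zero_iff)
qed

text \<open>General solution of \<open>- (p U')' / q - \<omega> U = y \<beta>\<close> with \<open>U(s) = 0\<close>, and its flux: differentiating
  the equation of \<open>y\<close> in \<open>\<omega>\<close> shows that \<open>yd\<close> is a particular solution, which is how Jordan chains arise.\<close>

abbreviation sol :: "real \<Rightarrow> 'a::real_vector \<Rightarrow> 'a \<Rightarrow> real \<Rightarrow> 'a" where
  "sol \<omega> \<alpha> \<beta> x \<equiv> y \<omega> x *\<^sub>R \<alpha> + yd \<omega> x *\<^sub>R \<beta>"

abbreviation flux :: "real \<Rightarrow> 'a::real_vector \<Rightarrow> 'a \<Rightarrow> real \<Rightarrow> 'a" where
  "flux \<omega> \<alpha> \<beta> x \<equiv> w \<omega> x *\<^sub>R \<alpha> + wd \<omega> x *\<^sub>R \<beta>"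

text \<open>The solution space of the equation with right-hand side \<open>y\<beta>\<close>, which governs both
  eigenfunctions (\<open>\<beta> = 0\<close>) and generalized eigenfunctions.\<close>

lemma solution_form:
  fixes U W :: "real \<Rightarrow> 'a::real_inner"
  assumes U: "\<And>x. x \<in> {c..d} \<Longrightarrow> (U has_vector_derivative (1 / p x) *\<^sub>R W x) (at x within {c..d})"
    and W: "\<And>x. x \<in> {c..d} \<Longrightarrow>
      (W has_vector_derivative (- q x) *\<^sub>R (\<omega> *\<^sub>R U x + y \<omega> x *\<^sub>R \<beta>)) (at x within {c..d})"
    and init: "U s = 0" and x: "x \<in> {c..d}"
  shows "U x = sol \<omega> (W s) \<beta> x" "W x = flux \<omega> (W s) \<beta> x"
proof -
  define U1 where "U1 x = U x - (sol \<omega> (W s) \<beta> x)" for x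
  define W1 where "W1 x = W x - (flux \<omega> (W s) \<beta> x)" for x
  have "U1 x = 0 \<and> W1 x = 0"
  proof (rule solution_unique[where \<omega> = \<omega>, OF _ _ _ _ x])
    fix x assume x: "x \<in> {c..d}"
    show "(U1 has_vector_derivative (1 / p x) *\<^sub>R W1 x) (at x within {c..d})"
      unfolding U1_def
      by (rule derivative_eq_intros U[OF x] y_deriv[OF x] yd_deriv[OF x] refl)+
         (simp add: W1_def algebra_simps divide_inverse)
    show "(W1 has_vector_derivative (- q x * \<omega>) *\<^sub>R U1 x) (at x within {c..d})"
      unfolding W1_def
      by (rule derivative_eq_intros W[OF x] w_deriv[OF x] wd_deriv[OF x] refl)+
         (simp add: U1_def algebra_simps)
  qed (simp_all add: U1_def W1_def init initial)
  then show "U x = sol \<omega> (W s) \<beta> x" "W x = flux \<omega> (W s) \<beta> x"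
    by (simp_all add: U1_def W1_def)
qed

lemma w_nonzero_inside: "\<exists>x. c < x \<and> x < d \<and> w \<omega> x \<noteq> 0"
proof (rule ccontr)
  assume "\<not> ?thesis"
  then have z: "w \<omega> x = 0" if "x \<in> {c<..<d}" for x using that by auto
  have "continuous_on {c..d} (w \<omega>)"
    by (meson w_deriv DERIV_continuous continuous_on_eq_continuous_within)
  then have "w \<omega> s = 0"
    using continuous_constant_on_closure[of "{c<..<d}" "w \<omega>" 0 s] z s cd by simp
  then show False by (simp add: initial)
qed

lemma y_nonzero_inside: "\<exists>x. c < x \<and> x < d \<and> y \<omega> x \<noteq> 0"
proof (rule ccontr)
  assume "\<not> ?thesis"
  then have z: "y \<omega> x = 0" if "x \<in> {c<..<d}" for x using that by auto
  have "w \<omega> x = 0" if x: "x \<in> {c<..<d}" for x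
  proof -
    have "(y \<omega> has_real_derivative w \<omega> x / p x) (at x)"
      using y_deriv[of x \<omega>] at_within_Icc_at[of c x d] x by simp
    then have "((\<lambda>_. 0) has_real_derivative w \<omega> x / p x) (at x)"
      by (rule has_field_derivative_transform_within_open[of _ _ _ "{c<..<d}"]) (use x z in auto)
    then have "w \<omega> x / p x = 0" using DERIV_const DERIV_unique by blast
    then show ?thesis using p_pos[of x] x by auto
  qed
  with w_nonzero_inside[of \<omega>] show False by auto
qed

text \<open>The Wronskian of the solution and its \<open>\<omega>\<close>-derivative has derivative \<open>- q y\<^sup>2\<close>. This is the source of
  all sign information: at a zero of \<open>y\<close> or \<open>w\<close> at the end point opposite to \<open>s\<close> it shows that this zero is
  simple in \<open>\<omega>\<close>, and in which direction it is crossed.\<close>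

lemma wronskian_omega_decreasing:
  "wd \<omega> d * y \<omega> d - w \<omega> d * yd \<omega> d < wd \<omega> c * y \<omega> c - w \<omega> c * yd \<omega> c"
proof -
  obtain x where x: "c < x" "x < d" "y \<omega> x \<noteq> 0" using y_nonzero_inside by blast
  show ?thesis
  proof (rule decreasing_strict_Icc[where N' = "\<lambda>x. - q x * (y \<omega> x)\<^sup>2", OF _ _ x(1,2)])
    show "((\<lambda>x. wd \<omega> x * y \<omega> x - w \<omega> x * yd \<omega> x) has_real_derivative - q x * (y \<omega> x)\<^sup>2)
        (at x within {c..d})" if "x \<in> {c..d}" for x
      by (rule derivative_eq_intros y_deriv[OF that] w_deriv[OF that] yd_deriv[OF that]
           wd_deriv[OF that] refl)+
         (simp add: algebra_simps power2_eq_square)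
    show "- q x * (y \<omega> x)\<^sup>2 \<le> 0" if "x \<in> {c..d}" for x
      using q_pos[OF that] by (simp add: mult_le_0_iff)
    show "- q x * (y \<omega> x)\<^sup>2 \<noteq> 0" using x q_pos[of x] by simp
  qed
qed

text \<open>For \<open>\<omega> \<le> 0\<close> the derivative \<open>(y w)' = w\<^sup>2 / p - \<omega> q y\<^sup>2\<close> is nonnegative. The resulting signs exclude
  nonpositive eigenvalues.\<close>

lemma energy_increasing:
  assumes "\<omega> \<le> 0"
  shows "y \<omega> c * w \<omega> c < y \<omega> d * w \<omega> d"
proof -
  obtain x where x: "c < x" "x < d" "w \<omega> x \<noteq> 0" using w_nonzero_inside by blast
  let ?N' = "\<lambda>x. - ((w \<omega> x)\<^sup>2 / p x - q x * \<omega> * (y \<omega> x)\<^sup>2)"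
  have nn: "0 \<le> - (q x * \<omega> * (y \<omega> x)\<^sup>2)" if "x \<in> {c..d}" for x
  proof -
    have "0 \<le> q x * (- \<omega>) * (y \<omega> x)\<^sup>2"
      using q_pos[OF that] assms by (intro mult_nonneg_nonneg) auto
    then show ?thesis by simp
  qed
  have "- (y \<omega> d * w \<omega> d) < - (y \<omega> c * w \<omega> c)"
  proof (rule decreasing_strict_Icc[where N' = ?N', OF _ _ x(1,2)])
    show "((\<lambda>x. - (y \<omega> x * w \<omega> x)) has_real_derivative ?N' x) (at x within {c..d})"
      if "x \<in> {c..d}" for x
      by (rule derivative_eq_intros y_deriv[OF that] w_deriv[OF that] refl)+
         (use p_pos[OF that] in \<open>simp add: field_simps power2_eq_square\<close>)
    show "?N' x \<le> 0" if "x \<in> {c..d}" for x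
      using nn[OF that] divide_nonneg_pos[OF zero_le_power2 p_pos[OF that], of "w \<omega> x"] by linarith
    show "?N' x \<noteq> 0"
    proof -
      have "0 < (w \<omega> x)\<^sup>2 / p x" using x p_pos[of x] by (intro divide_pos_pos) auto
      with nn[of x] x show ?thesis by simp
    qed
  qed
  then show ?thesis by simp
qed

end

section \<open>Sobolev and classical solutions\<close>

lemma ae_eq_iff_negligible:
  assumes "S \<in> sets lebesgue"
  shows "ae_eq S f g \<longleftrightarrow> negligible {x \<in> S. f x \<noteq> g x}"
proof -
  have "ae_eq S f g \<longleftrightarrow> (AE x in lebesgue. x \<in> S \<longrightarrow> f x = g x)"
    unfolding ae_eq_def using assms by (subst AE_restrict_space_iff) auto
  also have "\<dots> \<longleftrightarrow> negligible {x \<in> S. f x \<noteq> g x}"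
    by (simp add: completion.AE_iff_null_sets negligible_iff_null_sets)
  finally show ?thesis .
qed

lemma ae_eq_refl [simp]: "ae_eq S f f" and ae_eq_sym: "ae_eq S f g \<Longrightarrow> ae_eq S g f"
  by (auto simp: ae_eq_def)

lemma ae_eq_trans:
  assumes "ae_eq S f g" "ae_eq S g h"
  shows "ae_eq S f h"
  using assms unfolding ae_eq_def by eventually_elim simp

lemma ae_eqI: "(\<And>x. x \<in> S \<Longrightarrow> f x = g x) \<Longrightarrow> ae_eq S f g"
  unfolding ae_eq_def by (rule AE_I2) simp

lemma ae_eq_subset:
  assumes "ae_eq S f g" "T \<subseteq> S" "S \<in> sets lebesgue" "T \<in> sets lebesgue"
  shows "ae_eq T f g"
  using assms by (auto simp: ae_eq_iff_negligible intro: negligible_subset)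

lemma ae_eq_glue:
  fixes a b :: real
  assumes "ae_eq {a<..<0} f g" "ae_eq {0<..<b} f g"
  shows "ae_eq {a<..<b} f g"
proof -
  have "negligible ({x \<in> {a<..<0}. f x \<noteq> g x} \<union> {x \<in> {0<..<b}. f x \<noteq> g x} \<union> {0})"
    using assms by (auto simp: ae_eq_iff_negligible intro!: negligible_Un)
  then have "negligible {x \<in> {a<..<b}. f x \<noteq> g x}"
    by (rule negligible_subset) force
  then show ?thesis by (simp add: ae_eq_iff_negligible)
qed

lemma continuous_ae_eq_imp_eq:
  fixes f g :: "real \<Rightarrow> complex"
  assumes ae: "ae_eq {c<..<d} f g"
    and cont: "continuous_on {c<..<d} f" "continuous_on {c<..<d} g" and x: "x \<in> {c<..<d}"
  shows "f x = g x"
proof (rule ccontr)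
  assume ne: "f x \<noteq> g x"
  have "open ({c<..<d} \<inter> (\<lambda>x. f x - g x) -` (- {0}))"
    by (rule continuous_open_preimage) (use cont in \<open>auto intro!: continuous_intros\<close>)
  moreover have "{c<..<d} \<inter> (\<lambda>x. f x - g x) -` (- {0}) = {x \<in> {c<..<d}. f x \<noteq> g x}" by auto
  ultimately have "open {x \<in> {c<..<d}. f x \<noteq> g x}" by simp
  moreover have "negligible {x \<in> {c<..<d}. f x \<noteq> g x}"
    using ae by (simp add: ae_eq_iff_negligible)
  ultimately have "{x \<in> {c<..<d}. f x \<noteq> g x} = {}"
    using open_not_negligible by blast
  then show False using x ne by blast
qed

lemma ae_eq_measurable:
  assumes S: "S \<in> sets lebesgue" and ae: "ae_eq S f g" and g: "g \<in> borel_measurable (lebesgue_on S)"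
  shows "f \<in> borel_measurable (lebesgue_on S)"
proof (rule borel_measurableI)
  fix A :: "complex set" assume "open A"
  let ?N = "{x \<in> S. f x \<noteq> g x}"
  have sub: "T \<in> sets lebesgue" if "T \<subseteq> ?N" for T
  proof -
    have "negligible ?N" using ae S by (simp add: ae_eq_iff_negligible)
    then show ?thesis using that by (intro negligible_imp_sets) (rule negligible_subset)
  qed
  have "g -` A \<inter> S \<in> sets (lebesgue_on S)"
    using measurable_sets[OF g, of A] \<open>open A\<close> by (simp add: borel_open)
  then have "g -` A \<inter> S \<in> sets lebesgue"
    using S by (simp add: sets_restrict_space_iff)
  then have "(g -` A \<inter> S - ?N) \<union> (f -` A \<inter> ?N) \<in> sets lebesgue"
    using sub[of ?N] sub[of "f -` A \<inter> ?N"] by (intro sets.Un sets.Diff) auto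
  moreover have "f -` A \<inter> S = (g -` A \<inter> S - ?N) \<union> (f -` A \<inter> ?N)" by auto
  ultimately show "f -` A \<inter> space (lebesgue_on S) \<in> sets (lebesgue_on S)"
    using S by (auto simp: sets_restrict_space_iff)
qed

lemma bounded_measurable_in_L2:
  assumes S: "S \<in> lmeasurable" and f: "f \<in> borel_measurable (lebesgue_on S)"
    and B: "\<And>x. x \<in> S \<Longrightarrow> norm (f x) \<le> B"
  shows "f \<in> L2 unweighted S"
proof -
  interpret finite_measure "lebesgue_on S"
    using S by (rule finite_measure_lebesgue_on)
  have "integrable (lebesgue_on S) (\<lambda>x. 1 * (cmod (f x))\<^sup>2)"
  proof (rule integrable_const_bound[of _ "B\<^sup>2"])
    show "AE x in lebesgue_on S. norm (1 * (cmod (f x))\<^sup>2) \<le> B\<^sup>2"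
      by (rule AE_I2) (use B in \<open>auto intro!: power_mono\<close>)
    show "(\<lambda>x. 1 * (cmod (f x))\<^sup>2) \<in> borel_measurable (lebesgue_on S)"
      using f by measurable
  qed
  then show ?thesis using f by (simp add: L2_def)
qed

lemma continuous_on_Icc_in_L2:
  fixes f :: "real \<Rightarrow> complex"
  assumes "continuous_on {c..d} f"
  shows "f \<in> L2 unweighted {c<..<d}"
proof -
  have "bounded (f ` {c..d})"
    using assms by (intro compact_imp_bounded compact_continuous_image) auto
  then obtain B where B: "\<forall>z\<in>f ` {c..d}. norm z \<le> B" unfolding bounded_iff by blast
  show ?thesis
  proof (rule bounded_measurable_in_L2[of _ _ B])
    show "f \<in> borel_measurable (lebesgue_on {c<..<d})"
      by (rule continuous_imp_measurable_on_sets_lebesgue)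
         (auto intro: continuous_on_subset[OF assms])
  qed (use B in auto)
qed

lemma C1_imp_H1_deriv:
  assumes D: "\<And>x. x \<in> {c..d} \<Longrightarrow> (u has_vector_derivative v x) (at x within {c..d})"
    and v: "continuous_on {c..d} v"
  shows "H1_deriv c d u v"
  unfolding H1_deriv_def
proof (intro conjI ballI)
  show "v \<in> L2 unweighted {c<..<d}" by (rule continuous_on_Icc_in_L2[OF v])
  fix x assume x: "x \<in> {c..d}"
  show "(v has_integral (u x - u c)) {c..x}"
    using x by (intro fundamental_theorem_of_calculus)
       (auto intro: has_vector_derivative_within_subset[OF D])
qed

lemma H1_deriv_continuous:
  assumes "H1_deriv c d u v"
  shows "continuous_on {c..d} u"
proof (cases "c \<le> d")
  case True
  have "v integrable_on {c..d}"
    using assms True unfolding H1_deriv_def by (meson atLeastAtMost_iff has_integral_integrable order_refl)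
  then have "continuous_on {c..d} (\<lambda>x. u c + integral {c..x} v)"
    by (intro continuous_intros indefinite_integral_continuous_1)
  moreover have "u c + integral {c..x} v = u x" if "x \<in> {c..d}" for x
    using assms that unfolding H1_deriv_def by (auto dest!: bspec simp: integral_unique)
  ultimately show ?thesis by (rule continuous_on_eq)
qed simp

text \<open>A function whose weak derivative has a continuous representative is continuously differentiable. This
  turns the Sobolev formulation of the operators into classical differential equations.\<close>

lemma H1_deriv_C1:
  assumes H: "H1_deriv c d u v" and ae: "ae_eq {c<..<d} v g" and g: "continuous_on {c..d} g"
    and x: "x \<in> {c..d}"
  shows "(u has_vector_derivative g x) (at x within {c..d})"
proof -
  have *: "u t = u c + integral {c..t} g" if t: "t \<in> {c..d}" for t
  proof -
    have "(v has_integral (u t - u c)) {c..t}"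
      using H t by (auto simp: H1_deriv_def)
    moreover have "negligible ({x \<in> {c<..<d}. v x \<noteq> g x} \<union> {c, d})"
      using ae by (intro negligible_Un) (auto simp: ae_eq_iff_negligible)
    ultimately have "(g has_integral (u t - u c)) {c..t}"
      by (rule has_integral_spike[rotated 2]) (use t in auto)
    then show ?thesis by (simp add: integral_unique)
  qed
  have "((\<lambda>t. u c + integral {c..t} g) has_vector_derivative g x) (at x within {c..d})"
    by (rule derivative_eq_intros integral_has_vector_derivative[OF g x] refl)+ simp
  then show ?thesis
    by (rule has_vector_derivative_transform[OF x, rotated]) (rule *)
qed

context sl
begin

lemma y_cont: "continuous_on {c..d} (y \<omega>)" and yd_cont: "continuous_on {c..d} (yd \<omega>)"
  and w_cont: "continuous_on {c..d} (w \<omega>)" and wd_cont: "continuous_on {c..d} (wd \<omega>)"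
  by (meson y_deriv yd_deriv w_deriv wd_deriv DERIV_continuous continuous_on_eq_continuous_within)+

text \<open>Solutions in the Sobolev sense with a continuous right-hand side are classical.\<close>

lemma sl_expr_solution:
  assumes sl: "sl_expr c d p q u v F"
    and F: "ae_eq {c<..<d} F (\<lambda>x. \<omega> *\<^sub>R u x + y \<omega> x *\<^sub>R \<beta>)" and init: "u s = 0"
  obtains \<alpha> where "\<And>x. x \<in> {c..d} \<Longrightarrow> u x = sol \<omega> \<alpha> \<beta> x"
    "\<And>x. x \<in> {c..d} \<Longrightarrow> p x *\<^sub>R v x = flux \<omega> \<alpha> \<beta> x"
proof -
  obtain g h where uv: "H1_deriv c d u v" and vg: "H1_deriv c d v g"
    and h: "H1_deriv c d (\<lambda>x. of_real (p x) * v x) h"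
    and Fh: "ae_eq {c<..<d} F (\<lambda>x. - (1 / of_real (q x)) * h x)"
    using sl by (auto simp: sl_expr_def)
  have vc: "continuous_on {c..d} v" and uc: "continuous_on {c..d} u"
    using H1_deriv_continuous uv vg by auto
  let ?h = "\<lambda>x. (- q x) *\<^sub>R (\<omega> *\<^sub>R u x + y \<omega> x *\<^sub>R \<beta>)"
  have hae: "ae_eq {c<..<d} h ?h"
  proof -
    have "AE x in lebesgue_on {c<..<d}. - (1 / of_real (q x)) * h x = \<omega> *\<^sub>R u x + y \<omega> x *\<^sub>R \<beta>"
      using F Fh unfolding ae_eq_def by eventually_elim simp
    moreover have "AE x in lebesgue_on {c<..<d}. 0 < q x"
      by (rule AE_I2) (use q_pos in auto)
    ultimately have "AE x in lebesgue_on {c<..<d}. h x = ?h x"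
    proof eventually_elim
      case (elim x)
      then show ?case
        unfolding elim(1)[symmetric] by (simp add: scaleR_conv_of_real)
    qed
    then show ?thesis by (simp add: ae_eq_def)
  qed
  have U: "(u has_vector_derivative (1 / p x) *\<^sub>R (p x *\<^sub>R v x)) (at x within {c..d})"
    if "x \<in> {c..d}" for x
    using H1_deriv_C1[OF uv ae_eq_refl vc that] p_pos[OF that] by simp
  have W: "((\<lambda>x. p x *\<^sub>R v x) has_vector_derivative ?h x) (at x within {c..d})"
    if "x \<in> {c..d}" for x
    using H1_deriv_C1[OF h hae _ that]
    by (simp add: scaleR_conv_of_real continuous_intros q_cont uc y_cont)
  show ?thesis
    by (rule that[of "p s *\<^sub>R v s"]) (use solution_form[OF U W init] in auto)
qed

lemma sl_expr_of_solution:
  fixes \<omega> :: real and \<alpha> \<beta> :: complex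
  defines "u \<equiv> \<lambda>x. sol \<omega> \<alpha> \<beta> x"
    and "v \<equiv> \<lambda>x. (1 / p x) *\<^sub>R (flux \<omega> \<alpha> \<beta> x)"
  assumes F: "ae_eq {c<..<d} F (\<lambda>x. \<omega> *\<^sub>R u x + y \<omega> x *\<^sub>R \<beta>)"
  shows "sl_expr c d p q u v F"
proof -
  have p0: "\<forall>x\<in>{c..d}. p x \<noteq> 0" using p_pos by fastforce
  obtain p' where p': "continuous_on {c..d} p'"
    "\<And>x. x \<in> {c..d} \<Longrightarrow> (p has_real_derivative p' x) (at x within {c..d})"
    using p_C1 by blast
  let ?W = "\<lambda>x. flux \<omega> \<alpha> \<beta> x"
  let ?h = "\<lambda>x. (- q x) *\<^sub>R (\<omega> *\<^sub>R u x + y \<omega> x *\<^sub>R \<beta>)"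
  have uc: "continuous_on {c..d} u"
    unfolding u_def by (intro continuous_intros y_cont yd_cont)
  have W: "(?W has_vector_derivative ?h x) (at x within {c..d})" if "x \<in> {c..d}" for x
    unfolding u_def
    by (rule derivative_eq_intros w_deriv[OF that] wd_deriv[OF that] refl)+ (simp add: algebra_simps)
  have 1: "H1_deriv c d u v"
  proof (rule C1_imp_H1_deriv)
    show "(u has_vector_derivative v x) (at x within {c..d})" if "x \<in> {c..d}" for x
      unfolding u_def v_def
      by (rule derivative_eq_intros y_deriv[OF that] yd_deriv[OF that] refl)+
         (simp add: algebra_simps divide_inverse)
    show "continuous_on {c..d} v"
      unfolding v_def using p0 by (intro continuous_intros w_cont wd_cont p_cont) auto
  qed
  let ?g = "\<lambda>x. (1 / p x) *\<^sub>R ?h x + (- p' x / (p x)\<^sup>2) *\<^sub>R ?W x"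
  have 2: "H1_deriv c d v ?g"
  proof (rule C1_imp_H1_deriv)
    show "(v has_vector_derivative ?g x) (at x within {c..d})" if "x \<in> {c..d}" for x
    proof -
      have "((\<lambda>x. 1 / p x) has_real_derivative (- p' x / (p x)\<^sup>2)) (at x within {c..d})"
        by (rule derivative_eq_intros p'(2)[OF that] refl)+
           (use p_pos[OF that] in \<open>auto simp: power2_eq_square\<close>)
      from has_vector_derivative_scaleR[OF this W[OF that]]
      show ?thesis unfolding v_def .
    qed
    show "continuous_on {c..d} ?g"
      using p0 by (intro continuous_intros w_cont wd_cont p_cont q_cont uc y_cont p'(1)) auto
  qed
  have 3: "H1_deriv c d (\<lambda>x. of_real (p x) * v x) ?h"
  proof (rule C1_imp_H1_deriv)
    show "((\<lambda>x. of_real (p x) * v x) has_vector_derivative ?h x) (at x within {c..d})"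
      if "x \<in> {c..d}" for x
    proof (rule has_vector_derivative_transform[OF that _ W[OF that]])
      show "of_real (p x) * v x = ?W x" if "x \<in> {c..d}" for x
        using p_pos[OF that] by (simp add: v_def scaleR_conv_of_real)
    qed
    show "continuous_on {c..d} ?h"
      by (intro continuous_intros q_cont uc y_cont)
  qed
  have "AE x in lebesgue_on {c<..<d}. 0 < q x"
    by (rule AE_I2) (use q_pos in auto)
  then have "AE x in lebesgue_on {c<..<d}. F x = - (1 / of_real (q x)) * ?h x"
    using F[unfolded ae_eq_def] by eventually_elim (simp add: scaleR_conv_of_real)
  then have 4: "ae_eq {c<..<d} F (\<lambda>x. - (1 / of_real (q x)) * ?h x)"
    by (simp add: ae_eq_def)
  show ?thesis unfolding sl_expr_def using 1 2 3 4 by blast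
qed

end

section \<open>The characteristic equation of the perturbed problem\<close>

lemma singular_2x2:
  fixes p q r s :: real
  assumes "p * s = q * r"
  obtains \<alpha> \<beta> where "\<alpha> \<noteq> 0 \<or> \<beta> \<noteq> 0" "p * \<alpha> = q * \<beta>" "r * \<alpha> = s * \<beta>"
proof (cases "p = 0 \<and> q = 0")
  case True
  then show ?thesis
    using that[of s r] that[of 1 0] by (cases "s = 0 \<and> r = 0") (auto simp: mult.commute)
next
  case False
  then show ?thesis using that[of q p] assms by (auto simp: algebra_simps)
qed

locale transmission = left: sl a 0 a k r + right: sl 0 b b \<kappa> \<rho> for a b k r \<kappa> \<rho>
begin

lemma ab: "a < 0" "0 < b" using left.cd right.cd by auto

text \<open>An eigenfunction is \<open>\<alpha> left.y\<close> on the left and \<open>\<beta> right.y\<close> on the right. The two conditions at \<open>0\<close> form a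
  linear system for \<open>(\<alpha>, \<beta>)\<close> whose determinant is, up to sign, \<open>\<epsilon> char_A - char_B\<close>. The zeros of the factors of \<open>char_B\<close>
  are the eigenvalues of the two uncoupled problems.\<close>

definition char_A :: "real \<Rightarrow> real" where "char_A \<omega> = left.y \<omega> 0 * right.w \<omega> 0"
definition char_B :: "real \<Rightarrow> real" where "char_B \<omega> = left.w \<omega> 0 * right.y \<omega> 0"

lemma eigenfunction_form:
  assumes ef: "P_eigenfunction a b k r \<kappa> \<rho> \<epsilon> (of_real (\<epsilon> * \<omega>)) u" and eps: "0 < \<epsilon>"
  obtains \<alpha> \<beta> :: complex where
    "\<And>x. x \<in> {a..0} \<Longrightarrow> u x = left.y \<omega> x *\<^sub>R \<alpha>" "\<And>x. x \<in> {0..b} \<Longrightarrow> u x = right.y \<omega> x *\<^sub>R \<beta>"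
    "\<alpha> \<noteq> 0 \<or> \<beta> \<noteq> 0" "left.w \<omega> 0 *\<^sub>R \<alpha> = \<epsilon> *\<^sub>R (right.w \<omega> 0 *\<^sub>R \<beta>)"
proof -
  obtain v w where nz: "\<exists>x\<in>{a..b}. u x \<noteq> 0"
    and l: "\<And>x. x \<in> {a..0} \<Longrightarrow> (u has_vector_derivative v x) (at x within {a..0}) \<and>
        (\<exists>D. ((\<lambda>y. of_real (k y) * v y) has_vector_derivative D) (at x within {a..0}) \<and>
             D + of_real (1 / \<epsilon>) * of_real (\<epsilon> * \<omega>) * of_real (r x) * u x = 0)"
    and rr: "\<And>x. x \<in> {0..b} \<Longrightarrow> (u has_vector_derivative w x) (at x within {0..b}) \<and>
        (\<exists>D. ((\<lambda>y. of_real (\<kappa> y) * w y) has_vector_derivative D) (at x within {0..b}) \<and>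
             of_real \<epsilon> * D + of_real (\<epsilon> * \<omega>) * of_real (\<rho> x) * u x = 0)"
    and m: "of_real (k 0) * v 0 = of_real \<epsilon> * (of_real (\<kappa> 0) * w 0)" and bc: "u a = 0" "u b = 0"
    using ef unfolding P_eigenfunction_def by blast
  let ?L = "\<lambda>x. of_real (k x) * v x" and ?R = "\<lambda>x. of_real (\<kappa> x) * w x"
  have L1: "(u has_vector_derivative (1 / k x) *\<^sub>R ?L x) (at x within {a..0})" if "x \<in> {a..0}" for x
    using l[OF that] left.p_pos[OF that] by (simp add: scaleR_conv_of_real)
  have L2: "(?L has_vector_derivative (- r x) *\<^sub>R (\<omega> *\<^sub>R u x + left.y \<omega> x *\<^sub>R 0)) (at x within {a..0})"
    if x: "x \<in> {a..0}" for x
  proof -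
    obtain D where D: "(?L has_vector_derivative D) (at x within {a..0})"
      "D + of_real (1 / \<epsilon>) * of_real (\<epsilon> * \<omega>) * of_real (r x) * u x = 0"
      using l[OF x] by blast
    from D(2) eps have "D = (- r x) *\<^sub>R (\<omega> *\<^sub>R u x + left.y \<omega> x *\<^sub>R 0)"
      by (simp add: scaleR_conv_of_real eq_neg_iff_add_eq_0 mult_ac)
    with D(1) show ?thesis by simp
  qed
  have R1: "(u has_vector_derivative (1 / \<kappa> x) *\<^sub>R ?R x) (at x within {0..b})" if "x \<in> {0..b}" for x
    using rr[OF that] right.p_pos[OF that] by (simp add: scaleR_conv_of_real)
  have R2: "(?R has_vector_derivative (- \<rho> x) *\<^sub>R (\<omega> *\<^sub>R u x + right.y \<omega> x *\<^sub>R 0)) (at x within {0..b})"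
    if x: "x \<in> {0..b}" for x
  proof -
    obtain D where D: "(?R has_vector_derivative D) (at x within {0..b})"
      "of_real \<epsilon> * D + of_real (\<epsilon> * \<omega>) * of_real (\<rho> x) * u x = 0"
      using rr[OF x] by blast
    from D(2) have "of_real \<epsilon> * (D + of_real \<omega> * of_real (\<rho> x) * u x) = 0"
      by (simp add: algebra_simps)
    with eps have "D = (- \<rho> x) *\<^sub>R (\<omega> *\<^sub>R u x + right.y \<omega> x *\<^sub>R 0)"
      by (simp add: scaleR_conv_of_real eq_neg_iff_add_eq_0 mult_ac)
    with D(1) show ?thesis by simp
  qed
  have l_sol: "u x = left.y \<omega> x *\<^sub>R ?L a" "?L x = left.w \<omega> x *\<^sub>R ?L a" if "x \<in> {a..0}" for x
    using left.solution_form[OF L1 L2 bc(1) that] by auto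
  have r_sol: "u x = right.y \<omega> x *\<^sub>R ?R b" "?R x = right.w \<omega> x *\<^sub>R ?R b" if "x \<in> {0..b}" for x
    using right.solution_form[OF R1 R2 bc(2) that] by auto
  show ?thesis
  proof (rule that[of "?L a" "?R b"])
    show "?L a \<noteq> 0 \<or> ?R b \<noteq> 0"
    proof (rule ccontr)
      assume *: "\<not> ?thesis"
      obtain x where x: "x \<in> {a..b}" "u x \<noteq> 0" using nz by blast
      with * l_sol(1)[of x] r_sol(1)[of x] show False by (cases "x \<le> 0") auto
    qed
    show "left.w \<omega> 0 *\<^sub>R ?L a = \<epsilon> *\<^sub>R (right.w \<omega> 0 *\<^sub>R ?R b)"
      using m l_sol(2)[of 0] r_sol(2)[of 0] ab by (simp add: scaleR_conv_of_real)
  qed (rule l_sol(1) r_sol(1); assumption)+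
qed

lemma P_spectrum_iff:
  assumes eps: "0 < \<epsilon>"
  shows "complex_of_real (\<epsilon> * \<omega>) \<in> P_spectrum a b k r \<kappa> \<rho> \<epsilon> \<longleftrightarrow> \<epsilon> * char_A \<omega> = char_B \<omega>"
proof
  assume "complex_of_real (\<epsilon> * \<omega>) \<in> P_spectrum a b k r \<kappa> \<rho> \<epsilon>"
  then obtain u where ef: "P_eigenfunction a b k r \<kappa> \<rho> \<epsilon> (of_real (\<epsilon> * \<omega>)) u"
    by (auto simp: P_spectrum_def)
  obtain \<alpha> \<beta> :: complex where u:
    "\<And>x. x \<in> {a..0} \<Longrightarrow> u x = left.y \<omega> x *\<^sub>R \<alpha>" "\<And>x. x \<in> {0..b} \<Longrightarrow> u x = right.y \<omega> x *\<^sub>R \<beta>"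
    and nz: "\<alpha> \<noteq> 0 \<or> \<beta> \<noteq> 0" and w: "left.w \<omega> 0 *\<^sub>R \<alpha> = \<epsilon> *\<^sub>R (right.w \<omega> 0 *\<^sub>R \<beta>)"
    by (rule eigenfunction_form[OF ef eps]) blast
  have y: "left.y \<omega> 0 *\<^sub>R \<alpha> = right.y \<omega> 0 *\<^sub>R \<beta>" using u[of 0] ab by simp
  have "(\<epsilon> * char_A \<omega> - char_B \<omega>) *\<^sub>R \<alpha> =
      right.w \<omega> 0 *\<^sub>R \<epsilon> *\<^sub>R (left.y \<omega> 0 *\<^sub>R \<alpha>) - right.y \<omega> 0 *\<^sub>R (left.w \<omega> 0 *\<^sub>R \<alpha>)"
    by (simp add: char_A_def char_B_def scaleR_diff_left mult_ac)
  also have "\<dots> = 0" unfolding y w by (simp add: mult_ac)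
  finally have 1: "\<epsilon> * char_A \<omega> = char_B \<omega> \<or> \<alpha> = 0" by simp
  have "(\<epsilon> * char_A \<omega> - char_B \<omega>) *\<^sub>R \<beta> =
      left.y \<omega> 0 *\<^sub>R (\<epsilon> *\<^sub>R (right.w \<omega> 0 *\<^sub>R \<beta>)) - left.w \<omega> 0 *\<^sub>R (right.y \<omega> 0 *\<^sub>R \<beta>)"
    by (simp add: char_A_def char_B_def scaleR_diff_left mult_ac)
  also have "\<dots> = 0" unfolding y[symmetric] w[symmetric] by (simp add: mult_ac)
  finally have "\<epsilon> * char_A \<omega> = char_B \<omega> \<or> \<beta> = 0" by simp
  with 1 nz show "\<epsilon> * char_A \<omega> = char_B \<omega>" by blast
next
  assume "\<epsilon> * char_A \<omega> = char_B \<omega>"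
  then have "left.y \<omega> 0 * (\<epsilon> * right.w \<omega> 0) = right.y \<omega> 0 * left.w \<omega> 0"
    by (simp add: char_A_def char_B_def mult_ac)
  then obtain \<alpha> \<beta> where nz: "\<alpha> \<noteq> 0 \<or> \<beta> \<noteq> 0"
    and y0: "left.y \<omega> 0 * \<alpha> = right.y \<omega> 0 * \<beta>" and w0: "left.w \<omega> 0 * \<alpha> = (\<epsilon> * right.w \<omega> 0) * \<beta>"
    by (rule singular_2x2)
  define u where "u x = complex_of_real (if x \<le> 0 then \<alpha> * left.y \<omega> x else \<beta> * right.y \<omega> x)" for x
  have ur: "u x = complex_of_real (\<beta> * right.y \<omega> x)" if "x \<in> {0..b}" for x
    using that y0 by (cases "x = 0") (auto simp: u_def mult.commute)
  have ul: "u x = complex_of_real (\<alpha> * left.y \<omega> x)" if "x \<in> {a..0}" for x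
    using that by (auto simp: u_def)
  have "P_eigenfunction a b k r \<kappa> \<rho> \<epsilon> (of_real (\<epsilon> * \<omega>)) u"
    unfolding P_eigenfunction_def
  proof (intro conjI exI ballI)
    show "\<exists>x\<in>{a..b}. u x \<noteq> 0"
    proof (cases "\<alpha> = 0")
      case False
      obtain x where "a < x" "x < 0" "left.y \<omega> x \<noteq> 0" using left.y_nonzero_inside by blast
      then show ?thesis using ul[of x] False ab by (intro bexI[of _ x]) auto
    next
      case True
      obtain x where "0 < x" "x < b" "right.y \<omega> x \<noteq> 0" using right.y_nonzero_inside by blast
      then show ?thesis using ur[of x] True nz ab by (intro bexI[of _ x]) auto
    qed
    let ?v = "\<lambda>x. complex_of_real (\<alpha> * (left.w \<omega> x / k x))"
    let ?w = "\<lambda>x. complex_of_real (\<beta> * (right.w \<omega> x / \<kappa> x))"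
    note cr = has_vector_derivative_of_real[OF DERIV_cmult]
    show "(u has_vector_derivative ?v x) (at x within {a..0})" if "x \<in> {a..0}" for x
      by (rule has_vector_derivative_transform[OF that ul cr[OF left.y_deriv[OF that]]])
    show "(u has_vector_derivative ?w x) (at x within {0..b})" if "x \<in> {0..b}" for x
      by (rule has_vector_derivative_transform[OF that ur cr[OF right.y_deriv[OF that]]])
    show "((\<lambda>x. of_real (k x) * ?v x) has_vector_derivative of_real (\<alpha> * (- r x * (\<omega> * left.y \<omega> x))))
        (at x within {a..0})" if "x \<in> {a..0}" for x
    proof (rule has_vector_derivative_transform[OF that _ cr[OF left.w_deriv[OF that]]])
      show "of_real (k x) * ?v x = of_real (\<alpha> * left.w \<omega> x)" if "x \<in> {a..0}" for x
        using left.p_pos[OF that] by simp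
    qed
    show "((\<lambda>x. of_real (\<kappa> x) * ?w x) has_vector_derivative of_real (\<beta> * (- \<rho> x * (\<omega> * right.y \<omega> x))))
        (at x within {0..b})" if "x \<in> {0..b}" for x
    proof (rule has_vector_derivative_transform[OF that _ cr[OF right.w_deriv[OF that]]])
      show "of_real (\<kappa> x) * ?w x = of_real (\<beta> * right.w \<omega> x)" if "x \<in> {0..b}" for x
        using right.p_pos[OF that] by simp
    qed
    show "of_real (\<alpha> * (- r x * (\<omega> * left.y \<omega> x))) + of_real (1 / \<epsilon>) * of_real (\<epsilon> * \<omega>) * of_real (r x) * u x = 0"
      if "x \<in> {a..0}" for x
      unfolding ul[OF that] of_real_mult[symmetric] of_real_add[symmetric] using eps by simp
    show "of_real \<epsilon> * of_real (\<beta> * (- \<rho> x * (\<omega> * right.y \<omega> x))) + of_real (\<epsilon> * \<omega>) * of_real (\<rho> x) * u x = 0"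
      if "x \<in> {0..b}" for x
      unfolding ur[OF that] of_real_mult[symmetric] of_real_add[symmetric] by simp
    show "of_real (k 0) * ?v 0 = of_real \<epsilon> * (of_real (\<kappa> 0) * ?w 0)"
      unfolding of_real_mult[symmetric]
      using w0 left.p_pos[of 0] right.p_pos[of 0] ab by (simp add: mult_ac)
    show "u a = 0" using ul[of a] ab left.initial by simp
    show "u b = 0" using ur[of b] ab right.initial by simp
  qed
  then show "complex_of_real (\<epsilon> * \<omega>) \<in> P_spectrum a b k r \<kappa> \<rho> \<epsilon>"
    by (auto simp: P_spectrum_def)
qed

lemma left_energy: "\<omega> \<le> 0 \<Longrightarrow> 0 < left.y \<omega> 0 * left.w \<omega> 0"
  using left.energy_increasing[of \<omega>] left.initial by simp

lemma right_energy: "\<omega> \<le> 0 \<Longrightarrow> right.y \<omega> 0 * right.w \<omega> 0 < 0"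
  using right.energy_increasing[of \<omega>] right.initial by simp

lemma no_nonpositive_roots:
  assumes "0 < \<epsilon>" "\<epsilon> * char_A \<omega> = char_B \<omega>"
  shows "0 < \<omega>"
proof (rule ccontr)
  assume "\<not> 0 < \<omega>"
  then have e: "0 < left.y \<omega> 0 * left.w \<omega> 0" "right.y \<omega> 0 * right.w \<omega> 0 < 0"
    using left_energy right_energy by auto
  have "\<epsilon> * ((left.y \<omega> 0 * left.w \<omega> 0) * (right.y \<omega> 0 * right.w \<omega> 0)) =
      (\<epsilon> * char_A \<omega>) * (left.w \<omega> 0 * right.y \<omega> 0)"
    by (simp add: char_A_def mult_ac)
  also have "\<dots> = (char_B \<omega>)\<^sup>2" using assms(2) by (simp add: char_B_def power2_eq_square)
  also have "\<dots> > 0" using e by (auto simp: char_B_def)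
  finally have "0 < \<epsilon> * ((left.y \<omega> 0 * left.w \<omega> 0) * (right.y \<omega> 0 * right.w \<omega> 0))" .
  moreover have "\<epsilon> * ((left.y \<omega> 0 * left.w \<omega> 0) * (right.y \<omega> 0 * right.w \<omega> 0)) \<le> 0"
    by (rule mult_nonneg_nonpos[OF less_imp_le[OF assms(1)] less_imp_le[OF mult_pos_neg[OF e]]])
  ultimately show False by simp
qed

text \<open>The particular solution \<open>(\<alpha>, \<beta>) = (right.y(0), left.y(0))\<close> of the continuity condition. It depends smoothly
  on \<open>\<omega>\<close> and spans the eigenspace as long as \<open>left.y(0) \<noteq> 0\<close>, which holds near every double eigenvalue.\<close>

definition eigen_family :: "real \<Rightarrow> real \<Rightarrow> real" where
  "eigen_family \<omega> x =
     (if x < 0 then right.y \<omega> 0 * left.y \<omega> x else left.y \<omega> 0 * right.y \<omega> x)"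

lemma eigenfunction_in_family:
  assumes ef: "P_eigenfunction a b k r \<kappa> \<rho> \<epsilon> (of_real (\<epsilon> * \<omega>)) u" and eps: "0 < \<epsilon>"
    and nz: "left.y \<omega> 0 \<noteq> 0"
  obtains \<gamma> where "\<gamma> \<noteq> 0" "\<And>x. x \<in> {a..b} \<Longrightarrow> u x = \<gamma> * of_real (eigen_family \<omega> x)"
proof -
  obtain \<alpha> \<beta> :: complex where u:
    "\<And>x. x \<in> {a..0} \<Longrightarrow> u x = left.y \<omega> x *\<^sub>R \<alpha>" "\<And>x. x \<in> {0..b} \<Longrightarrow> u x = right.y \<omega> x *\<^sub>R \<beta>"
    and ab0: "\<alpha> \<noteq> 0 \<or> \<beta> \<noteq> 0"
    by (rule eigenfunction_form[OF ef eps]) blast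
  have y: "left.y \<omega> 0 *\<^sub>R \<alpha> = right.y \<omega> 0 *\<^sub>R \<beta>" using u[of 0] ab by simp
  then have "(1 / left.y \<omega> 0) *\<^sub>R (left.y \<omega> 0 *\<^sub>R \<alpha>) = (1 / left.y \<omega> 0) *\<^sub>R (right.y \<omega> 0 *\<^sub>R \<beta>)" by simp
  then have \<alpha>: "\<alpha> = (right.y \<omega> 0 / left.y \<omega> 0) *\<^sub>R \<beta>" using nz by simp
  show ?thesis
  proof (rule that[of "\<beta> / of_real (left.y \<omega> 0)"])
    show "\<beta> / of_real (left.y \<omega> 0) \<noteq> 0" using ab0 \<alpha> nz by auto
    show "u x = \<beta> / of_real (left.y \<omega> 0) * of_real (eigen_family \<omega> x)" if "x \<in> {a..b}" for x
      using u[of x] that nz \<alpha> by (auto simp: eigen_family_def scaleR_conv_of_real)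
  qed
qed

end

section \<open>Root subspaces of the limit operator\<close>

text \<open>A set that contains the null functions and all preimages of its elements under \<open>T - z\<close> contains the whole
  root subspace; chains of length two are all that ever occurs below.\<close>

lemma root_subspace_eqI:
  assumes null: "\<And>U. ae_eq S U (\<lambda>_. 0) \<Longrightarrow> U \<in> E"
    and step: "\<And>U G. op_shift T z U G \<Longrightarrow> G \<in> E \<Longrightarrow> U \<in> E"
    and ex: "\<And>U. U \<in> E \<Longrightarrow> \<exists>G H. op_shift T z U G \<and> op_shift T z G H \<and> ae_eq S H (\<lambda>_. 0)"
  shows "root_subspace S T z = E"
proof
  have "U \<in> E" if "(op_shift T z ^^ n) U f" "ae_eq S f (\<lambda>_. 0)" for n U f
    using that
  proof (induction n arbitrary: U)
    case 0
    then show ?case using null by simp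
  next
    case (Suc n)
    then obtain G where "op_shift T z U G" "(op_shift T z ^^ n) G f"
      using relpowp_Suc_D2[OF Suc.prems(1)] by blast
    then show ?case using Suc step by blast
  qed
  then show "root_subspace S T z \<subseteq> E"
    by (auto simp: root_subspace_def op_kernel_def)
  show "E \<subseteq> root_subspace S T z"
  proof
    fix U assume "U \<in> E"
    then obtain G H where "op_shift T z U G" "op_shift T z G H" "ae_eq S H (\<lambda>_. 0)"
      using ex by blast
    moreover from this have "(op_shift T z ^^ 2) U H"
      by (auto simp: numeral_2_eq_2)
    ultimately show "U \<in> root_subspace S T z"
      unfolding root_subspace_def op_kernel_def by (intro UN_I[of 2]) auto
  qed
qed

definition ae_span :: "real set \<Rightarrow> nat \<Rightarrow> (nat \<Rightarrow> real \<Rightarrow> complex) \<Rightarrow> (real \<Rightarrow> complex) set" where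
  "ae_span S n e = {f. \<exists>c :: nat \<Rightarrow> complex. ae_eq S f (\<lambda>x. \<Sum>i<n. c i * e i x)}"

lemma has_dimension_ae_span:
  assumes "\<And>c :: nat \<Rightarrow> complex. ae_eq S (\<lambda>x. \<Sum>i<n. c i * e i x) (\<lambda>_. 0) \<Longrightarrow> \<forall>i<n. c i = 0"
  shows "has_dimension S (ae_span S n e) n"
  unfolding has_dimension_def
proof (intro exI[of _ e] conjI allI impI ballI)
  fix i assume "i < n"
  then have "(\<Sum>j<n. (if j = i then 1 else 0) * e j x) = e i x" for x
    by (simp add: if_distrib[of "\<lambda>c. c * _"] cong: if_cong)
  then show "e i \<in> ae_span S n e"
    unfolding ae_span_def by (auto intro!: exI[of _ "\<lambda>j. if j = i then 1 else 0"] ae_eqI)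
qed (use assms in \<open>auto simp: ae_span_def\<close>)

context transmission
begin

abbreviation "op \<equiv> op_A a b k r \<kappa> \<rho>"

lemma ae_restrict:
  assumes "ae_eq {a<..<b} f g"
  shows "ae_eq {a<..<0} f g" "ae_eq {0<..<b} f g"
  using assms ab by (auto intro: ae_eq_subset)

lemma shift_components:
  assumes "op_shift op (of_real \<omega>) U G"
  obtains F u1 v1 u2 v2 where "G = (\<lambda>x. F x - of_real \<omega> * U x)"
    "ae_eq {a<..<0} U u1" "ae_eq {0<..<b} U u2" "sl_expr a 0 k r u1 v1 F" "sl_expr 0 b \<kappa> \<rho> u2 v2 F"
    "u1 a = 0" "v1 0 = 0" "u2 b = 0" "u1 0 = u2 0"
  using assms by (auto simp: op_shift_def op_A_def)

lemma shifted_equation: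
  assumes "ae_eq I U u" "ae_eq I (\<lambda>x. F x - of_real \<omega> * U x) g"
  shows "ae_eq I F (\<lambda>x. \<omega> *\<^sub>R u x + g x)"
  using assms unfolding ae_eq_def
  by eventually_elim (simp only: diff_eq_eq scaleR_conv_of_real, simp only: add.commute)

lemma shift_left:
  assumes UG: "op_shift op (of_real \<omega>) U G" and Gl: "ae_eq {a<..<0} G (\<lambda>x. left.y \<omega> x *\<^sub>R \<beta>)"
  obtains \<alpha> where "left.flux \<omega> \<alpha> \<beta> 0 = 0"
proof -
  obtain F u1 v1 where G: "G = (\<lambda>x. F x - of_real \<omega> * U x)" and U: "ae_eq {a<..<0} U u1"
    and sl: "sl_expr a 0 k r u1 v1 F" and bc: "u1 a = 0" "v1 0 = 0"
    by (rule shift_components[OF UG]) blast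
  obtain \<alpha> where "\<And>x. x \<in> {a..0} \<Longrightarrow> k x *\<^sub>R v1 x = left.flux \<omega> \<alpha> \<beta> x"
    by (rule left.sl_expr_solution[OF sl shifted_equation[OF U Gl[unfolded G]] bc(1)]) blast
  from this[of 0] bc(2) ab show ?thesis by (intro that[of \<alpha>]) simp
qed

text \<open>The equation \<open>(A - \<omega>) U = G\<close> is solved for those \<open>G\<close> that are multiples of the solutions on each side.\<close>

lemma shift_both:
  assumes UG: "op_shift op (of_real \<omega>) U G" and Gl: "ae_eq {a<..<0} G (\<lambda>x. left.y \<omega> x *\<^sub>R \<beta>)"
    and Gr: "ae_eq {0<..<b} G (\<lambda>x. right.y \<omega> x *\<^sub>R \<delta>)"
  obtains \<alpha> \<gamma> where "ae_eq {a<..<0} U (\<lambda>x. left.sol \<omega> \<alpha> \<beta> x)"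
    "ae_eq {0<..<b} U (\<lambda>x. right.sol \<omega> \<gamma> \<delta> x)"
    "left.flux \<omega> \<alpha> \<beta> 0 = 0" "left.sol \<omega> \<alpha> \<beta> 0 = right.sol \<omega> \<gamma> \<delta> 0"
proof -
  obtain F u1 v1 u2 v2 where G: "G = (\<lambda>x. F x - of_real \<omega> * U x)"
    and U: "ae_eq {a<..<0} U u1" "ae_eq {0<..<b} U u2"
    and sl: "sl_expr a 0 k r u1 v1 F" "sl_expr 0 b \<kappa> \<rho> u2 v2 F"
    and bc: "u1 a = 0" "v1 0 = 0" "u2 b = 0" "u1 0 = u2 0"
    by (rule shift_components[OF UG]) blast
  obtain \<alpha> where \<alpha>: "\<And>x. x \<in> {a..0} \<Longrightarrow> u1 x = left.sol \<omega> \<alpha> \<beta> x"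
      "\<And>x. x \<in> {a..0} \<Longrightarrow> k x *\<^sub>R v1 x = left.flux \<omega> \<alpha> \<beta> x"
    by (rule left.sl_expr_solution[OF sl(1) shifted_equation[OF U(1) Gl[unfolded G]] bc(1)]) blast
  obtain \<gamma> where \<gamma>: "\<And>x. x \<in> {0..b} \<Longrightarrow> u2 x = right.sol \<omega> \<gamma> \<delta> x"
    by (rule right.sl_expr_solution[OF sl(2) shifted_equation[OF U(2) Gr[unfolded G]] bc(3)]) blast
  show ?thesis
  proof (rule that)
    show "ae_eq {a<..<0} U (\<lambda>x. left.sol \<omega> \<alpha> \<beta> x)"
      by (rule ae_eq_trans[OF U(1) ae_eqI]) (use \<alpha>(1) in auto)
    show "ae_eq {0<..<b} U (\<lambda>x. right.sol \<omega> \<gamma> \<delta> x)"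
      by (rule ae_eq_trans[OF U(2) ae_eqI]) (use \<gamma> in auto)
    show "left.flux \<omega> \<alpha> \<beta> 0 = 0" using \<alpha>(2)[of 0] bc(2) ab by simp
    show "left.sol \<omega> \<alpha> \<beta> 0 = right.sol \<omega> \<gamma> \<delta> 0"
      using \<alpha>(1)[of 0] \<gamma>[of 0] bc(4) ab by simp
  qed
qed

lemma shift_of_solution:
  fixes \<alpha> \<beta> \<gamma> \<delta> :: complex
  assumes U: "ae_eq {a<..<0} U (\<lambda>x. left.sol \<omega> \<alpha> \<beta> x)"
    "ae_eq {0<..<b} U (\<lambda>x. right.sol \<omega> \<gamma> \<delta> x)"
    and "left.flux \<omega> \<alpha> \<beta> 0 = 0"
    and "left.sol \<omega> \<alpha> \<beta> 0 = right.sol \<omega> \<gamma> \<delta> 0"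
  shows "op_shift op (of_real \<omega>) U (\<lambda>x. if x < 0 then left.y \<omega> x *\<^sub>R \<beta> else right.y \<omega> x *\<^sub>R \<delta>)"
    (is "op_shift _ _ _ ?G")
proof -
  define G where "G = ?G"
  let ?F = "\<lambda>x. G x + of_real \<omega> * U x"
  let ?u1 = "\<lambda>x. left.sol \<omega> \<alpha> \<beta> x"
  let ?u2 = "\<lambda>x. right.sol \<omega> \<gamma> \<delta> x"
  have G: "ae_eq {a<..<0} G (\<lambda>x. left.y \<omega> x *\<^sub>R \<beta>)" "ae_eq {0<..<b} G (\<lambda>x. right.y \<omega> x *\<^sub>R \<delta>)"
    by (auto intro!: ae_eqI simp: G_def)
  have F: "ae_eq {a<..<0} ?F (\<lambda>x. \<omega> *\<^sub>R ?u1 x + left.y \<omega> x *\<^sub>R \<beta>)"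
    using U(1) G(1) unfolding ae_eq_def
    by eventually_elim (simp add: scaleR_conv_of_real)
  have F': "ae_eq {0<..<b} ?F (\<lambda>x. \<omega> *\<^sub>R ?u2 x + right.y \<omega> x *\<^sub>R \<delta>)"
    using U(2) G(2) unfolding ae_eq_def
    by eventually_elim (simp add: scaleR_conv_of_real)
  note sl = left.sl_expr_of_solution[OF F] right.sl_expr_of_solution[OF F']
  have "op U ?F"
    unfolding op_A_def
  proof (intro exI conjI)
    show "sl_expr a 0 k r ?u1 (\<lambda>x. (1 / k x) *\<^sub>R (left.flux \<omega> \<alpha> \<beta> x)) ?F"
      by (rule sl(1))
    show "sl_expr 0 b \<kappa> \<rho> ?u2 (\<lambda>x. (1 / \<kappa> x) *\<^sub>R (right.flux \<omega> \<gamma> \<delta> x)) ?F"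
      by (rule sl(2))
  qed (use assms left.initial right.initial in simp_all)
  then show ?thesis unfolding op_shift_def G_def by (intro exI[of _ ?F]) (auto simp: G_def)
qed

text \<open>At an eigenvalue of either uncoupled problem the Wronskian reduces to a single product.\<close>

lemma left_wronskian: "left.w \<omega> 0 = 0 \<Longrightarrow> left.wd \<omega> 0 * left.y \<omega> 0 < 0"
  using left.wronskian_omega_decreasing[of \<omega>] left.initial by simp

lemma right_wronskian: "right.y \<omega> 0 = 0 \<Longrightarrow> right.yd \<omega> 0 * right.w \<omega> 0 < 0"
  using right.wronskian_omega_decreasing[of \<omega>] right.initial by (simp add: mult.commute)

definition eigen_family_deriv :: "real \<Rightarrow> real \<Rightarrow> real" where
  "eigen_family_deriv \<omega> x =
     (if x < 0 then right.yd \<omega> 0 * left.y \<omega> x + right.y \<omega> 0 * left.yd \<omega> x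
      else left.yd \<omega> 0 * right.y \<omega> x + left.y \<omega> 0 * right.yd \<omega> x)"

definition dirichlet_mode :: "real \<Rightarrow> real \<Rightarrow> real" where
  "dirichlet_mode \<omega> x = (if x < 0 then 0 else right.y \<omega> x)"

lemma scaled_solution_ae_zero:
  fixes \<alpha> :: complex
  shows "ae_eq {a<..<0} (\<lambda>x. left.y \<omega> x *\<^sub>R \<alpha>) (\<lambda>_. 0) \<Longrightarrow> \<alpha> = 0"
    and "ae_eq {0<..<b} (\<lambda>x. right.y \<omega> x *\<^sub>R \<alpha>) (\<lambda>_. 0) \<Longrightarrow> \<alpha> = 0"
proof -
  assume ae: "ae_eq {a<..<0} (\<lambda>x. left.y \<omega> x *\<^sub>R \<alpha>) (\<lambda>_. 0)"
  obtain x where "a < x" "x < 0" "left.y \<omega> x \<noteq> 0" using left.y_nonzero_inside by blast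
  moreover have "continuous_on {a<..<0} (\<lambda>x. left.y \<omega> x *\<^sub>R \<alpha>)"
    by (intro continuous_intros continuous_on_subset[OF left.y_cont]) auto
  ultimately show "\<alpha> = 0" using continuous_ae_eq_imp_eq[OF ae, of x] by simp
next
  assume ae: "ae_eq {0<..<b} (\<lambda>x. right.y \<omega> x *\<^sub>R \<alpha>) (\<lambda>_. 0)"
  obtain x where "0 < x" "x < b" "right.y \<omega> x \<noteq> 0" using right.y_nonzero_inside by blast
  moreover have "continuous_on {0<..<b} (\<lambda>x. right.y \<omega> x *\<^sub>R \<alpha>)"
    by (intro continuous_intros continuous_on_subset[OF right.y_cont]) auto
  ultimately show "\<alpha> = 0" using continuous_ae_eq_imp_eq[OF ae, of x] by simp
qed

lemma shift_null:
  assumes "ae_eq {a<..<b} H (\<lambda>_. 0)"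
  shows "\<exists>H'. op_shift op (of_real \<omega>) H H' \<and> ae_eq {a<..<b} H' (\<lambda>_. 0)"
  using shift_of_solution[of H \<omega> 0 0 0 0] ae_restrict[OF assms]
  by (intro exI conjI, assumption?) (auto simp: ae_eqI)

lemma root_subspace_resolvent:
  assumes "left.w \<omega> 0 \<noteq> 0" "right.y \<omega> 0 \<noteq> 0"
  shows "root_subspace {a<..<b} op (of_real \<omega>) = ae_span {a<..<b} 0 e"
proof (rule root_subspace_eqI)
  fix U G assume UG: "op_shift op (of_real \<omega>) U G" and "G \<in> ae_span {a<..<b} 0 e"
  then have "ae_eq {a<..<b} G (\<lambda>_. 0)" by (simp add: ae_span_def)
  note G = ae_restrict[OF this]
  obtain \<alpha> \<gamma> where
    "ae_eq {a<..<0} U (\<lambda>x. left.sol \<omega> \<alpha> 0 x)"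
    "ae_eq {0<..<b} U (\<lambda>x. right.sol \<omega> \<gamma> 0 x)"
    "left.flux \<omega> \<alpha> 0 0 = 0"
    "left.sol \<omega> \<alpha> 0 0 = right.sol \<omega> \<gamma> 0 0"
    by (rule shift_both[OF UG, of 0 0]) (use G in auto)
  with assms have "ae_eq {a<..<0} U (\<lambda>_. 0)" "ae_eq {0<..<b} U (\<lambda>_. 0)" by auto
  then show "U \<in> ae_span {a<..<b} 0 e" by (simp add: ae_span_def ae_eq_glue)
next
  fix U assume "U \<in> ae_span {a<..<b} 0 e"
  then have "ae_eq {a<..<b} U (\<lambda>_. 0)" by (simp add: ae_span_def)
  then show "\<exists>G H. op_shift op (of_real \<omega>) U G \<and> op_shift op (of_real \<omega>) G H \<and> ae_eq {a<..<b} H (\<lambda>_. 0)"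
    using shift_null by metis
qed (simp add: ae_span_def)

lemma ae_span_1: "f \<in> ae_span S 1 (\<lambda>_ x. of_real (e x)) \<longleftrightarrow> (\<exists>c. ae_eq S f (\<lambda>x. e x *\<^sub>R c))"
  unfolding ae_span_def
  by (auto simp: scaleR_conv_of_real mult.commute intro: exI[of _ "\<lambda>_. _"])

text \<open>The flux condition \<open>\<alpha> w + \<beta> wd = 0\<close> at \<open>0\<close> with \<open>w = 0 \<noteq> wd\<close> forbids generalized eigenfunctions.\<close>

lemma root_subspace_left:
  assumes z: "left.w \<omega> 0 = 0" "right.y \<omega> 0 \<noteq> 0"
  shows "root_subspace {a<..<b} op (of_real \<omega>) = ae_span {a<..<b} 1 (\<lambda>_ x. of_real (eigen_family \<omega> x))"
    (is "_ = ?E")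
proof (rule root_subspace_eqI)
  fix U :: "real \<Rightarrow> complex" assume "ae_eq {a<..<b} U (\<lambda>_. 0)"
  then show "U \<in> ?E" unfolding ae_span_1 by (intro exI[of _ 0]) simp
next
  fix U G assume UG: "op_shift op (of_real \<omega>) U G" and "G \<in> ?E"
  then obtain c where G: "ae_eq {a<..<b} G (\<lambda>x. eigen_family \<omega> x *\<^sub>R c)" unfolding ae_span_1 by blast
  have Gl: "ae_eq {a<..<0} G (\<lambda>x. left.y \<omega> x *\<^sub>R (right.y \<omega> 0 *\<^sub>R c))"
    by (rule ae_eq_trans[OF ae_restrict(1)[OF G] ae_eqI]) (simp add: eigen_family_def)
  obtain \<alpha> where "left.flux \<omega> \<alpha> (right.y \<omega> 0 *\<^sub>R c) 0 = 0"
    by (rule shift_left[OF UG Gl])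
  then have c: "c = 0" using z left_wronskian[OF z(1)] by auto
  have G0: "ae_eq {a<..<0} G (\<lambda>x. left.y \<omega> x *\<^sub>R 0)" "ae_eq {0<..<b} G (\<lambda>x. right.y \<omega> x *\<^sub>R 0)"
    using ae_restrict[OF G] c by auto
  obtain \<alpha> \<gamma> where
    U: "ae_eq {a<..<0} U (\<lambda>x. left.sol \<omega> \<alpha> 0 x)"
    "ae_eq {0<..<b} U (\<lambda>x. right.sol \<omega> \<gamma> 0 x)"
    and y: "left.sol \<omega> \<alpha> 0 0 = right.sol \<omega> \<gamma> 0 0"
    by (rule shift_both[OF UG G0])
  from y have "(1 / right.y \<omega> 0) *\<^sub>R (left.y \<omega> 0 *\<^sub>R \<alpha>) = (1 / right.y \<omega> 0) *\<^sub>R (right.y \<omega> 0 *\<^sub>R \<gamma>)" by simp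
  then have \<gamma>: "\<gamma> = (left.y \<omega> 0 / right.y \<omega> 0) *\<^sub>R \<alpha>" using z by simp
  let ?u = "\<lambda>x. eigen_family \<omega> x *\<^sub>R ((1 / right.y \<omega> 0) *\<^sub>R \<alpha>)"
  have "ae_eq {a<..<b} U ?u"
    by (rule ae_eq_glue; rule ae_eq_trans[OF _ ae_eqI], rule U)
       (use z in \<open>auto simp: eigen_family_def \<gamma>\<close>)
  then show "U \<in> ?E" unfolding ae_span_1 by blast
next
  fix U assume "U \<in> ?E"
  then obtain c where U: "ae_eq {a<..<b} U (\<lambda>x. eigen_family \<omega> x *\<^sub>R c)" unfolding ae_span_1 by blast
  have "op_shift op (of_real \<omega>) U (\<lambda>x. if x < 0 then left.y \<omega> x *\<^sub>R 0 else right.y \<omega> x *\<^sub>R 0)"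
  proof (rule shift_of_solution[where \<alpha> = "right.y \<omega> 0 *\<^sub>R c" and \<gamma> = "left.y \<omega> 0 *\<^sub>R c"])
    show "ae_eq {a<..<0} U (\<lambda>x. left.sol \<omega> (right.y \<omega> 0 *\<^sub>R c) 0 x)"
      by (rule ae_eq_trans[OF ae_restrict(1)[OF U] ae_eqI]) (simp add: eigen_family_def)
    show "ae_eq {0<..<b} U (\<lambda>x. right.sol \<omega> (left.y \<omega> 0 *\<^sub>R c) 0 x)"
      by (rule ae_eq_trans[OF ae_restrict(2)[OF U] ae_eqI]) (simp add: eigen_family_def)
  qed (simp_all add: z)
  then show "\<exists>G H. op_shift op (of_real \<omega>) U G \<and> op_shift op (of_real \<omega>) G H \<and> ae_eq {a<..<b} H (\<lambda>_. 0)"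
    using shift_null[of "\<lambda>x. if x < 0 then left.y \<omega> x *\<^sub>R 0 else right.y \<omega> x *\<^sub>R 0" \<omega>] by (auto simp: ae_eqI)
qed

text \<open>Here the left component vanishes, and the Dirichlet condition with \<open>right.y = 0 \<noteq> right.yd\<close> forbids
  generalized eigenfunctions.\<close>

lemma root_subspace_right:
  assumes z: "left.w \<omega> 0 \<noteq> 0" "right.y \<omega> 0 = 0"
  shows "root_subspace {a<..<b} op (of_real \<omega>) = ae_span {a<..<b} 1 (\<lambda>_ x. of_real (dirichlet_mode \<omega> x))"
    (is "_ = ?E")
proof (rule root_subspace_eqI)
  fix U :: "real \<Rightarrow> complex" assume "ae_eq {a<..<b} U (\<lambda>_. 0)"
  then show "U \<in> ?E" unfolding ae_span_1 by (intro exI[of _ 0]) simp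
next
  fix U G assume UG: "op_shift op (of_real \<omega>) U G" and "G \<in> ?E"
  then obtain c where G: "ae_eq {a<..<b} G (\<lambda>x. dirichlet_mode \<omega> x *\<^sub>R c)" unfolding ae_span_1 by blast
  have Gl: "ae_eq {a<..<0} G (\<lambda>x. left.y \<omega> x *\<^sub>R 0)"
    by (rule ae_eq_trans[OF ae_restrict(1)[OF G] ae_eqI]) (simp add: dirichlet_mode_def)
  have Gr: "ae_eq {0<..<b} G (\<lambda>x. right.y \<omega> x *\<^sub>R c)"
    by (rule ae_eq_trans[OF ae_restrict(2)[OF G] ae_eqI]) (simp add: dirichlet_mode_def)
  obtain \<alpha> \<gamma> where
    U: "ae_eq {a<..<0} U (\<lambda>x. left.sol \<omega> \<alpha> 0 x)"
    "ae_eq {0<..<b} U (\<lambda>x. right.sol \<omega> \<gamma> c x)"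
    and w: "left.flux \<omega> \<alpha> 0 0 = 0"
    and y: "left.sol \<omega> \<alpha> 0 0 = right.sol \<omega> \<gamma> c 0"
    by (rule shift_both[OF UG Gl Gr])
  have \<alpha>: "\<alpha> = 0" using w z by simp
  have c: "c = 0" using y z \<alpha> right_wronskian[OF z(2)] by auto
  have "ae_eq {a<..<b} U (\<lambda>x. dirichlet_mode \<omega> x *\<^sub>R \<gamma>)"
    by (rule ae_eq_glue; rule ae_eq_trans[OF _ ae_eqI], rule U)
       (auto simp: dirichlet_mode_def \<alpha> c)
  then show "U \<in> ?E" unfolding ae_span_1 by blast
next
  fix U assume "U \<in> ?E"
  then obtain c where U: "ae_eq {a<..<b} U (\<lambda>x. dirichlet_mode \<omega> x *\<^sub>R c)" unfolding ae_span_1 by blast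
  have "op_shift op (of_real \<omega>) U (\<lambda>x. if x < 0 then left.y \<omega> x *\<^sub>R 0 else right.y \<omega> x *\<^sub>R 0)"
  proof (rule shift_of_solution[where \<alpha> = 0 and \<gamma> = c])
    show "ae_eq {a<..<0} U (\<lambda>x. left.sol \<omega> 0 0 x)"
      by (rule ae_eq_trans[OF ae_restrict(1)[OF U] ae_eqI]) (simp add: dirichlet_mode_def)
    show "ae_eq {0<..<b} U (\<lambda>x. right.sol \<omega> c 0 x)"
      by (rule ae_eq_trans[OF ae_restrict(2)[OF U] ae_eqI]) (simp add: dirichlet_mode_def)
  qed (simp_all add: z)
  then show "\<exists>G H. op_shift op (of_real \<omega>) U G \<and> op_shift op (of_real \<omega>) G H \<and> ae_eq {a<..<b} H (\<lambda>_. 0)"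
    using shift_null[of "\<lambda>x. if x < 0 then left.y \<omega> x *\<^sub>R 0 else right.y \<omega> x *\<^sub>R 0" \<omega>] by (auto simp: ae_eqI)
qed

definition double_basis :: "real \<Rightarrow> nat \<Rightarrow> real \<Rightarrow> real" where
  "double_basis \<omega> i = (if i = 0 then eigen_family \<omega> else eigen_family_deriv \<omega>)"

lemma ae_span_2: "f \<in> ae_span S 2 (\<lambda>i x. of_real (double_basis \<omega> i x)) \<longleftrightarrow>
   (\<exists>c0 c1. ae_eq S f (\<lambda>x. eigen_family \<omega> x *\<^sub>R c0 + eigen_family_deriv \<omega> x *\<^sub>R c1))"
proof
  assume "f \<in> ae_span S 2 (\<lambda>i x. of_real (double_basis \<omega> i x))"
  then obtain c :: "nat \<Rightarrow> complex" where
    "ae_eq S f (\<lambda>x. \<Sum>i<2. c i * of_real (double_basis \<omega> i x))" by (auto simp: ae_span_def)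
  then show "\<exists>c0 c1. ae_eq S f (\<lambda>x. eigen_family \<omega> x *\<^sub>R c0 + eigen_family_deriv \<omega> x *\<^sub>R c1)"
    by (intro exI[of _ "c 0"] exI[of _ "c 1"])
       (simp add: numeral_2_eq_2 double_basis_def scaleR_conv_of_real mult.commute)
next
  assume "\<exists>c0 c1. ae_eq S f (\<lambda>x. eigen_family \<omega> x *\<^sub>R c0 + eigen_family_deriv \<omega> x *\<^sub>R c1)"
  then obtain c0 c1 where "ae_eq S f (\<lambda>x. eigen_family \<omega> x *\<^sub>R c0 + eigen_family_deriv \<omega> x *\<^sub>R c1)" by blast
  then show "f \<in> ae_span S 2 (\<lambda>i x. of_real (double_basis \<omega> i x))"
    unfolding ae_span_def
    by (intro CollectI exI[of _ "\<lambda>i. if i = 0 then c0 else c1"])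
       (simp add: numeral_2_eq_2 double_basis_def scaleR_conv_of_real mult.commute)
qed

text \<open>The only eigenfunction is the right Dirichlet mode, a multiple of the family at \<open>\<omega>\<close>, because any other one
  would have a left component with \<open>y(0) = w(0) = 0\<close>. The Jordan chain is completed by the \<open>\<omega>\<close>-derivative of the
  family: its left component satisfies the Neumann condition, and it is continuous at \<open>0\<close>. The chain stops
  there by the argument of the Neumann case.\<close>

lemma root_subspace_double:
  assumes z: "left.w \<omega> 0 = 0" "right.y \<omega> 0 = 0"
  shows "root_subspace {a<..<b} op (of_real \<omega>) =
    ae_span {a<..<b} 2 (\<lambda>i x. of_real (double_basis \<omega> i x))" (is "_ = ?E")
proof (rule root_subspace_eqI)
  fix U :: "real \<Rightarrow> complex" assume "ae_eq {a<..<b} U (\<lambda>_. 0)"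
  then show "U \<in> ?E" unfolding ae_span_2 by (intro exI[of _ 0]) simp
next
  fix U G assume UG: "op_shift op (of_real \<omega>) U G" and "G \<in> ?E"
  then obtain c0 c1 where
    G: "ae_eq {a<..<b} G (\<lambda>x. eigen_family \<omega> x *\<^sub>R c0 + eigen_family_deriv \<omega> x *\<^sub>R c1)"
    unfolding ae_span_2 by blast
  have Gl: "ae_eq {a<..<0} G (\<lambda>x. left.y \<omega> x *\<^sub>R (right.yd \<omega> 0 *\<^sub>R c1))"
    by (rule ae_eq_trans[OF ae_restrict(1)[OF G] ae_eqI])
       (simp add: eigen_family_def eigen_family_deriv_def z mult.commute)
  obtain \<alpha> where "left.flux \<omega> \<alpha> (right.yd \<omega> 0 *\<^sub>R c1) 0 = 0"
    by (rule shift_left[OF UG Gl])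
  then have c: "c1 = 0" using z left_wronskian[OF z(1)] right_wronskian[OF z(2)] by auto
  have Gl: "ae_eq {a<..<0} G (\<lambda>x. left.y \<omega> x *\<^sub>R 0)"
    by (rule ae_eq_trans[OF ae_restrict(1)[OF G] ae_eqI]) (simp add: eigen_family_def z c)
  have Gr: "ae_eq {0<..<b} G (\<lambda>x. right.y \<omega> x *\<^sub>R (left.y \<omega> 0 *\<^sub>R c0))"
    by (rule ae_eq_trans[OF ae_restrict(2)[OF G] ae_eqI]) (simp add: eigen_family_def z c mult.commute)
  obtain \<alpha> \<gamma> where
    U: "ae_eq {a<..<0} U (\<lambda>x. left.sol \<omega> \<alpha> 0 x)"
    "ae_eq {0<..<b} U (\<lambda>x. right.sol \<omega> \<gamma> (left.y \<omega> 0 *\<^sub>R c0) x)"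
    and y: "left.sol \<omega> \<alpha> 0 0 =
      right.sol \<omega> \<gamma> (left.y \<omega> 0 *\<^sub>R c0) 0"
    by (rule shift_both[OF UG Gl Gr])
  have nz: "left.y \<omega> 0 \<noteq> 0" "right.yd \<omega> 0 \<noteq> 0"
    using left_wronskian[OF z(1)] right_wronskian[OF z(2)] by auto
  from y have "left.y \<omega> 0 *\<^sub>R \<alpha> = left.y \<omega> 0 *\<^sub>R (right.yd \<omega> 0 *\<^sub>R c0)"
    by (simp add: z mult.commute)
  then have \<alpha>: "\<alpha> = right.yd \<omega> 0 *\<^sub>R c0"
    using nz(1) by (simp only: scaleR_cancel_left) simp
  let ?d = "(1 / left.y \<omega> 0) *\<^sub>R (\<gamma> - left.yd \<omega> 0 *\<^sub>R c0)"
  have "ae_eq {a<..<b} U (\<lambda>x. eigen_family \<omega> x *\<^sub>R ?d + eigen_family_deriv \<omega> x *\<^sub>R c0)"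
  proof (rule ae_eq_glue)
    show "ae_eq {a<..<0} U (\<lambda>x. eigen_family \<omega> x *\<^sub>R ?d + eigen_family_deriv \<omega> x *\<^sub>R c0)"
      by (rule ae_eq_trans[OF U(1) ae_eqI])
         (simp add: eigen_family_def eigen_family_deriv_def z \<alpha> mult.commute)
    show "ae_eq {0<..<b} U (\<lambda>x. eigen_family \<omega> x *\<^sub>R ?d + eigen_family_deriv \<omega> x *\<^sub>R c0)"
      by (rule ae_eq_trans[OF U(2) ae_eqI])
         (use nz in \<open>simp add: eigen_family_def eigen_family_deriv_def z algebra_simps\<close>)
  qed
  then show "U \<in> ?E" unfolding ae_span_2 by blast
next
  fix U assume "U \<in> ?E"
  then obtain c0 c1 where
    U: "ae_eq {a<..<b} U (\<lambda>x. eigen_family \<omega> x *\<^sub>R c0 + eigen_family_deriv \<omega> x *\<^sub>R c1)"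
    unfolding ae_span_2 by blast
  let ?\<delta> = "left.y \<omega> 0 *\<^sub>R c1"
  let ?G = "\<lambda>x. if x < 0 then left.y \<omega> x *\<^sub>R 0 else right.y \<omega> x *\<^sub>R ?\<delta>"
  let ?H = "\<lambda>x. if x < 0 then left.y \<omega> x *\<^sub>R 0 else right.y \<omega> x *\<^sub>R 0"
  have "op_shift op (of_real \<omega>) U ?G"
  proof (rule shift_of_solution[where \<alpha> = "right.yd \<omega> 0 *\<^sub>R c1"
        and \<gamma> = "left.sol \<omega> c0 c1 0"])
    show "ae_eq {a<..<0} U (\<lambda>x. left.sol \<omega> (right.yd \<omega> 0 *\<^sub>R c1) 0 x)"
      by (rule ae_eq_trans[OF ae_restrict(1)[OF U] ae_eqI])
         (simp add: eigen_family_def eigen_family_deriv_def z mult.commute)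
    show "ae_eq {0<..<b} U (\<lambda>x. right.sol \<omega> (left.y \<omega> 0 *\<^sub>R c0 + left.yd \<omega> 0 *\<^sub>R c1) ?\<delta> x)"
      by (rule ae_eq_trans[OF ae_restrict(2)[OF U] ae_eqI])
         (simp add: eigen_family_def eigen_family_deriv_def z algebra_simps)
  qed (simp_all add: z mult.commute)
  moreover have "op_shift op (of_real \<omega>) ?G ?H"
    by (rule shift_of_solution[where \<alpha> = 0 and \<gamma> = ?\<delta>]) (auto simp: z intro!: ae_eqI)
  ultimately show "\<exists>G H. op_shift op (of_real \<omega>) U G \<and> op_shift op (of_real \<omega>) G H \<and> ae_eq {a<..<b} H (\<lambda>_. 0)"
    by (intro exI[of _ ?G] exI[of _ ?H]) (auto simp: ae_eqI)
qed

end

section \<open>Uniqueness of dimensions\<close>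

text \<open>Gaussian elimination of the last equation, by induction on their number.\<close>

lemma underdetermined_system:
  fixes A :: "'i \<Rightarrow> nat \<Rightarrow> complex"
  assumes "finite I" "n < card I"
  shows "\<exists>c. (\<exists>i\<in>I. c i \<noteq> 0) \<and> (\<forall>l<n. (\<Sum>i\<in>I. c i * A i l) = 0)"
  using assms
proof (induction n arbitrary: I A)
  case 0
  then show ?case by (intro exI[of _ "\<lambda>_. 1"]) (auto simp: card_gt_0_iff)
next
  case (Suc n)
  show ?case
  proof (cases "\<forall>i\<in>I. A i n = 0")
    case True
    obtain c where "\<exists>i\<in>I. c i \<noteq> 0" "\<forall>l<n. (\<Sum>i\<in>I. c i * A i l) = 0"
      using Suc.IH[OF Suc.prems(1), of A] Suc.prems(2) by auto
    with True show ?thesis by (intro exI[of _ c]) (auto simp: less_Suc_eq)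
  next
    case False
    then obtain i0 where i0: "i0 \<in> I" "A i0 n \<noteq> 0" by blast
    let ?J = "I - {i0}"
    have J: "finite ?J" "n < card ?J" using Suc.prems i0 by auto
    obtain c where c: "\<exists>i\<in>?J. c i \<noteq> 0"
      "\<forall>l<n. (\<Sum>i\<in>?J. c i * (A i l - A i n / A i0 n * A i0 l)) = 0"
      using Suc.IH[OF J, of "\<lambda>i l. A i l - A i n / A i0 n * A i0 l"] by auto
    define e where "e = - (\<Sum>i\<in>?J. c i * A i n) / A i0 n"
    let ?c = "c(i0 := e)"
    have split: "(\<Sum>i\<in>I. ?c i * A i l) = e * A i0 l + (\<Sum>i\<in>?J. c i * A i l)" for l
      using Suc.prems(1) i0 by (subst sum.remove[of I i0]) (auto intro!: arg_cong2[of _ _ _ _ "(+)"] sum.cong)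
    have "(\<Sum>i\<in>I. ?c i * A i l) = 0" if "l < Suc n" for l
    proof (cases "l = n")
      case True
      then show ?thesis unfolding split using i0 by (simp add: e_def)
    next
      case False
      with that c(2) have "(\<Sum>i\<in>?J. c i * (A i l - A i n / A i0 n * A i0 l)) = 0" by auto
      moreover have "(\<Sum>i\<in>?J. c i * (A i l - A i n / A i0 n * A i0 l)) = (\<Sum>i\<in>?J. c i * A i l) + e * A i0 l"
        by (simp add: e_def right_diff_distrib sum_subtractf sum_divide_distrib sum_distrib_left sum_distrib_right mult_ac)
      ultimately show ?thesis unfolding split by (simp add: add.commute)
    qed
    moreover have "\<exists>i\<in>I. ?c i \<noteq> 0" using c(1) by auto
    ultimately show ?thesis by blast
  qed
qed

lemma has_dimension_le:
  assumes n: "has_dimension S V n" and m: "has_dimension S V m"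
  shows "m \<le> n"
proof (rule ccontr)
  assume "\<not> m \<le> n"
  then have nm: "n < card {..<m}" by simp
  obtain e where e: "\<forall>f\<in>V. \<exists>c :: nat \<Rightarrow> complex. ae_eq S f (\<lambda>x. \<Sum>i<n. c i * e i x)"
    using n unfolding has_dimension_def by blast
  obtain f where f: "\<forall>i<m. f i \<in> V"
    "\<And>c :: nat \<Rightarrow> complex. ae_eq S (\<lambda>x. \<Sum>i<m. c i * f i x) (\<lambda>_. 0) \<Longrightarrow> \<forall>i<m. c i = 0"
    using m unfolding has_dimension_def by blast
  have "\<forall>i. \<exists>c :: nat \<Rightarrow> complex. i < m \<longrightarrow> ae_eq S (f i) (\<lambda>x. \<Sum>l<n. c l * e l x)"
    using e f(1) by blast
  then obtain A :: "nat \<Rightarrow> nat \<Rightarrow> complex"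
    where A: "\<And>i. i < m \<Longrightarrow> ae_eq S (f i) (\<lambda>x. \<Sum>l<n. A i l * e l x)" by metis
  obtain c where c: "\<exists>i\<in>{..<m}. c i \<noteq> 0" "\<forall>l<n. (\<Sum>i<m. c i * A i l) = 0"
    using underdetermined_system[OF finite_lessThan nm, of A] by auto
  have "AE x in lebesgue_on S. \<forall>i\<in>{..<m}. f i x = (\<Sum>l<n. A i l * e l x)"
    using A by (intro AE_finite_allI) (auto simp: ae_eq_def)
  then have "AE x in lebesgue_on S. (\<Sum>i<m. c i * f i x) = 0"
  proof eventually_elim
    case (elim x)
    then have "(\<Sum>i<m. c i * f i x) = (\<Sum>i<m. \<Sum>l<n. c i * A i l * e l x)"
      by (intro sum.cong) (auto simp: sum_distrib_left mult.assoc)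
    also have "\<dots> = (\<Sum>l<n. (\<Sum>i<m. c i * A i l) * e l x)"
      by (subst sum.swap) (simp add: sum_distrib_right)
    finally show ?case using c(2) by simp
  qed
  then have "\<forall>i<m. c i = 0" by (intro f(2)) (simp add: ae_eq_def)
  with c(1) show False by blast
qed

lemma has_dimension_unique: "has_dimension S V n \<Longrightarrow> has_dimension S V m \<Longrightarrow> n = m"
  by (meson has_dimension_le le_antisym)

context transmission
begin

definition root_mult :: "real \<Rightarrow> nat" where
  "root_mult \<omega> = of_bool (left.w \<omega> 0 = 0) + of_bool (right.y \<omega> 0 = 0)"

lemma double_basis_independent:
  assumes z: "left.w \<omega> 0 = 0" "right.y \<omega> 0 = 0"
    and ae: "ae_eq {a<..<b} (\<lambda>x. eigen_family \<omega> x *\<^sub>R c0 + eigen_family_deriv \<omega> x *\<^sub>R c1) (\<lambda>_. 0)"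
  shows "c0 = (0 :: complex) \<and> c1 = 0"
proof -
  have nz: "left.y \<omega> 0 \<noteq> 0" "right.yd \<omega> 0 \<noteq> 0"
    using left_wronskian[OF z(1)] right_wronskian[OF z(2)] by auto
  have "ae_eq {a<..<0} (\<lambda>x. left.y \<omega> x *\<^sub>R (right.yd \<omega> 0 *\<^sub>R c1)) (\<lambda>_. 0)"
    by (rule ae_eq_trans[OF ae_eqI ae_restrict(1)[OF ae]])
       (simp add: eigen_family_def eigen_family_deriv_def z mult.commute)
  then have c1: "c1 = 0" using scaled_solution_ae_zero(1) nz by fastforce
  have "ae_eq {0<..<b} (\<lambda>x. right.y \<omega> x *\<^sub>R (left.y \<omega> 0 *\<^sub>R c0)) (\<lambda>_. 0)"
    by (rule ae_eq_trans[OF ae_eqI ae_restrict(2)[OF ae]])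
       (simp add: eigen_family_def eigen_family_deriv_def z c1 mult.commute)
  then show ?thesis using scaled_solution_ae_zero(2) nz c1 by fastforce
qed

lemma root_subspace_dimension:
  "has_dimension {a<..<b} (root_subspace {a<..<b} op (of_real \<omega>)) (root_mult \<omega>)"
proof -
  consider "left.w \<omega> 0 \<noteq> 0" "right.y \<omega> 0 \<noteq> 0" | "left.w \<omega> 0 = 0" "right.y \<omega> 0 \<noteq> 0"
    | "left.w \<omega> 0 \<noteq> 0" "right.y \<omega> 0 = 0" | "left.w \<omega> 0 = 0" "right.y \<omega> 0 = 0" by blast
  then show ?thesis
  proof cases
    case 1
    have "has_dimension {a<..<b} (ae_span {a<..<b} 0 (\<lambda>_ _. 0)) 0"
      by (rule has_dimension_ae_span) simp
    then show ?thesis using root_subspace_resolvent[OF 1] by (simp add: root_mult_def 1)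
  next
    case 2
    have "has_dimension {a<..<b} (ae_span {a<..<b} 1 (\<lambda>_ x. of_real (eigen_family \<omega> x))) 1"
    proof (rule has_dimension_ae_span)
      fix c :: "nat \<Rightarrow> complex"
      assume "ae_eq {a<..<b} (\<lambda>x. \<Sum>i<1. c i * of_real (eigen_family \<omega> x)) (\<lambda>_. 0)"
      then have ae: "ae_eq {a<..<b} (\<lambda>x. c 0 * of_real (eigen_family \<omega> x)) (\<lambda>_. 0)" by simp
      have "ae_eq {a<..<0} (\<lambda>x. left.y \<omega> x *\<^sub>R (right.y \<omega> 0 *\<^sub>R c 0)) (\<lambda>_. 0)"
        by (rule ae_eq_trans[OF ae_eqI ae_restrict(1)[OF ae]])
           (simp add: eigen_family_def scaleR_conv_of_real mult_ac)
      then show "\<forall>i<1. c i = 0" using scaled_solution_ae_zero(1) 2 by fastforce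
    qed
    then show ?thesis by (simp add: root_subspace_left[OF 2] root_mult_def 2)
  next
    case 3
    have "has_dimension {a<..<b} (ae_span {a<..<b} 1 (\<lambda>_ x. of_real (dirichlet_mode \<omega> x))) 1"
    proof (rule has_dimension_ae_span)
      fix c :: "nat \<Rightarrow> complex"
      assume "ae_eq {a<..<b} (\<lambda>x. \<Sum>i<1. c i * of_real (dirichlet_mode \<omega> x)) (\<lambda>_. 0)"
      then have ae: "ae_eq {a<..<b} (\<lambda>x. c 0 * of_real (dirichlet_mode \<omega> x)) (\<lambda>_. 0)" by simp
      have "ae_eq {0<..<b} (\<lambda>x. right.y \<omega> x *\<^sub>R c 0) (\<lambda>_. 0)"
        by (rule ae_eq_trans[OF ae_eqI ae_restrict(2)[OF ae]])
           (simp add: dirichlet_mode_def scaleR_conv_of_real mult_ac)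
      then show "\<forall>i<1. c i = 0" using scaled_solution_ae_zero(2) by fastforce
    qed
    then show ?thesis by (simp add: root_subspace_right[OF 3] root_mult_def 3)
  next
    case 4
    have "has_dimension {a<..<b} (ae_span {a<..<b} 2 (\<lambda>i x. of_real (double_basis \<omega> i x))) 2"
    proof (rule has_dimension_ae_span)
      fix c :: "nat \<Rightarrow> complex"
      assume "ae_eq {a<..<b} (\<lambda>x. \<Sum>i<2. c i * of_real (double_basis \<omega> i x)) (\<lambda>_. 0)"
      then have "ae_eq {a<..<b} (\<lambda>x. eigen_family \<omega> x *\<^sub>R c 0 + eigen_family_deriv \<omega> x *\<^sub>R c 1) (\<lambda>_. 0)"
        by (simp add: numeral_2_eq_2 double_basis_def scaleR_conv_of_real mult.commute)
      from double_basis_independent[OF 4 this] show "\<forall>i<2. c i = 0"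
        by (auto simp: less_2_cases_iff)
    qed
    then show ?thesis by (simp add: root_subspace_double[OF 4] root_mult_def 4 numeral_2_eq_2)
  qed
qed

lemma root_mult_eq_0_iff: "root_mult \<omega> = 0 \<longleftrightarrow> char_B \<omega> \<noteq> 0"
  by (auto simp: root_mult_def char_B_def)

end

section \<open>Persistence and splitting of roots\<close>

text \<open>Three roots would force a zero of the second derivative, by Rolle applied three times.\<close>

lemma three_roots_contradict_convexity:
  fixes h h' h'' :: "real \<Rightarrow> real"
  assumes h: "\<And>x. (h has_real_derivative h' x) (at x)"
    and h': "\<And>x. (h' has_real_derivative h'' x) (at x)"
    and pos: "\<And>t. x \<le> t \<Longrightarrow> t \<le> z \<Longrightarrow> 0 < h'' t"
    and xyz: "x < y" "y < z" "h x = 0" "h y = 0" "h z = 0"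
  shows False
proof -
  have rolle: "\<exists>t. u < t \<and> t < v \<and> f' t = 0"
    if uv: "u < v" "f u = f v" and f: "\<And>x. (f has_real_derivative f' x) (at x)"
    for f f' :: "real \<Rightarrow> real" and u v
  proof -
    have "continuous_on {u..v} f"
      using f DERIV_isCont continuous_at_imp_continuous_on by blast
    moreover have "f differentiable at x" for x
      using f by (auto simp: real_differentiable_def)
    ultimately obtain t where "u < t" "t < v" "DERIV f t :> 0"
      using Rolle[of u v f] uv by blast
    then show ?thesis using f DERIV_unique by blast
  qed
  obtain s t where "x < s" "s < y" "h' s = 0" "y < t" "t < z" "h' t = 0"
    using rolle[OF xyz(1) _ h] rolle[OF xyz(2) _ h] xyz by auto
  moreover from this obtain r where "s < r" "r < t" "h'' r = 0"
    using rolle[OF _ _ h', of s t] by auto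
  ultimately show False using pos[of r] by auto
qed

lemma Icc_bounded_by:
  fixes f :: "real \<Rightarrow> real"
  assumes "continuous_on UNIV f"
  obtains M where "M > 0" "\<And>x. x \<in> {l..u} \<Longrightarrow> \<bar>f x\<bar> \<le> M"
proof -
  have "bounded (f ` {l..u})"
    using assms by (intro compact_imp_bounded compact_continuous_image) (auto intro: continuous_on_subset)
  then obtain M where "M > 0" "\<forall>z\<in>f ` {l..u}. norm z \<le> M" unfolding bounded_pos by blast
  then show ?thesis using that[of M] by auto
qed

lemma positive_near:
  fixes f :: "real \<Rightarrow> real"
  assumes "continuous_on UNIV f" "0 < f z"
  obtains d where "d > 0" "\<And>x. \<bar>x - z\<bar> \<le> d \<Longrightarrow> f z / 2 < f x"
proof -
  have "isCont f z" using assms(1) by (simp add: continuous_on_eq_continuous_at)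
  then obtain d where d: "d > 0" "\<And>x. \<bar>x - z\<bar> < d \<Longrightarrow> \<bar>f x - f z\<bar> < f z / 2"
    using assms(2) unfolding continuous_at_eps_delta dist_real_def by (metis half_gt_zero)
  show ?thesis
  proof (rule that[of "d / 2"])
    show "f z / 2 < f x" if "\<bar>x - z\<bar> \<le> d / 2" for x
    proof -
      have "\<bar>f x - f z\<bar> < f z / 2" by (rule d(2)) (use that d(1) in linarith)
      then show ?thesis by linarith
    qed
  qed (use d in simp)
qed

definition roots_near :: "(real \<Rightarrow> real) \<Rightarrow> (real \<Rightarrow> real) \<Rightarrow> nat \<Rightarrow> real \<Rightarrow> bool" where
  "roots_near A B m z \<longleftrightarrow> (\<forall>\<eta>>0. \<exists>\<delta>. 0 < \<delta> \<and> \<delta> \<le> \<eta> \<and> (\<exists>e>0. \<forall>\<epsilon>. 0 < \<epsilon> \<and> \<epsilon> < e \<longrightarrow>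
     card {x. \<bar>x - z\<bar> < \<delta> \<and> \<epsilon> * A x = B x} = m))"

text \<open>Near \<open>z\<close> the function \<open>B - \<epsilon>A\<close> is strictly increasing for small \<open>\<epsilon>\<close>, and it changes sign.\<close>

lemma simple_root_persists_pos:
  fixes A A' B B' :: "real \<Rightarrow> real"
  assumes A: "\<And>x. (A has_real_derivative A' x) (at x)" "continuous_on UNIV A'"
    and B: "\<And>x. (B has_real_derivative B' x) (at x)" "continuous_on UNIV B'"
    and z: "B z = 0" "0 < B' z"
  shows "roots_near A B 1 z"
  unfolding roots_near_def
proof (intro allI impI)
  fix \<eta> :: real assume eta: "0 < \<eta>"
  obtain d where d: "d > 0" "\<And>x. \<bar>x - z\<bar> \<le> d \<Longrightarrow> B' z / 2 < B' x"
    using positive_near[of B' z, OF B(2) z(2)] by blast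
  define \<delta> where "\<delta> = min d \<eta>"
  have \<delta>: "0 < \<delta>" "\<delta> \<le> \<eta>" "\<delta> \<le> d" using d eta by (auto simp: \<delta>_def)
  have Ac: "continuous_on UNIV A" using A(1) DERIV_continuous_on by (metis has_field_derivative_at_within)
  have Bc: "continuous_on UNIV B" using B(1) DERIV_continuous_on by (metis has_field_derivative_at_within)
  obtain M where M: "M > 0" "\<And>x. x \<in> {z - \<delta>..z + \<delta>} \<Longrightarrow> \<bar>A x\<bar> \<le> M"
    using Icc_bounded_by[OF Ac] by blast
  obtain M' where M': "M' > 0" "\<And>x. x \<in> {z - \<delta>..z + \<delta>} \<Longrightarrow> \<bar>A' x\<bar> \<le> M'"
    using Icc_bounded_by[OF A(2)] by blast
  have inc: "B s < B t" if "z - \<delta> \<le> s" "s < t" "t \<le> z + \<delta>" for s t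
  proof (rule DERIV_pos_imp_increasing[OF that(2)])
    fix x assume "s \<le> x" "x \<le> t"
    then have "\<bar>x - z\<bar> \<le> d" using that \<delta> by linarith
    then show "\<exists>y. (B has_real_derivative y) (at x) \<and> 0 < y"
      using B(1)[of x] d(2)[of x] z by (intro exI[of _ "B' x"]) auto
  qed
  define e where "e = Min {B' z / 2 / M', B (z + \<delta>) / M, - B (z - \<delta>) / M}"
  have e: "e > 0" using inc[of z "z + \<delta>"] inc[of "z - \<delta>" z] z \<delta> M M'
    by (auto simp: e_def divide_neg_pos)
  have "card {x. \<bar>x - z\<bar> < \<delta> \<and> \<epsilon> * A x = B x} = 1" if eps: "0 < \<epsilon>" "\<epsilon> < e" for \<epsilon>
  proof -
    let ?h = "\<lambda>x. B x - \<epsilon> * A x"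
    have *: "\<epsilon> * M' < B' z / 2" "\<epsilon> * M < B (z + \<delta>)" "\<epsilon> * M < - B (z - \<delta>)"
      using eps M M' by (auto simp: e_def field_simps)
    have hinc: "?h s < ?h t" if "z - \<delta> \<le> s" "s < t" "t \<le> z + \<delta>" for s t
    proof (rule DERIV_pos_imp_increasing[OF that(2)])
      fix x assume x: "s \<le> x" "x \<le> t"
      have "\<epsilon> * A' x \<le> \<epsilon> * M'" using M'(2)[of x] eps x that by (intro mult_left_mono) auto
      moreover have "\<bar>x - z\<bar> \<le> d" using x that \<delta> by linarith
      ultimately have "0 < B' x - \<epsilon> * A' x" using * d(2)[of x] by linarith
      then show "\<exists>y. (?h has_real_derivative y) (at x) \<and> 0 < y"
        by (intro exI[of _ "B' x - \<epsilon> * A' x"]) (auto intro!: derivative_eq_intros A B)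
    qed
    have "\<epsilon> * A (z + \<delta>) \<le> \<epsilon> * M" "- (\<epsilon> * M) \<le> \<epsilon> * A (z - \<delta>)"
      using M(2)[of "z + \<delta>"] M(2)[of "z - \<delta>"] \<delta> eps mult_left_mono[of "A (z + \<delta>)" M \<epsilon>]
        mult_left_mono[of "- M" "A (z - \<delta>)" \<epsilon>] by auto
    then have "?h (z - \<delta>) < 0" "0 < ?h (z + \<delta>)" using * by auto
    moreover have "continuous_on {z - \<delta>..z + \<delta>} ?h"
      by (intro continuous_intros continuous_on_subset[OF Ac] continuous_on_subset[OF Bc]) auto
    ultimately obtain x where x: "z - \<delta> \<le> x" "x \<le> z + \<delta>" "?h x = 0"
      using IVT'[of ?h "z - \<delta>" 0 "z + \<delta>"] \<delta> by auto
    have "x \<noteq> z - \<delta>" "x \<noteq> z + \<delta>"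
      using x(3) \<open>?h (z - \<delta>) < 0\<close> \<open>0 < ?h (z + \<delta>)\<close> by auto
    then have "{x. \<bar>x - z\<bar> < \<delta> \<and> \<epsilon> * A x = B x} = {x}"
    proof -
      have "t = x" if "\<bar>t - z\<bar> < \<delta>" "\<epsilon> * A t = B t" for t
      proof -
        have "z - \<delta> \<le> t" "t \<le> z + \<delta>" using that by linarith+
        with hinc[of t x] hinc[of x t] x that show ?thesis by (cases t x rule: linorder_cases) auto
      qed
      with x \<open>x \<noteq> z - \<delta>\<close> \<open>x \<noteq> z + \<delta>\<close> show ?thesis by auto
    qed
    then show ?thesis by simp
  qed
  with \<delta> e show "\<exists>\<delta>. 0 < \<delta> \<and> \<delta> \<le> \<eta> \<and> (\<exists>e>0. \<forall>\<epsilon>. 0 < \<epsilon> \<and> \<epsilon> < e \<longrightarrow>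
    card {x. \<bar>x - z\<bar> < \<delta> \<and> \<epsilon> * A x = B x} = 1)"
    by blast
qed

lemma simple_root_persists:
  fixes A A' B B' :: "real \<Rightarrow> real"
  assumes A: "\<And>x. (A has_real_derivative A' x) (at x)" "continuous_on UNIV A'"
    and B: "\<And>x. (B has_real_derivative B' x) (at x)" "continuous_on UNIV B'"
    and z: "B z = 0" "B' z \<noteq> 0"
  shows "roots_near A B 1 z"
proof (cases "0 < B' z")
  case True
  then show ?thesis using simple_root_persists_pos[OF A B z(1) _] by blast
next
  case False
  have "roots_near (\<lambda>x. - A x) (\<lambda>x. - B x) 1 z"
    by (rule simple_root_persists_pos[where A' = "\<lambda>x. - A' x" and B' = "\<lambda>x. - B' x"])
       (use A B z False in \<open>auto intro!: DERIV_minus continuous_intros\<close>)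
  then show ?thesis by (simp add: roots_near_def)
qed

text \<open>Near \<open>z\<close> the function \<open>B - \<epsilon>A\<close> is strictly convex, negative at \<open>z\<close> and positive at \<open>z \<plusminus> \<delta>\<close>.\<close>

lemma double_root_splits_pos:
  fixes A A' A'' B B' B'' :: "real \<Rightarrow> real"
  assumes A: "\<And>x. (A has_real_derivative A' x) (at x)" "\<And>x. (A' has_real_derivative A'' x) (at x)"
      "continuous_on UNIV A''"
    and B: "\<And>x. (B has_real_derivative B' x) (at x)" "\<And>x. (B' has_real_derivative B'' x) (at x)"
      "continuous_on UNIV B''"
    and z: "B z = 0" "B' z = 0" "0 < B'' z" "0 < A z"
  shows "roots_near A B 2 z"
  unfolding roots_near_def
proof (intro allI impI)
  fix \<eta> :: real assume eta: "0 < \<eta>"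
  obtain d where d: "d > 0" "\<And>x. \<bar>x - z\<bar> \<le> d \<Longrightarrow> B'' z / 2 < B'' x"
    using positive_near[of B'' z, OF B(3) z(3)] by blast
  define \<delta> where "\<delta> = min d \<eta>"
  have \<delta>: "0 < \<delta>" "\<delta> \<le> \<eta>" "\<delta> \<le> d" using d eta by (auto simp: \<delta>_def)
  have Ac: "continuous_on UNIV A" using A(1) DERIV_continuous_on by (metis has_field_derivative_at_within)
  have Bc: "continuous_on UNIV B" using B(1) DERIV_continuous_on by (metis has_field_derivative_at_within)
  obtain M where M: "M > 0" "\<And>x. x \<in> {z - \<delta>..z + \<delta>} \<Longrightarrow> \<bar>A x\<bar> \<le> M"
    using Icc_bounded_by[OF Ac] by blast
  obtain M' where M': "M' > 0" "\<And>x. x \<in> {z - \<delta>..z + \<delta>} \<Longrightarrow> \<bar>A'' x\<bar> \<le> M'"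
    using Icc_bounded_by[OF A(3)] by blast
  have inc': "B' s < B' t" if "z - \<delta> \<le> s" "s < t" "t \<le> z + \<delta>" for s t
  proof (rule DERIV_pos_imp_increasing[OF that(2)])
    fix x assume "s \<le> x" "x \<le> t"
    then have "\<bar>x - z\<bar> \<le> d" using that \<delta> by linarith
    then show "\<exists>y. (B' has_real_derivative y) (at x) \<and> 0 < y"
      using B(2)[of x] d(2)[of x] z by (intro exI[of _ "B'' x"]) auto
  qed
  have "B z < B (z + \<delta>)"
  proof (rule DERIV_pos_imp_increasing_open[of z "z + \<delta>" B])
    show "\<exists>y. (B has_real_derivative y) (at x) \<and> 0 < y" if "z < x" "x < z + \<delta>" for x
      using B(1)[of x] inc'[of z x] z that \<delta> by (intro exI[of _ "B' x"]) auto
  qed (use \<delta> in \<open>auto intro: continuous_on_subset[OF Bc]\<close>)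
  moreover have "B z < B (z - \<delta>)"
  proof (rule DERIV_neg_imp_decreasing_open[of "z - \<delta>" z B])
    show "\<exists>y. (B has_real_derivative y) (at x) \<and> y < 0" if "z - \<delta> < x" "x < z" for x
      using B(1)[of x] inc'[of x z] z that \<delta> by (intro exI[of _ "B' x"]) auto
  qed (use \<delta> in \<open>auto intro: continuous_on_subset[OF Bc]\<close>)
  ultimately have Bpos: "0 < B (z + \<delta>)" "0 < B (z - \<delta>)" using z by auto
  define e where "e = Min {B'' z / 2 / M', B (z + \<delta>) / M, B (z - \<delta>) / M}"
  have e: "e > 0" using Bpos z \<delta> M M' by (auto simp: e_def)
  have "card {x. \<bar>x - z\<bar> < \<delta> \<and> \<epsilon> * A x = B x} = 2" if eps: "0 < \<epsilon>" "\<epsilon> < e" for \<epsilon>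
  proof -
    let ?h = "\<lambda>x. B x - \<epsilon> * A x"
    have *: "\<epsilon> * M' < B'' z / 2" "\<epsilon> * M < B (z + \<delta>)" "\<epsilon> * M < B (z - \<delta>)"
      using eps M M' by (auto simp: e_def field_simps)
    have h: "(?h has_real_derivative B' x - \<epsilon> * A' x) (at x)" for x
      by (auto intro!: derivative_eq_intros A B)
    have h': "((\<lambda>x. B' x - \<epsilon> * A' x) has_real_derivative B'' x - \<epsilon> * A'' x) (at x)" for x
      by (auto intro!: derivative_eq_intros A B)
    have h''pos: "0 < B'' x - \<epsilon> * A'' x" if "z - \<delta> \<le> x" "x \<le> z + \<delta>" for x
    proof -
      have "\<epsilon> * A'' x \<le> \<epsilon> * M'" using M'(2)[of x] eps that by (intro mult_left_mono) auto
      moreover have "\<bar>x - z\<bar> \<le> d" using that \<delta> by linarith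
      ultimately show ?thesis using * d(2)[of x] by linarith
    qed
    have no3: False
      if "p < q" "q < r" "?h p = 0" "?h q = 0" "?h r = 0" "z - \<delta> \<le> p" "r \<le> z + \<delta>" for p q r
      by (rule three_roots_contradict_convexity[OF h h' _ that(1-5)]) (use h''pos that in auto)
    have "\<epsilon> * A (z + \<delta>) \<le> \<epsilon> * M" "\<epsilon> * A (z - \<delta>) \<le> \<epsilon> * M"
      using M(2)[of "z + \<delta>"] M(2)[of "z - \<delta>"] \<delta> eps by (auto intro!: mult_left_mono)
    then have hb: "0 < ?h (z - \<delta>)" "0 < ?h (z + \<delta>)" using * by auto
    have hz: "?h z < 0" using z eps by simp
    have hc: "continuous_on S ?h" for S
      by (intro continuous_intros continuous_on_subset[OF Ac] continuous_on_subset[OF Bc]) auto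
    obtain x where x: "z \<le> x" "x \<le> z + \<delta>" "?h x = 0"
      using IVT'[of ?h z 0 "z + \<delta>", OF _ _ _ hc] \<delta> hb hz by auto
    obtain y where y: "z - \<delta> \<le> y" "y \<le> z" "?h y = 0"
      using IVT2'[of ?h z 0 "z - \<delta>", OF _ _ _ hc] \<delta> hb hz by auto
    have ne: "x \<noteq> z" "y \<noteq> z" "x \<noteq> z + \<delta>" "y \<noteq> z - \<delta>"
      using x(3) y(3) hb hz by auto
    have "{x. \<bar>x - z\<bar> < \<delta> \<and> \<epsilon> * A x = B x} = {y, x}"
    proof -
      have "t = x \<or> t = y" if t: "\<bar>t - z\<bar> < \<delta>" "\<epsilon> * A t = B t" for t
      proof (rule ccontr)
        have tb: "z - \<delta> \<le> t" "t \<le> z + \<delta>" using t by linarith+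
        assume "\<not> ?thesis"
        then consider "t < y" | "y < t" "t < x" | "x < t" by linarith
        then show False
        proof cases
          case 1
          then show ?thesis using no3[of t y x] x y t tb ne by auto
        next
          case 2
          then show ?thesis using no3[of y t x] x y t tb ne by auto
        next
          case 3
          then show ?thesis using no3[of y x t] x y t tb ne by auto
        qed
      qed
      with x y ne show ?thesis by auto
    qed
    moreover have "y \<noteq> x" using x y ne by auto
    ultimately show ?thesis by simp
  qed
  with \<delta> e show "\<exists>\<delta>. 0 < \<delta> \<and> \<delta> \<le> \<eta> \<and> (\<exists>e>0. \<forall>\<epsilon>. 0 < \<epsilon> \<and> \<epsilon> < e \<longrightarrow>
    card {x. \<bar>x - z\<bar> < \<delta> \<and> \<epsilon> * A x = B x} = 2)"
    by blast
qed

text \<open>The sign condition decides that the double root splits into real roots and not into complex ones.\<close>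

lemma double_root_splits:
  fixes A A' A'' B B' B'' :: "real \<Rightarrow> real"
  assumes A: "\<And>x. (A has_real_derivative A' x) (at x)" "\<And>x. (A' has_real_derivative A'' x) (at x)"
      "continuous_on UNIV A''"
    and B: "\<And>x. (B has_real_derivative B' x) (at x)" "\<And>x. (B' has_real_derivative B'' x) (at x)"
      "continuous_on UNIV B''"
    and z: "B z = 0" "B' z = 0" "0 < A z * B'' z"
  shows "roots_near A B 2 z"
proof (cases "0 < A z")
  case True
  then have "0 < B'' z" using z(3) by (simp add: zero_less_mult_iff)
  then show ?thesis using double_root_splits_pos[OF A B z(1,2) _ True] by blast
next
  case False
  then have s: "B'' z < 0" "A z < 0" using z(3) by (auto simp: zero_less_mult_iff)
  have "roots_near (\<lambda>x. - A x) (\<lambda>x. - B x) 2 z"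
    by (rule double_root_splits_pos[where A' = "\<lambda>x. - A' x" and B' = "\<lambda>x. - B' x"
          and A'' = "\<lambda>x. - A'' x" and B'' = "\<lambda>x. - B'' x"])
       (use A B z s in \<open>auto intro!: DERIV_minus continuous_intros\<close>)
  then show ?thesis by (simp add: roots_near_def)
qed

lemma initial_segment:
  fixes S :: "nat set"
  assumes "finite S" "S \<subseteq> {1..}" and down: "\<And>i j. i \<in> S \<Longrightarrow> 1 \<le> j \<Longrightarrow> j \<le> i \<Longrightarrow> j \<in> S"
  shows "S = {1..card S}"
proof (cases "S = {}")
  case False
  have "S = {1..Max S}"
  proof
    show "S \<subseteq> {1..Max S}" using assms(1,2) by auto
    show "{1..Max S} \<subseteq> S" using down[OF Max_in[OF assms(1) False]] by auto
  qed
  then have "card S = Max S" by (metis card_atLeastAtMost diff_Suc_1)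
  with \<open>S = {1..Max S}\<close> show ?thesis by simp
qed simp

text \<open>The indices whose values satisfy a downward closed property form an initial segment, so their number
  determines them.\<close>

lemma enumeration_threshold:
  fixes \<Omega> :: "nat \<Rightarrow> real"
  assumes mono: "strict_mono_on {1..} \<Omega>"
    and fin: "finite {x \<in> \<Omega> ` {1..}. P x}" and card: "card {x \<in> \<Omega> ` {1..}. P x} = N"
    and down: "\<And>x y. P y \<Longrightarrow> x \<le> y \<Longrightarrow> P x" and i: "1 \<le> i"
  shows "P (\<Omega> i) \<longleftrightarrow> i \<le> N"
proof -
  let ?S = "{i \<in> {1..}. P (\<Omega> i)}"
  have inj: "inj_on \<Omega> {1..}" using mono by (rule strict_mono_on_imp_inj_on)
  have im: "\<Omega> ` ?S = {x \<in> \<Omega> ` {1..}. P x}" by auto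
  have injS: "inj_on \<Omega> ?S" by (rule inj_on_subset[OF inj]) auto
  have "finite ?S" using fin im finite_imageD[OF _ injS] by simp
  moreover have "card ?S = N" using card im card_image[OF injS] by simp
  moreover have "j \<in> ?S" if "i \<in> ?S" "1 \<le> j" "j \<le> i" for i j
  proof -
    have "\<Omega> j \<le> \<Omega> i" using strict_mono_onD[OF mono, of j i] that by (cases "i = j") auto
    then show ?thesis using down that by auto
  qed
  ultimately have "?S = {1..N}" using initial_segment[of ?S] by auto
  then show ?thesis using i by (auto simp: set_eq_iff)
qed

lemma finite_set_separated:
  fixes F :: "real set"
  assumes "finite F" "\<eta> > 0"
  obtains \<delta> where "0 < \<delta>" "\<delta> \<le> \<eta>" "\<And>x y. x \<in> F \<Longrightarrow> y \<in> F \<Longrightarrow> x \<noteq> y \<Longrightarrow> 2 * \<delta> \<le> \<bar>x - y\<bar>"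
proof -
  let ?D = "{\<eta>} \<union> (\<lambda>(x, y). \<bar>x - y\<bar> / 2) ` {(x, y) \<in> F \<times> F. x \<noteq> y}"
  have fin: "finite ?D" using assms by (intro finite_UnI finite_imageI) (auto intro: finite_subset[of _ "F \<times> F"])
  show ?thesis
  proof (rule that[of "Min ?D"])
    show "0 < Min ?D" using fin assms by (subst Min_gr_iff) auto
    show "Min ?D \<le> \<eta>" using fin by (intro Min_le) auto
    show "2 * Min ?D \<le> \<bar>x - y\<bar>" if "x \<in> F" "y \<in> F" "x \<noteq> y" for x y
    proof -
      have "Min ?D \<le> \<bar>x - y\<bar> / 2" using fin that by (intro Min_le) auto
      then show ?thesis by simp
    qed
  qed
qed

text \<open>If every root of \<open>B\<close> up to \<open>M\<close> gives rise to exactly \<open>m\<close> roots of \<open>\<epsilon>A = B\<close> nearby, then the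
  ordering of the roots identifies those that converge to \<open>M\<close>.\<close>

lemma ordered_roots_converge:
  fixes A B :: "real \<Rightarrow> real" and m :: "real \<Rightarrow> nat" and \<Omega> :: "real \<Rightarrow> nat \<Rightarrow> real"
  assumes Ac: "continuous_on UNIV A" and Bc: "continuous_on UNIV B"
    and pos: "\<And>\<epsilon> \<omega>. 0 < \<epsilon> \<Longrightarrow> \<epsilon> * A \<omega> = B \<omega> \<Longrightarrow> 0 < \<omega>"
    and fin: "finite {z. B z = 0 \<and> z < M}" and M: "B M = 0"
    and local: "\<And>z. B z = 0 \<Longrightarrow> roots_near A B (m z) z"
    and m_pos: "\<And>z. B z = 0 \<Longrightarrow> 0 < m z"
    and mono: "\<And>\<epsilon>. 0 < \<epsilon> \<Longrightarrow> strict_mono_on {1..} (\<Omega> \<epsilon>)"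
    and image: "\<And>\<epsilon>. 0 < \<epsilon> \<Longrightarrow> \<Omega> \<epsilon> ` {1..} = {\<omega>. \<epsilon> * A \<omega> = B \<omega>}"
    and N: "(\<Sum>z | B z = 0 \<and> z < M. m z) = N" and i: "N < i" "i \<le> N + m M"
  shows "((\<lambda>\<epsilon>. \<Omega> \<epsilon> i) \<longlongrightarrow> M) (at_right 0)"
proof (rule tendstoI)
  fix \<eta> :: real assume "0 < \<eta>"
  let ?F = "{z. B z = 0 \<and> z < M}"
  let ?Z = "\<lambda>\<epsilon> z \<delta>. {x. \<bar>x - z\<bar> < \<delta> \<and> \<epsilon> * A x = B x}"
  obtain \<delta>0 where \<delta>0: "0 < \<delta>0" "\<delta>0 \<le> \<eta>"
    and sep: "\<And>x y. x \<in> insert M ?F \<Longrightarrow> y \<in> insert M ?F \<Longrightarrow> x \<noteq> y \<Longrightarrow> 2 * \<delta>0 \<le> \<bar>x - y\<bar>"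
    by (rule finite_set_separated[OF finite.insertI[OF fin] \<open>0 < \<eta>\<close>]) blast
  have "\<forall>z. \<exists>\<delta> e. z \<in> insert M ?F \<longrightarrow> 0 < \<delta> \<and> \<delta> \<le> \<delta>0 \<and> 0 < e \<and>
      (\<forall>\<epsilon>. 0 < \<epsilon> \<and> \<epsilon> < e \<longrightarrow> card (?Z \<epsilon> z \<delta>) = m z)"
  proof
    fix z
    show "\<exists>\<delta> e. z \<in> insert M ?F \<longrightarrow> 0 < \<delta> \<and> \<delta> \<le> \<delta>0 \<and> 0 < e \<and>
      (\<forall>\<epsilon>. 0 < \<epsilon> \<and> \<epsilon> < e \<longrightarrow> card (?Z \<epsilon> z \<delta>) = m z)"
    proof (cases "z \<in> insert M ?F")
      case True
      then have "B z = 0" using M by auto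
      from local[OF this, unfolded roots_near_def, rule_format, OF \<delta>0(1)] show ?thesis by blast
    qed blast
  qed
  from choice[OF this] obtain \<delta> where
    "\<forall>z. \<exists>e. z \<in> insert M ?F \<longrightarrow> 0 < \<delta> z \<and> \<delta> z \<le> \<delta>0 \<and> 0 < e \<and>
      (\<forall>\<epsilon>. 0 < \<epsilon> \<and> \<epsilon> < e \<longrightarrow> card (?Z \<epsilon> z (\<delta> z)) = m z)" ..
  from choice[OF this] obtain e where
    \<delta>e: "\<forall>z. z \<in> insert M ?F \<longrightarrow> 0 < \<delta> z \<and> \<delta> z \<le> \<delta>0 \<and> 0 < e z \<and>
      (\<forall>\<epsilon>. 0 < \<epsilon> \<and> \<epsilon> < e z \<longrightarrow> card (?Z \<epsilon> z (\<delta> z)) = m z)" ..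
  have \<delta>: "\<And>z. z \<in> insert M ?F \<Longrightarrow> 0 < \<delta> z" "\<And>z. z \<in> insert M ?F \<Longrightarrow> \<delta> z \<le> \<delta>0"
    and e: "\<And>z. z \<in> insert M ?F \<Longrightarrow> 0 < e z"
    and crd: "\<And>z \<epsilon>. z \<in> insert M ?F \<Longrightarrow> 0 < \<epsilon> \<Longrightarrow> \<epsilon> < e z \<Longrightarrow> card (?Z \<epsilon> z (\<delta> z)) = m z"
    using \<delta>e by blast+
  \<comment> \<open>On the compact rest \<open>K\<close> the function \<open>\<bar>B\<bar>\<close> has a positive minimum, so no roots of \<open>\<epsilon>A = B\<close> stay there.\<close>
  define K where "K = {0..M} - (\<Union>z\<in>insert M ?F. {z - \<delta> z<..<z + \<delta> z})"
  have Kc: "compact K" unfolding K_def by (intro compact_diff open_UN) auto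
  have KB: "B x \<noteq> 0" if "x \<in> K" for x
  proof
    assume "B x = 0"
    moreover have "x \<le> M" using that by (auto simp: K_def)
    ultimately have x: "x \<in> insert M ?F" by auto
    then have "x \<in> {x - \<delta> x<..<x + \<delta> x}" using \<delta>(1)[OF x] by simp
    with x that show False unfolding K_def by blast
  qed
  have "\<exists>e0>0. \<forall>\<epsilon> x. 0 < \<epsilon> \<and> \<epsilon> < e0 \<and> x \<in> K \<longrightarrow> \<epsilon> * A x \<noteq> B x"
  proof (cases "K = {}")
    case True
    then show ?thesis by (intro exI[of _ 1]) simp
  next
    case False
    obtain x0 where x0: "x0 \<in> K" "\<And>x. x \<in> K \<Longrightarrow> \<bar>B x0\<bar> \<le> \<bar>B x\<bar>"
      using continuous_attains_inf[OF Kc False, of "\<lambda>x. \<bar>B x\<bar>"] Bc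
      by (metis continuous_on_rabs continuous_on_subset subset_UNIV)
    obtain C where C: "C > 0" "\<And>x. x \<in> {0..M} \<Longrightarrow> \<bar>A x\<bar> \<le> C" using Icc_bounded_by[OF Ac] by blast
    show ?thesis
    proof (intro exI[of _ "\<bar>B x0\<bar> / C"] conjI allI impI)
      show "0 < \<bar>B x0\<bar> / C" using KB[OF x0(1)] C by simp
      fix \<epsilon> x assume *: "0 < \<epsilon> \<and> \<epsilon> < \<bar>B x0\<bar> / C \<and> x \<in> K"
      then have "\<bar>\<epsilon> * A x\<bar> \<le> \<epsilon> * C" using C(2)[of x] by (auto simp: abs_mult K_def intro!: mult_left_mono)
      also have "\<dots> < \<bar>B x0\<bar>" using * C by (simp add: field_simps)
      also have "\<dots> \<le> \<bar>B x\<bar>" using x0 * by auto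
      finally show "\<epsilon> * A x \<noteq> B x" by auto
    qed
  qed
  then obtain e0 where e0: "e0 > 0" "\<And>\<epsilon> x. 0 < \<epsilon> \<Longrightarrow> \<epsilon> < e0 \<Longrightarrow> x \<in> K \<Longrightarrow> \<epsilon> * A x \<noteq> B x" by blast
  define e1 where "e1 = Min (insert e0 (e ` insert M ?F))"
  have fin': "finite (insert e0 (e ` insert M ?F))" using fin by simp
  have e1: "0 < e1" unfolding e1_def using fin' e0 e by (subst Min_gr_iff) auto
  have e1_le: "e1 \<le> e0" "\<And>z. z \<in> insert M ?F \<Longrightarrow> e1 \<le> e z"
    unfolding e1_def by (rule Min_le[OF fin'], blast)+
  have close: "\<bar>\<Omega> \<epsilon> i - M\<bar> < \<eta>" if eps: "0 < \<epsilon>" "\<epsilon> < e1" for \<epsilon>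
  proof -
    let ?R = "{\<omega>. \<epsilon> * A \<omega> = B \<omega>}"
    have crd': "card (?Z \<epsilon> z (\<delta> z)) = m z" "finite (?Z \<epsilon> z (\<delta> z))" if z: "z \<in> insert M ?F" for z
    proof -
      show 1: "card (?Z \<epsilon> z (\<delta> z)) = m z" using crd[OF z eps(1)] e1_le(2)[OF z] eps by linarith
      have "B z = 0" using z M by auto
      then show "finite (?Z \<epsilon> z (\<delta> z))" using m_pos[of z] 1 card_gt_0_iff by metis
    qed
    have below: "{x \<in> ?R. x \<le> M - \<delta> M} = (\<Union>z\<in>?F. ?Z \<epsilon> z (\<delta> z))"
    proof (intro equalityI subsetI)
      fix x assume x: "x \<in> {x \<in> ?R. x \<le> M - \<delta> M}"
      then have "0 < x" using pos[of \<epsilon> x] eps by auto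
      moreover have "x \<notin> K" using e0(2)[of \<epsilon> x] x eps e1_le(1) by auto
      moreover have "x \<notin> {M - \<delta> M<..<M + \<delta> M}" using x by auto
      moreover have "x \<le> M" using x \<delta>(1)[of M] by auto
      ultimately obtain z where "z \<in> ?F" "x \<in> {z - \<delta> z<..<z + \<delta> z}" unfolding K_def by auto
      then show "x \<in> (\<Union>z\<in>?F. ?Z \<epsilon> z (\<delta> z))" using x by (intro UN_I[of z]) auto
    next
      fix x assume "x \<in> (\<Union>z\<in>?F. ?Z \<epsilon> z (\<delta> z))"
      then obtain z where z: "z \<in> ?F" "x \<in> ?Z \<epsilon> z (\<delta> z)" by blast
      then have "2 * \<delta>0 \<le> \<bar>z - M\<bar>" by (intro sep) auto
      then have "x \<le> M - \<delta> M" using z \<delta>(2)[of z] \<delta>(2)[of M] by (auto simp: abs_if split: if_splits)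
      then show "x \<in> {x \<in> ?R. x \<le> M - \<delta> M}" using z by auto
    qed
    have disj: "?Z \<epsilon> z (\<delta> z) \<inter> ?Z \<epsilon> z' (\<delta> z') = {}" if "z \<in> ?F" "z' \<in> ?F" "z \<noteq> z'" for z z'
    proof -
      have s: "2 * \<delta>0 \<le> \<bar>z - z'\<bar>" using that by (intro sep) auto
      have d: "\<delta> z \<le> \<delta>0" "\<delta> z' \<le> \<delta>0" using \<delta>(2) that by auto
      show ?thesis
      proof (rule ccontr)
        assume "\<not> ?thesis"
        then obtain x where "\<bar>x - z\<bar> < \<delta> z" "\<bar>x - z'\<bar> < \<delta> z'" by auto
        with s d show False by linarith
      qed
    qed
    have c1: "card {x \<in> ?R. x \<le> M - \<delta> M} = N" "finite {x \<in> ?R. x \<le> M - \<delta> M}"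
    proof -
      have "card (\<Union>z\<in>?F. ?Z \<epsilon> z (\<delta> z)) = (\<Sum>z\<in>?F. card (?Z \<epsilon> z (\<delta> z)))"
        by (rule card_UN_disjoint) (use fin crd'(2) disj in auto)
      also have "\<dots> = N" unfolding N[symmetric] by (rule sum.cong) (use crd'(1) in auto)
      finally show "card {x \<in> ?R. x \<le> M - \<delta> M} = N" unfolding below .
      show "finite {x \<in> ?R. x \<le> M - \<delta> M}" unfolding below
        using fin crd'(2) by (intro finite_UN_I) auto
    qed
    have split: "{x \<in> ?R. x < M + \<delta> M} = {x \<in> ?R. x \<le> M - \<delta> M} \<union> ?Z \<epsilon> M (\<delta> M)"
      using \<delta>(1)[of M] by auto
    have c2: "card {x \<in> ?R. x < M + \<delta> M} = N + m M"
      unfolding split c1(1)[symmetric] crd'(1)[of M, symmetric, OF insertI1]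
      by (rule card_Un_disjoint[OF c1(2) crd'(2)[OF insertI1]]) auto
    have f2: "finite {x \<in> ?R. x < M + \<delta> M}" unfolding split using c1(2) crd'(2)[OF insertI1] by simp
    have i1: "1 \<le> i" using i by simp
    have "\<Omega> \<epsilon> i \<le> M - \<delta> M \<longleftrightarrow> i \<le> N"
      by (rule enumeration_threshold[OF mono[OF eps(1)] _ _ _ i1]) (use c1 image[OF eps(1)] in auto)
    moreover have "\<Omega> \<epsilon> i < M + \<delta> M \<longleftrightarrow> i \<le> N + m M"
      by (rule enumeration_threshold[OF mono[OF eps(1)] _ _ _ i1]) (use c2 f2 image[OF eps(1)] in auto)
    ultimately have "M - \<delta> M < \<Omega> \<epsilon> i" "\<Omega> \<epsilon> i < M + \<delta> M" using i by auto
    then show ?thesis using \<delta>(2)[of M] \<delta>0 by auto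
  qed
  show "\<forall>\<^sub>F \<epsilon> in at_right 0. dist (\<Omega> \<epsilon> i) M < \<eta>"
    unfolding eventually_at_right_field dist_real_def using e1 close by auto
qed

section \<open>Projections onto planes as integral operators\<close>

definition plane :: "real set \<Rightarrow> (real \<Rightarrow> real) \<Rightarrow> (real \<Rightarrow> real) \<Rightarrow> (real \<Rightarrow> complex) set" where
  "plane S e f = {h \<in> L2 unweighted S. \<exists>c d :: complex. ae_eq S h (\<lambda>x. e x *\<^sub>R c + f x *\<^sub>R d)}"

definition ip :: "real set \<Rightarrow> (real \<Rightarrow> real) \<Rightarrow> (real \<Rightarrow> real) \<Rightarrow> real" where
  "ip S e f = (\<integral>x. e x * f x \<partial>lebesgue_on S)"

definition gram_det :: "real set \<Rightarrow> (real \<Rightarrow> real) \<Rightarrow> (real \<Rightarrow> real) \<Rightarrow> real" where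
  "gram_det S e f = ip S e e * ip S f f - (ip S e f)\<^sup>2"

text \<open>The kernel of the orthogonal projection onto the span of \<open>e\<close> and \<open>f\<close>, from the inverse of the Gram matrix.
  Representing projections as integral operators reduces their convergence in norm to uniform convergence
  of these kernels.\<close>

definition proj_kernel :: "real set \<Rightarrow> (real \<Rightarrow> real) \<Rightarrow> (real \<Rightarrow> real) \<Rightarrow> real \<times> real \<Rightarrow> real" where
  "proj_kernel S e f z =
     (ip S f f * (e (fst z) * e (snd z)) - ip S e f * (e (fst z) * f (snd z) + f (fst z) * e (snd z))
      + ip S e e * (f (fst z) * f (snd z))) * inverse (gram_det S e f)"

definition bdd_meas :: "real set \<Rightarrow> (real \<Rightarrow> real) \<Rightarrow> bool" where
  "bdd_meas S e \<longleftrightarrow> e \<in> borel_measurable (lebesgue_on S) \<and> bounded (e ` S)"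

lemma bdd_measE:
  assumes "bdd_meas S e"
  obtains B where "e \<in> borel_measurable (lebesgue_on S)" "\<And>x. x \<in> S \<Longrightarrow> \<bar>e x\<bar> \<le> B"
  using assms unfolding bdd_meas_def bounded_iff by (metis imageI real_norm_def)

lemma le_one_plus_square:
  fixes t :: real
  assumes "0 \<le> t"
  shows "t \<le> 1 + t\<^sup>2"
proof -
  have "0 \<le> (t - 1)\<^sup>2" by simp
  then have "2 * t \<le> 1 + t\<^sup>2" by (simp add: power2_diff)
  with assms show ?thesis by linarith
qed

context
  fixes S :: "real set" assumes S: "S \<in> lmeasurable"
begin

interpretation finite_measure "lebesgue_on S"
  using S by (rule finite_measure_lebesgue_on)

lemma L2_integrable:
  assumes "h \<in> L2 unweighted S" "bdd_meas S e"
  shows "integrable (lebesgue_on S) (\<lambda>x. e x *\<^sub>R h x)"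
proof -
  obtain B where e: "e \<in> borel_measurable (lebesgue_on S)" "\<And>x. x \<in> S \<Longrightarrow> \<bar>e x\<bar> \<le> B"
    using assms(2) by (rule bdd_measE) blast
  have h: "h \<in> borel_measurable (lebesgue_on S)" "integrable (lebesgue_on S) (\<lambda>x. (cmod (h x))\<^sup>2)"
    using assms(1) by (auto simp: L2_def)
  show ?thesis
  proof (rule Bochner_Integration.integrable_bound)
    show "integrable (lebesgue_on S) (\<lambda>x. \<bar>B\<bar> * (1 + (cmod (h x))\<^sup>2))"
      using h(2) by simp
    show "(\<lambda>x. e x *\<^sub>R h x) \<in> borel_measurable (lebesgue_on S)" using e(1) h(1) by measurable
    show "AE x in lebesgue_on S. norm (e x *\<^sub>R h x) \<le> norm (\<bar>B\<bar> * (1 + (cmod (h x))\<^sup>2))"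
    proof (rule AE_I2)
      fix x assume "x \<in> space (lebesgue_on S)"
      then have "\<bar>e x\<bar> \<le> \<bar>B\<bar>" using e(2)[of x] by simp
      moreover have "cmod (h x) \<le> 1 + (cmod (h x))\<^sup>2"
        by (simp add: le_one_plus_square)
      ultimately show "norm (e x *\<^sub>R h x) \<le> norm (\<bar>B\<bar> * (1 + (cmod (h x))\<^sup>2))"
        by (simp add: abs_mult mult_mono)
    qed
  qed
qed

lemma bdd_meas_integrable:
  assumes "bdd_meas S e" "bdd_meas S f"
  shows "integrable (lebesgue_on S) (\<lambda>x. e x * f x)"
proof -
  obtain B where e: "e \<in> borel_measurable (lebesgue_on S)" "\<And>x. x \<in> S \<Longrightarrow> \<bar>e x\<bar> \<le> B"
    using assms(1) by (rule bdd_measE) blast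
  obtain C where f: "f \<in> borel_measurable (lebesgue_on S)" "\<And>x. x \<in> S \<Longrightarrow> \<bar>f x\<bar> \<le> C"
    using assms(2) by (rule bdd_measE) blast
  show ?thesis
  proof (rule integrable_const_bound[of _ "\<bar>B\<bar> * \<bar>C\<bar>"])
    show "AE x in lebesgue_on S. norm (e x * f x) \<le> \<bar>B\<bar> * \<bar>C\<bar>"
      by (rule AE_I2) (auto simp: abs_mult intro!: mult_mono order_trans[OF e(2)] order_trans[OF f(2)])
    show "(\<lambda>x. e x * f x) \<in> borel_measurable (lebesgue_on S)" using e(1) f(1) by measurable
  qed
qed

lemma combination_in_L2:
  assumes "bdd_meas S e" "bdd_meas S f"
  shows "(\<lambda>x. e x *\<^sub>R (c::complex) + f x *\<^sub>R d) \<in> L2 unweighted S"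
proof -
  obtain B where e: "e \<in> borel_measurable (lebesgue_on S)" "\<And>x. x \<in> S \<Longrightarrow> \<bar>e x\<bar> \<le> B"
    using assms(1) by (rule bdd_measE) blast
  obtain C where f: "f \<in> borel_measurable (lebesgue_on S)" "\<And>x. x \<in> S \<Longrightarrow> \<bar>f x\<bar> \<le> C"
    using assms(2) by (rule bdd_measE) blast
  show ?thesis
  proof (rule bounded_measurable_in_L2[OF S])
    show "(\<lambda>x. e x *\<^sub>R c + f x *\<^sub>R d) \<in> borel_measurable (lebesgue_on S)" using e(1) f(1) by measurable
    show "norm (e x *\<^sub>R c + f x *\<^sub>R d) \<le> B * norm c + C * norm d" if "x \<in> S" for x
      using norm_triangle_ineq[of "e x *\<^sub>R c" "f x *\<^sub>R d"]
        mult_right_mono[OF e(2)[OF that], of "norm c"] mult_right_mono[OF f(2)[OF that], of "norm d"]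
      by simp
  qed
qed

text \<open>The orthogonality conditions of the projection onto the plane form a linear system with the
  Gram matrix; Cramer's rule solves it.\<close>

lemma residual_inner:
  assumes e: "bdd_meas S e" and f: "bdd_meas S f" and h: "h \<in> L2 unweighted S"
    and g: "g \<in> L2 unweighted S" "ae_eq S g (\<lambda>x. e x *\<^sub>R c + f x *\<^sub>R d)"
    and k: "k \<in> L2 unweighted S" "ae_eq S k (\<lambda>x. e x *\<^sub>R c' + f x *\<^sub>R d')"
  shows "L2_inner unweighted S (\<lambda>x. h x - g x) k =
     cnj c' * ((\<integral>x. e x *\<^sub>R h x \<partial>lebesgue_on S) - ip S e e *\<^sub>R c - ip S e f *\<^sub>R d) +
     cnj d' * ((\<integral>x. f x *\<^sub>R h x \<partial>lebesgue_on S) - ip S e f *\<^sub>R c - ip S f f *\<^sub>R d)"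
proof -
  let ?M = "lebesgue_on S"
  note ei = L2_integrable[OF h e] and fi = L2_integrable[OF h f]
  note ee = bdd_meas_integrable[OF e e] and ef = bdd_meas_integrable[OF e f]
    and ff = bdd_meas_integrable[OF f f]
  let ?rhs = "\<lambda>x. cnj c' * (e x *\<^sub>R h x - (e x * e x) *\<^sub>R c - (e x * f x) *\<^sub>R d) +
       cnj d' * (f x *\<^sub>R h x - (e x * f x) *\<^sub>R c - (f x * f x) *\<^sub>R d)"
  have i1: "integrable ?M (\<lambda>x. e x *\<^sub>R h x - (e x * e x) *\<^sub>R c - (e x * f x) *\<^sub>R d)"
    by (intro Bochner_Integration.integrable_diff integrable_scaleR_left ei ee ef)
  have i2: "integrable ?M (\<lambda>x. f x *\<^sub>R h x - (e x * f x) *\<^sub>R c - (f x * f x) *\<^sub>R d)"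
    by (intro Bochner_Integration.integrable_diff integrable_scaleR_left fi ff ef)
  have "L2_inner unweighted S (\<lambda>x. h x - g x) k = (\<integral>x. ?rhs x \<partial>?M)"
    unfolding L2_inner_def
  proof (rule integral_cong_AE)
    have [measurable]: "h \<in> borel_measurable ?M" "g \<in> borel_measurable ?M" "k \<in> borel_measurable ?M"
      using h g k by (auto simp: L2_def)
    have [measurable]: "cnj \<in> borel_measurable borel"
      by (intro borel_measurable_continuous_onI continuous_intros)
    show "(\<lambda>x. of_real (unweighted x) * (h x - g x) * cnj (k x)) \<in> borel_measurable ?M"
      by measurable
    show "?rhs \<in> borel_measurable ?M"
      using i1 i2 by (intro borel_measurable_integrable Bochner_Integration.integrable_add
          integrable_mult_right) auto
    show "AE x in ?M. of_real (unweighted x) * (h x - g x) * cnj (k x) = ?rhs x"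
      using g(2) k(2) unfolding ae_eq_def
      by eventually_elim (simp add: scaleR_conv_of_real algebra_simps)
  qed
  also have "\<dots> = cnj c' * ((\<integral>x. e x *\<^sub>R h x \<partial>?M) - ip S e e *\<^sub>R c - ip S e f *\<^sub>R d) +
     cnj d' * ((\<integral>x. f x *\<^sub>R h x \<partial>?M) - ip S e f *\<^sub>R c - ip S f f *\<^sub>R d)"
    using i1 i2 ei fi ee ef ff by (simp add: ip_def)
  finally show ?thesis .
qed

lemma kernel_integral:
  assumes e: "bdd_meas S e" and f: "bdd_meas S f" and h: "h \<in> L2 unweighted S"
  defines "H0 \<equiv> (\<integral>x. e x *\<^sub>R h x \<partial>lebesgue_on S)" and "H1 \<equiv> (\<integral>x. f x *\<^sub>R h x \<partial>lebesgue_on S)"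
  shows "integrable (lebesgue_on S) (\<lambda>y. proj_kernel S e f (x, y) *\<^sub>R h y)"
    "(\<integral>y. proj_kernel S e f (x, y) *\<^sub>R h y \<partial>lebesgue_on S) =
      e x *\<^sub>R (inverse (gram_det S e f) *\<^sub>R (ip S f f *\<^sub>R H0 - ip S e f *\<^sub>R H1)) +
      f x *\<^sub>R (inverse (gram_det S e f) *\<^sub>R (ip S e e *\<^sub>R H1 - ip S e f *\<^sub>R H0))"
proof -
  let ?g = "inverse (gram_det S e f)"
  have eq: "proj_kernel S e f (x, y) *\<^sub>R h y =
     (?g * (e x * ip S f f - f x * ip S e f)) *\<^sub>R (e y *\<^sub>R h y) +
     (?g * (f x * ip S e e - e x * ip S e f)) *\<^sub>R (f y *\<^sub>R h y)" for y
    by (simp add: proj_kernel_def scaleR_add_left[symmetric] del: scaleR_left_distrib) (simp add: algebra_simps)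
  note ei = L2_integrable[OF h e] and fi = L2_integrable[OF h f]
  show "integrable (lebesgue_on S) (\<lambda>y. proj_kernel S e f (x, y) *\<^sub>R h y)"
    unfolding eq using ei fi by (intro Bochner_Integration.integrable_add integrable_scaleR_right) auto
  have "(\<integral>y. proj_kernel S e f (x, y) *\<^sub>R h y \<partial>lebesgue_on S) =
     (?g * (e x * ip S f f - f x * ip S e f)) *\<^sub>R H0 + (?g * (f x * ip S e e - e x * ip S e f)) *\<^sub>R H1"
    unfolding eq H0_def H1_def
    by (rule trans[OF Bochner_Integration.integral_add])
       (simp_all only: integral_scaleR_right integrable_scaleR_right ei fi)
  then show "(\<integral>y. proj_kernel S e f (x, y) *\<^sub>R h y \<partial>lebesgue_on S) =
      e x *\<^sub>R (?g *\<^sub>R (ip S f f *\<^sub>R H0 - ip S e f *\<^sub>R H1)) +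
      f x *\<^sub>R (?g *\<^sub>R (ip S e e *\<^sub>R H1 - ip S e f *\<^sub>R H0))"
    by (simp add: algebra_simps)
qed

lemma cramer_2x2:
  fixes H0 H1 c d :: complex and G00 G01 G11 :: real
  assumes "G00 * G11 - G01\<^sup>2 \<noteq> 0"
  shows "H0 - G00 *\<^sub>R c - G01 *\<^sub>R d = 0 \<and> H1 - G01 *\<^sub>R c - G11 *\<^sub>R d = 0 \<longleftrightarrow>
    c = inverse (G00 * G11 - G01\<^sup>2) *\<^sub>R (G11 *\<^sub>R H0 - G01 *\<^sub>R H1) \<and>
    d = inverse (G00 * G11 - G01\<^sup>2) *\<^sub>R (G00 *\<^sub>R H1 - G01 *\<^sub>R H0)"
proof -
  define D where "D = G00 * G11 - G01\<^sup>2"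
  have D: "D \<noteq> 0" using assms by (simp add: D_def)
  show ?thesis unfolding D_def[symmetric]
  proof
    assume *: "H0 - G00 *\<^sub>R c - G01 *\<^sub>R d = 0 \<and> H1 - G01 *\<^sub>R c - G11 *\<^sub>R d = 0"
    then have H: "H0 = G00 *\<^sub>R c + G01 *\<^sub>R d" "H1 = G01 *\<^sub>R c + G11 *\<^sub>R d"
      by (simp_all add: algebra_simps)
    have "G11 *\<^sub>R H0 - G01 *\<^sub>R H1 = D *\<^sub>R c" "G00 *\<^sub>R H1 - G01 *\<^sub>R H0 = D *\<^sub>R d"
      unfolding H by (simp_all add: D_def algebra_simps power2_eq_square)
    then show "c = inverse D *\<^sub>R (G11 *\<^sub>R H0 - G01 *\<^sub>R H1) \<and> d = inverse D *\<^sub>R (G00 *\<^sub>R H1 - G01 *\<^sub>R H0)"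
      using D by simp
  next
    assume *: "c = inverse D *\<^sub>R (G11 *\<^sub>R H0 - G01 *\<^sub>R H1) \<and> d = inverse D *\<^sub>R (G00 *\<^sub>R H1 - G01 *\<^sub>R H0)"
    have Dc: "D *\<^sub>R c = G11 *\<^sub>R H0 - G01 *\<^sub>R H1" and Dd: "D *\<^sub>R d = G00 *\<^sub>R H1 - G01 *\<^sub>R H0"
      using * D by simp_all
    have "D *\<^sub>R (H0 - G00 *\<^sub>R c - G01 *\<^sub>R d) = D *\<^sub>R H0 - G00 *\<^sub>R (D *\<^sub>R c) - G01 *\<^sub>R (D *\<^sub>R d)"
      by (simp add: algebra_simps)
    also have "\<dots> = 0" unfolding Dc Dd by (simp add: D_def algebra_simps power2_eq_square)
    finally have 1: "H0 - G00 *\<^sub>R c - G01 *\<^sub>R d = 0" using D by simp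
    have "D *\<^sub>R (H1 - G01 *\<^sub>R c - G11 *\<^sub>R d) = D *\<^sub>R H1 - G01 *\<^sub>R (D *\<^sub>R c) - G11 *\<^sub>R (D *\<^sub>R d)"
      by (simp add: algebra_simps)
    also have "\<dots> = 0" unfolding Dc Dd by (simp add: D_def algebra_simps power2_eq_square)
    finally show "H0 - G00 *\<^sub>R c - G01 *\<^sub>R d = 0 \<and> H1 - G01 *\<^sub>R c - G11 *\<^sub>R d = 0"
      using 1 D by simp
  qed
qed

lemma orth_proj_plane:
  assumes e: "bdd_meas S e" and f: "bdd_meas S f" and D: "gram_det S e f \<noteq> 0"
    and h: "h \<in> L2 unweighted S"
  shows "ae_eq S (orth_proj S (plane S e f) h) (\<lambda>x. \<integral>y. proj_kernel S e f (x, y) *\<^sub>R h y \<partial>lebesgue_on S)"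
    "orth_proj S (plane S e f) h \<in> L2 unweighted S"
proof -
  define H0 where "H0 = (\<integral>x. e x *\<^sub>R h x \<partial>lebesgue_on S)"
  define H1 where "H1 = (\<integral>x. f x *\<^sub>R h x \<partial>lebesgue_on S)"
  let ?c = "inverse (gram_det S e f) *\<^sub>R (ip S f f *\<^sub>R H0 - ip S e f *\<^sub>R H1)"
  let ?d = "inverse (gram_det S e f) *\<^sub>R (ip S e e *\<^sub>R H1 - ip S e f *\<^sub>R H0)"
  let ?p = "\<lambda>x. e x *\<^sub>R ?c + f x *\<^sub>R ?d"
  let ?P = "\<lambda>g. g \<in> plane S e f \<and> (\<forall>k\<in>plane S e f. L2_inner unweighted S (\<lambda>x. h x - g x) k = 0)"
  note cr = cramer_2x2[OF D[unfolded gram_det_def], of H0 _ _ H1, folded gram_det_def]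
  note res = residual_inner[OF e f h, folded H0_def H1_def]
  have pL: "?p \<in> L2 unweighted S" by (rule combination_in_L2[OF e f])
  have "?P ?p"
  proof (intro conjI ballI)
    show "?p \<in> plane S e f"
      unfolding plane_def by (intro CollectI conjI exI, rule pL, rule ae_eq_refl)
    fix k assume "k \<in> plane S e f"
    then obtain c' d' where k: "k \<in> L2 unweighted S" "ae_eq S k (\<lambda>x. e x *\<^sub>R c' + f x *\<^sub>R d')"
      by (auto simp: plane_def)
    note cz = iffD2[OF cr conjI[OF refl refl]]
    have z: "H0 - ip S e e *\<^sub>R ?c - ip S e f *\<^sub>R ?d = 0" "H1 - ip S e f *\<^sub>R ?c - ip S f f *\<^sub>R ?d = 0"
      by (rule conjunct1[OF cz], rule conjunct2[OF cz])
    show "L2_inner unweighted S (\<lambda>x. h x - ?p x) k = 0"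
      unfolding res[OF pL ae_eq_refl k] z by simp
  qed
  then have P: "?P (orth_proj S (plane S e f) h)"
    unfolding orth_proj_def by (rule someI[where P = ?P])
  let ?g = "orth_proj S (plane S e f) h"
  obtain c d where g: "?g \<in> L2 unweighted S" "ae_eq S ?g (\<lambda>x. e x *\<^sub>R c + f x *\<^sub>R d)"
    using P by (auto simp: plane_def)
  have el: "(\<lambda>x. e x *\<^sub>R (1::complex) + f x *\<^sub>R 0) \<in> plane S e f" "(\<lambda>x. e x *\<^sub>R (0::complex) + f x *\<^sub>R 1) \<in> plane S e f"
    unfolding plane_def using combination_in_L2[OF e f] ae_eq_refl by blast+
  have s0: "H0 - ip S e e *\<^sub>R c - ip S e f *\<^sub>R d = 0"
    using P el(1) res[OF g combination_in_L2[OF e f] ae_eq_refl, of 1 0] by simp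
  have s1: "H1 - ip S e f *\<^sub>R c - ip S f f *\<^sub>R d = 0"
    using P el(2) res[OF g combination_in_L2[OF e f] ae_eq_refl, of 0 1] by simp
  note cd = iffD1[OF cr conjI[OF s0 s1]]
  have "ae_eq S ?g ?p"
    using g(2) unfolding conjunct1[OF cd, symmetric] conjunct2[OF cd, symmetric] .
  then show "ae_eq S ?g (\<lambda>x. \<integral>y. proj_kernel S e f (x, y) *\<^sub>R h y \<partial>lebesgue_on S)"
    by (simp only: kernel_integral(2)[OF e f h] H0_def H1_def)
  show "?g \<in> L2 unweighted S" by (rule g(1))
qed

text \<open>On a set of measure \<open>m\<close> the unit ball of \<open>L\<^sub>2\<close> satisfies \<open>\<integral> \<bar>h\<bar> \<le> m + 1\<close>, since \<open>t \<le> 1 + t\<^sup>2\<close>. So a kernel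
  bounded by \<open>\<eta>\<close> maps it to functions bounded by \<open>\<eta> (m + 1)\<close>.\<close>

lemma op_norm_projection_diff:
  assumes e: "bdd_meas S e" and f: "bdd_meas S f" and D: "gram_det S e f \<noteq> 0"
    and e': "bdd_meas S e'" and f': "bdd_meas S f'" and D': "gram_det S e' f' \<noteq> 0"
    and K: "\<And>z. z \<in> S \<times> S \<Longrightarrow> \<bar>proj_kernel S e f z - proj_kernel S e' f' z\<bar> \<le> \<eta>"
    and eta: "0 \<le> \<eta>"
  defines "N \<equiv> op_norm S (\<lambda>h x. orth_proj S (plane S e f) h x - orth_proj S (plane S e' f') h x)"
  shows "0 \<le> N" "N \<le> \<eta> * ((measure lebesgue S + 1) * sqrt (measure lebesgue S))"
proof -
  let ?M = "lebesgue_on S" and ?m = "measure lebesgue S"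
  have mS: "measure ?M (space ?M) = ?m"
    using S by (simp add: measure_restrict_space)
  let ?T = "\<lambda>h x. orth_proj S (plane S e f) h x - orth_proj S (plane S e' f') h x"
  let ?U = "{h \<in> L2 unweighted S. L2_norm unweighted S h \<le> 1}"
  let ?C = "\<eta> * ((?m + 1) * sqrt ?m)"
  have bound: "L2_norm unweighted S (?T h) \<le> ?C" if hU: "h \<in> ?U" for h
  proof -
    have h: "h \<in> L2 unweighted S" using hU by simp
    have hi: "integrable ?M (\<lambda>x. (cmod (h x))\<^sup>2)" using h by (simp add: L2_def)
    have h1: "(\<integral>x. (cmod (h x))\<^sup>2 \<partial>?M) \<le> 1" using hU by (simp add: L2_norm_def)
    have "integrable ?M (\<lambda>x. 1 *\<^sub>R h x)"
      by (rule L2_integrable[OF h]) (auto simp: bdd_meas_def intro: bounded_subset[of "{1}"])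
    then have hint: "integrable ?M (\<lambda>x. norm (h x))" by simp
    have "(\<integral>x. norm (h x) \<partial>?M) \<le> (\<integral>x. 1 + (cmod (h x))\<^sup>2 \<partial>?M)"
    proof (rule integral_mono[OF hint])
      show "norm (h x) \<le> 1 + (cmod (h x))\<^sup>2" for x
        by (simp add: le_one_plus_square)
    qed (use hi in simp)
    also have "\<dots> = ?m + (\<integral>x. (cmod (h x))\<^sup>2 \<partial>?M)" using hi mS by simp
    finally have hn: "(\<integral>x. norm (h x) \<partial>?M) \<le> ?m + 1" using h1 by simp
    note p = orth_proj_plane[OF e f D h] and p' = orth_proj_plane[OF e' f' D' h]
    have pt: "cmod ((\<integral>y. proj_kernel S e f (x, y) *\<^sub>R h y \<partial>?M) -
        (\<integral>y. proj_kernel S e' f' (x, y) *\<^sub>R h y \<partial>?M)) \<le> \<eta> * (?m + 1)" if "x \<in> S" for x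
    proof -
      note ki = kernel_integral(1)[OF e f h, of x] kernel_integral(1)[OF e' f' h, of x]
      have eq: "(\<integral>y. proj_kernel S e f (x, y) *\<^sub>R h y \<partial>?M) - (\<integral>y. proj_kernel S e' f' (x, y) *\<^sub>R h y \<partial>?M)
         = (\<integral>y. proj_kernel S e f (x, y) *\<^sub>R h y - proj_kernel S e' f' (x, y) *\<^sub>R h y \<partial>?M)"
        using ki by simp
      have "cmod ((\<integral>y. proj_kernel S e f (x, y) *\<^sub>R h y \<partial>?M) -
        (\<integral>y. proj_kernel S e' f' (x, y) *\<^sub>R h y \<partial>?M)) \<le> (\<integral>y. norm (proj_kernel S e f (x, y) *\<^sub>R h y - proj_kernel S e' f' (x, y) *\<^sub>R h y) \<partial>?M)"
        unfolding eq by (rule integral_norm_bound)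
      also have "\<dots> \<le> (\<integral>y. \<eta> * norm (h y) \<partial>?M)"
      proof (rule integral_mono)
        show "integrable ?M (\<lambda>y. norm (proj_kernel S e f (x, y) *\<^sub>R h y - proj_kernel S e' f' (x, y) *\<^sub>R h y))"
          using ki by simp
        show "integrable ?M (\<lambda>y. \<eta> * norm (h y))" using hint by simp
        show "norm (proj_kernel S e f (x, y) *\<^sub>R h y - proj_kernel S e' f' (x, y) *\<^sub>R h y) \<le> \<eta> * norm (h y)"
          if "y \<in> space ?M" for y
          using K[of "(x, y)"] \<open>x \<in> S\<close> that mult_right_mono[OF K[of "(x, y)"], of "norm (h y)"]
          by (simp add: scaleR_diff_left[symmetric])
      qed
      also have "\<dots> \<le> \<eta> * (?m + 1)" using hn eta by (simp add: mult_left_mono)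
      finally show ?thesis .
    qed
    have "AE x in ?M. 1 * (cmod (?T h x))\<^sup>2 \<le> (\<eta> * (?m + 1))\<^sup>2"
    proof -
      have "AE x in ?M. x \<in> S" by (rule AE_I2) simp
      then show ?thesis
        using p(1) p'(1) unfolding ae_eq_def
      proof eventually_elim
        case (elim x)
        have "cmod (?T h x) \<le> \<eta> * (?m + 1)" unfolding elim(2,3) by (rule pt[OF elim(1)])
        then show ?case by (simp add: power_mono)
      qed
    qed
    note ae = this
    have Tm: "(\<lambda>x. 1 * (cmod (?T h x))\<^sup>2) \<in> borel_measurable ?M"
    proof -
      have [measurable]: "orth_proj S (plane S e f) h \<in> borel_measurable ?M"
          "orth_proj S (plane S e' f') h \<in> borel_measurable ?M"
        using p(2) p'(2) by (auto simp: L2_def)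
      show ?thesis by measurable
    qed
    have "integrable ?M (\<lambda>x. 1 * (cmod (?T h x))\<^sup>2)"
      by (rule integrable_const_bound[of _ "(\<eta> * (?m + 1))\<^sup>2", OF _ Tm]) (use ae in simp)
    then have "(\<integral>x. 1 * (cmod (?T h x))\<^sup>2 \<partial>?M) \<le> (\<integral>x. (\<eta> * (?m + 1))\<^sup>2 \<partial>?M)"
      using ae by (intro integral_mono_AE) auto
    also have "\<dots> = (\<eta> * (?m + 1))\<^sup>2 * ?m" using mS by simp
    finally have "L2_norm unweighted S (?T h) \<le> sqrt ((\<eta> * (?m + 1))\<^sup>2 * ?m)"
      unfolding L2_norm_def by (rule real_sqrt_le_mono)
    also have "\<dots> = ?C" using eta by (simp add: real_sqrt_mult)
    finally show ?thesis .
  qed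
  have z: "(\<lambda>_. 0) \<in> ?U" by (simp add: L2_def L2_norm_def)
  have bdd: "bdd_above ((\<lambda>h. L2_norm unweighted S (?T h)) ` ?U)"
    using bound by (intro bdd_aboveI2) blast
  show "N \<le> ?C" unfolding N_def op_norm_def using z bound by (intro cSUP_least) blast+
  have "0 \<le> L2_norm unweighted S (?T (\<lambda>_. 0))" by (simp add: L2_norm_def)
  then show "0 \<le> N" unfolding N_def op_norm_def by (rule cSUP_upper2[OF bdd z])
qed

end

lemma uniform_limit_constant_family:
  assumes "(c \<longlongrightarrow> (l::real)) F"
  shows "uniform_limit X (\<lambda>\<epsilon> x. c \<epsilon>) (\<lambda>x. l) F"
proof (rule uniform_limitI)
  fix e :: real assume "0 < e"
  then have "\<forall>\<^sub>F \<epsilon> in F. dist (c \<epsilon>) l < e" by (rule tendstoD[OF assms])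
  then show "\<forall>\<^sub>F \<epsilon> in F. \<forall>x\<in>X. dist (c \<epsilon>) l < e" by eventually_elim simp
qed

lemma uniform_limit_precompose:
  assumes "uniform_limit X f l F" "g ` Y \<subseteq> X"
  shows "uniform_limit Y (\<lambda>\<epsilon> y. f \<epsilon> (g y)) (\<lambda>y. l (g y)) F"
proof (rule uniform_limitI)
  fix e :: real assume "0 < e"
  from uniform_limitD[OF assms(1) this]
  show "\<forall>\<^sub>F \<epsilon> in F. \<forall>y\<in>Y. dist (f \<epsilon> (g y)) (l (g y)) < e"
  proof eventually_elim
    case (elim \<epsilon>)
    then show ?case using assms(2) by blast
  qed
qed

text \<open>Uniform convergence to a bounded limit is preserved by all operations that occur in the kernel
  of the projection.\<close>

definition blim :: "'b set \<Rightarrow> ('a \<Rightarrow> 'b \<Rightarrow> real) \<Rightarrow> ('b \<Rightarrow> real) \<Rightarrow> 'a filter \<Rightarrow> bool" where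
  "blim X f l F \<longleftrightarrow> uniform_limit X f l F \<and> bounded (l ` X)"

lemma blim_const:
  assumes "(c \<longlongrightarrow> l) F"
  shows "blim X (\<lambda>\<epsilon> x. c \<epsilon>) (\<lambda>x. l) F"
proof -
  have "bounded ((\<lambda>x. l) ` X)" by (rule bounded_subset[of "{l}"]) auto
  then show ?thesis unfolding blim_def by (intro conjI uniform_limit_constant_family[OF assms])
qed

lemma bounded_image_combine:
  fixes l m :: "'b \<Rightarrow> real"
  assumes "bounded (l ` X)" "bounded (m ` X)"
  shows "bounded ((\<lambda>x. l x * m x) ` X)" "bounded ((\<lambda>x. l x + m x) ` X)" "bounded ((\<lambda>x. l x - m x) ` X)"
proof -
  obtain B C where B: "\<forall>x\<in>l ` X. norm x \<le> B" and C: "\<forall>x\<in>m ` X. norm x \<le> C"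
    using assms unfolding bounded_iff by blast
  have l: "\<bar>l x\<bar> \<le> B" and m: "\<bar>m x\<bar> \<le> C" if "x \<in> X" for x using B C that by auto
  show "bounded ((\<lambda>x. l x * m x) ` X)"
    unfolding bounded_iff
    by (intro exI[of _ "\<bar>B\<bar> * \<bar>C\<bar>"]) (auto simp: abs_mult intro!: mult_mono order_trans[OF l] order_trans[OF m])
  show "bounded ((\<lambda>x. l x + m x) ` X)"
    unfolding bounded_iff using l m by (intro exI[of _ "B + C"]) (auto intro!: order_trans[OF abs_triangle_ineq] add_mono)
  show "bounded ((\<lambda>x. l x - m x) ` X)"
    unfolding bounded_iff using l m by (intro exI[of _ "B + C"]) (auto intro!: order_trans[OF abs_triangle_ineq4] add_mono)
qed

lemma
  assumes "blim X f l F" "blim X g m F"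
  shows blim_mult: "blim X (\<lambda>\<epsilon> x. f \<epsilon> x * g \<epsilon> x) (\<lambda>x. l x * m x) F"
    and blim_add: "blim X (\<lambda>\<epsilon> x. f \<epsilon> x + g \<epsilon> x) (\<lambda>x. l x + m x) F"
    and blim_diff: "blim X (\<lambda>\<epsilon> x. f \<epsilon> x - g \<epsilon> x) (\<lambda>x. l x - m x) F"
proof -
  have f: "uniform_limit X f l F" "bounded (l ` X)" and g: "uniform_limit X g m F" "bounded (m ` X)"
    using assms by (simp_all add: blim_def)
  note b = bounded_image_combine[OF f(2) g(2)]
  show "blim X (\<lambda>\<epsilon> x. f \<epsilon> x * g \<epsilon> x) (\<lambda>x. l x * m x) F"
    unfolding blim_def by (rule conjI[OF uniform_lim_mult[OF f(1) g(1) f(2) g(2)] b(1)])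
  show "blim X (\<lambda>\<epsilon> x. f \<epsilon> x + g \<epsilon> x) (\<lambda>x. l x + m x) F"
    unfolding blim_def by (rule conjI[OF uniform_limit_add[OF f(1) g(1)] b(2)])
  show "blim X (\<lambda>\<epsilon> x. f \<epsilon> x - g \<epsilon> x) (\<lambda>x. l x - m x) F"
    unfolding blim_def by (rule conjI[OF uniform_limit_minus[OF f(1) g(1)] b(3)])
qed

lemma blim_precompose:
  assumes "blim X f l F" "g ` Y \<subseteq> X"
  shows "blim Y (\<lambda>\<epsilon> y. f \<epsilon> (g y)) (\<lambda>y. l (g y)) F"
proof -
  have "bounded ((\<lambda>y. l (g y)) ` Y)"
    by (rule bounded_subset[of "l ` X"]) (use assms in \<open>auto simp: blim_def\<close>)
  then show ?thesis
    using assms unfolding blim_def by (intro conjI uniform_limit_precompose[where g = g and X = X]) auto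
qed

context
  fixes S :: "real set" assumes S: "S \<in> lmeasurable"
begin

interpretation finite_measure "lebesgue_on S"
  using S by (rule finite_measure_lebesgue_on)

lemma ip_tendsto:
  assumes lim: "blim S E e F" "blim S G g F" and m: "bdd_meas S e" "bdd_meas S g"
    and ev: "\<forall>\<^sub>F \<epsilon> in F. bdd_meas S (E \<epsilon>) \<and> bdd_meas S (G \<epsilon>)"
  shows "((\<lambda>\<epsilon>. ip S (E \<epsilon>) (G \<epsilon>)) \<longlongrightarrow> ip S e g) F"
proof (rule tendstoI)
  fix \<eta> :: real assume "0 < \<eta>"
  let ?m = "measure lebesgue S"
  have mS: "measure (lebesgue_on S) (space (lebesgue_on S)) = ?m"
    using S by (simp add: measure_restrict_space)
  define \<delta> where "\<delta> = \<eta> / (?m + 1)"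
  have m0: "0 < ?m + 1" using measure_nonneg[of lebesgue S] by linarith
  have \<delta>: "0 < \<delta>" using \<open>0 < \<eta>\<close> m0 by (simp add: \<delta>_def)
  have "\<forall>\<^sub>F \<epsilon> in F. \<forall>x\<in>S. dist (E \<epsilon> x * G \<epsilon> x) (e x * g x) < \<delta>"
    using blim_mult[OF lim] \<delta> by (auto simp: blim_def dest: uniform_limitD)
  then show "\<forall>\<^sub>F \<epsilon> in F. dist (ip S (E \<epsilon>) (G \<epsilon>)) (ip S e g) < \<eta>"
    using ev
  proof eventually_elim
    case (elim \<epsilon>)
    have i: "integrable (lebesgue_on S) (\<lambda>x. E \<epsilon> x * G \<epsilon> x)" "integrable (lebesgue_on S) (\<lambda>x. e x * g x)"
      using elim(2) m bdd_meas_integrable[OF S] by auto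
    have "ip S (E \<epsilon>) (G \<epsilon>) - ip S e g = (\<integral>x. E \<epsilon> x * G \<epsilon> x - e x * g x \<partial>lebesgue_on S)"
      using i by (simp add: ip_def)
    moreover have "norm (\<integral>x. E \<epsilon> x * G \<epsilon> x - e x * g x \<partial>lebesgue_on S)
        \<le> (\<integral>x. norm (E \<epsilon> x * G \<epsilon> x - e x * g x) \<partial>lebesgue_on S)"
      by (rule integral_norm_bound)
    moreover have "(\<integral>x. norm (E \<epsilon> x * G \<epsilon> x - e x * g x) \<partial>lebesgue_on S) \<le> (\<integral>x. \<delta> \<partial>lebesgue_on S)"
      by (rule integral_mono) (use i elim(1) in \<open>auto simp: dist_real_def less_imp_le\<close>)
    moreover have "(\<integral>x. \<delta> \<partial>lebesgue_on S) = \<delta> * ?m" using mS by simp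
    moreover have "\<delta> * ?m < \<delta> * (?m + 1)" using \<delta> by (simp add: algebra_simps)
    moreover have "\<delta> * (?m + 1) = \<eta>" using m0 by (simp add: \<delta>_def)
    ultimately show ?case unfolding dist_real_def real_norm_def by linarith
  qed
qed

lemma ip_self_zero:
  assumes "bdd_meas S e" "ip S e e = 0"
  shows "AE x in lebesgue_on S. e x = 0"
proof -
  have "AE x in lebesgue_on S. e x * e x = 0"
    using assms(2) integral_nonneg_eq_0_iff_AE[OF bdd_meas_integrable[OF S assms(1) assms(1)]]
    by (simp add: ip_def)
  then show ?thesis by eventually_elim simp
qed

text \<open>If the Gram determinant vanishes, then \<open>\<langle>f, f\<rangle> e - \<langle>e, f\<rangle> f\<close> has norm zero.\<close>

lemma gram_det_nonzero:
  assumes e: "bdd_meas S e" and f: "bdd_meas S f"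
    and indep: "\<And>c d :: real. AE x in lebesgue_on S. c * e x + d * f x = 0 \<Longrightarrow> c = 0 \<and> d = 0"
  shows "gram_det S e f \<noteq> 0"
proof
  assume D: "gram_det S e f = 0"
  let ?c = "ip S f f" and ?d = "- ip S e f"
  let ?g = "\<lambda>x. ?c * e x + ?d * f x"
  obtain B where B: "e \<in> borel_measurable (lebesgue_on S)" "\<And>x. x \<in> S \<Longrightarrow> \<bar>e x\<bar> \<le> B"
    using e by (rule bdd_measE) blast
  obtain C where C: "f \<in> borel_measurable (lebesgue_on S)" "\<And>x. x \<in> S \<Longrightarrow> \<bar>f x\<bar> \<le> C"
    using f by (rule bdd_measE) blast
  have g: "bdd_meas S ?g"
    unfolding bdd_meas_def
  proof
    show "?g \<in> borel_measurable (lebesgue_on S)" using B(1) C(1) by measurable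
    have k: "bounded ((\<lambda>x. c) ` S)" for c :: real by (rule bounded_subset[of "{c}"]) auto
    show "bounded (?g ` S)"
      using e f by (intro bounded_image_combine k) (auto simp: bdd_meas_def)
  qed
  note ee = bdd_meas_integrable[OF S e e] and ef = bdd_meas_integrable[OF S e f]
    and ff = bdd_meas_integrable[OF S f f]
  have "ip S ?g ?g = (\<integral>x. ?c\<^sup>2 * (e x * e x) + 2 * ?c * ?d * (e x * f x) + ?d\<^sup>2 * (f x * f x) \<partial>lebesgue_on S)"
    unfolding ip_def[of S ?g] by (rule Bochner_Integration.integral_cong) (simp_all add: algebra_simps power2_eq_square)
  also have "\<dots> = ?c\<^sup>2 * ip S e e + 2 * ?c * ?d * ip S e f + ?d\<^sup>2 * ip S f f"
    using ee ef ff by (simp add: ip_def)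
  also have "\<dots> = ?c * gram_det S e f"
    by (simp add: gram_det_def algebra_simps power2_eq_square)
  finally have "ip S ?g ?g = 0" using D by simp
  from indep[OF ip_self_zero[OF g this]] have "ip S f f = 0" by simp
  then have "AE x in lebesgue_on S. 0 * e x + 1 * f x = 0" using ip_self_zero[OF f] by simp
  from indep[OF this] show False by simp
qed

lemma projections_converge:
  assumes e: "bdd_meas S e" and f: "bdd_meas S f" and D: "gram_det S e f \<noteq> 0"
    and ev: "\<forall>\<^sub>F \<epsilon> in F. bdd_meas S (E \<epsilon>) \<and> bdd_meas S (G \<epsilon>)"
    and E: "uniform_limit S E e F" and G: "uniform_limit S G f F"
  shows "((\<lambda>\<epsilon>. op_norm S (\<lambda>h x. orth_proj S (plane S (E \<epsilon>) (G \<epsilon>)) h x - orth_proj S (plane S e f) h x))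
    \<longlongrightarrow> 0) F"
proof -
  have bE: "blim S E e F" and bG: "blim S G f F"
    using e f E G by (auto simp: blim_def bdd_meas_def)
  have evE: "\<forall>\<^sub>F \<epsilon> in F. bdd_meas S (E \<epsilon>) \<and> bdd_meas S (E \<epsilon>)"
    and evG: "\<forall>\<^sub>F \<epsilon> in F. bdd_meas S (G \<epsilon>) \<and> bdd_meas S (G \<epsilon>)"
    using ev by (eventually_elim, simp)+
  note ips = ip_tendsto[OF bE bE e e evE] ip_tendsto[OF bE bG e f ev] ip_tendsto[OF bG bG f f evG]
  have gd: "((\<lambda>\<epsilon>. gram_det S (E \<epsilon>) (G \<epsilon>)) \<longlongrightarrow> gram_det S e f) F"
    unfolding gram_det_def by (intro tendsto_intros ips)
  have ginv: "((\<lambda>\<epsilon>. inverse (gram_det S (E \<epsilon>) (G \<epsilon>))) \<longlongrightarrow> inverse (gram_det S e f)) F"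
    by (rule tendsto_inverse[OF gd D])
  have 1: "fst ` (S \<times> S) \<subseteq> S" and 2: "snd ` (S \<times> S) \<subseteq> S" by auto
  have "blim (S \<times> S) (\<lambda>\<epsilon>. proj_kernel S (E \<epsilon>) (G \<epsilon>)) (proj_kernel S e f) F"
    unfolding proj_kernel_def[abs_def]
    by (intro blim_mult blim_add blim_diff blim_const ips ginv
        blim_precompose[OF bE 1] blim_precompose[OF bE 2] blim_precompose[OF bG 1] blim_precompose[OF bG 2])
  then have K: "uniform_limit (S \<times> S) (\<lambda>\<epsilon>. proj_kernel S (E \<epsilon>) (G \<epsilon>)) (proj_kernel S e f) F"
    by (simp add: blim_def)
  let ?C = "(measure lebesgue S + 1) * sqrt (measure lebesgue S)"
  have C: "0 \<le> ?C" using measure_nonneg[of lebesgue S] by (intro mult_nonneg_nonneg) auto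
  show ?thesis
  proof (rule tendstoI)
    fix \<eta> :: real assume "0 < \<eta>"
    define \<delta> where "\<delta> = \<eta> / (?C + 1)"
    have \<delta>: "0 < \<delta>" using \<open>0 < \<eta>\<close> C by (simp add: \<delta>_def add_nonneg_pos)
    have "\<forall>\<^sub>F \<epsilon> in F. \<forall>z\<in>S \<times> S. dist (proj_kernel S (E \<epsilon>) (G \<epsilon>) z) (proj_kernel S e f z) < \<delta>"
      by (rule uniform_limitD[OF K \<delta>])
    moreover have "\<forall>\<^sub>F \<epsilon> in F. gram_det S (E \<epsilon>) (G \<epsilon>) \<noteq> 0"
      by (rule tendsto_imp_eventually_ne[OF gd D])
    ultimately show "\<forall>\<^sub>F \<epsilon> in F. dist (op_norm S (\<lambda>h x. orth_proj S (plane S (E \<epsilon>) (G \<epsilon>)) h x -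
        orth_proj S (plane S e f) h x)) 0 < \<eta>"
      using ev
    proof eventually_elim
      case (elim \<epsilon>)
      have k: "\<bar>proj_kernel S (E \<epsilon>) (G \<epsilon>) z - proj_kernel S e f z\<bar> \<le> \<delta>" if "z \<in> S \<times> S" for z
        using elim(1) that by (auto simp: dist_real_def less_imp_le)
      have EG: "bdd_meas S (E \<epsilon>)" "bdd_meas S (G \<epsilon>)" using elim by auto
      note n = op_norm_projection_diff[OF S EG elim(2) e f D k less_imp_le[OF \<delta>]]
      have "\<delta> * ?C < \<delta> * (?C + 1)" using \<delta> by (simp add: algebra_simps)
      also have "\<delta> * (?C + 1) = \<eta>" unfolding \<delta>_def
        by (rule nonzero_eq_divide_eq[THEN iffD1, OF _ refl]) (use C in linarith)
      finally show ?case using n by (simp add: dist_real_def)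
    qed
  qed
qed

end

lemma joint_continuity_equicontinuous:
  fixes G :: "real \<Rightarrow> real \<Rightarrow> real"
  assumes X: "compact X" and G: "\<And>R. continuous_on (X \<times> {-R..R}) (\<lambda>(x, \<omega>). G x \<omega>)" and e: "0 < e"
  obtains d where "0 < d" "\<And>x \<omega>. x \<in> X \<Longrightarrow> \<bar>\<omega> - z\<bar> < d \<Longrightarrow> \<bar>G x \<omega> - G x z\<bar> < e"
proof -
  let ?R = "\<bar>z\<bar> + 1"
  have "uniformly_continuous_on (X \<times> {-?R..?R}) (\<lambda>(x, \<omega>). G x \<omega>)"
    by (rule compact_uniformly_continuous[OF G]) (intro compact_Times X compact_Icc)
  from this[unfolded uniformly_continuous_on_def, rule_format, OF e]
  obtain d where d: "0 < d" and
    D: "\<forall>v\<in>X \<times> {-?R..?R}. \<forall>w\<in>X \<times> {-?R..?R}. dist w v < d \<longrightarrow>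
       dist ((\<lambda>(x, \<omega>). G x \<omega>) w) ((\<lambda>(x, \<omega>). G x \<omega>) v) < e"
    by (elim exE conjE)
  show ?thesis
  proof (rule that[of "min d 1"])
    show "0 < min d 1" using d by simp
    fix x \<omega> assume x: "x \<in> X" "\<bar>\<omega> - z\<bar> < min d 1"
    then have "dist (x, \<omega>) (x, z) < d" by (simp add: dist_Pair_Pair dist_real_def)
    moreover have "\<omega> \<in> {-?R..?R}" "z \<in> {-?R..?R}" using x by auto
    ultimately show "\<bar>G x \<omega> - G x z\<bar> < e"
      using D[rule_format, of "(x, z)" "(x, \<omega>)"] x by (simp add: dist_real_def)
  qed
qed

lemma uniform_limit_parameter:
  fixes G :: "real \<Rightarrow> real \<Rightarrow> real"
  assumes X: "compact X" and G: "\<And>R. continuous_on (X \<times> {-R..R}) (\<lambda>(x, \<omega>). G x \<omega>)"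
    and q: "(q \<longlongrightarrow> z) F"
  shows "uniform_limit X (\<lambda>\<epsilon> x. G x (q \<epsilon>)) (\<lambda>x. G x z) F"
proof (rule uniform_limitI)
  fix e :: real assume "0 < e"
  then obtain d where d: "0 < d" "\<And>x \<omega>. x \<in> X \<Longrightarrow> \<bar>\<omega> - z\<bar> < d \<Longrightarrow> \<bar>G x \<omega> - G x z\<bar> < e"
    by (rule joint_continuity_equicontinuous[OF X G]) blast
  from tendstoD[OF q d(1)] show "\<forall>\<^sub>F \<epsilon> in F. \<forall>x\<in>X. dist (G x (q \<epsilon>)) (G x z) < e"
    by eventually_elim (use d(2) in \<open>auto simp: dist_real_def\<close>)
qed

text \<open>By the mean value theorem, a divided difference is the derivative at an intermediate parameter.\<close>

lemma uniform_limit_divided_difference: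
  fixes G G' :: "real \<Rightarrow> real \<Rightarrow> real"
  assumes X: "compact X" and G': "\<And>R. continuous_on (X \<times> {-R..R}) (\<lambda>(x, \<omega>). G' x \<omega>)"
    and D: "\<And>x \<omega>. x \<in> X \<Longrightarrow> (G x has_real_derivative G' x \<omega>) (at \<omega>)"
    and q: "(q \<longlongrightarrow> z) F" and p: "(p \<longlongrightarrow> z) F" and less: "\<forall>\<^sub>F \<epsilon> in F. q \<epsilon> < p \<epsilon>"
  shows "uniform_limit X (\<lambda>\<epsilon> x. (G x (p \<epsilon>) - G x (q \<epsilon>)) / (p \<epsilon> - q \<epsilon>)) (\<lambda>x. G' x z) F"
proof (rule uniform_limitI)
  fix e :: real assume "0 < e"
  then obtain d where d: "0 < d" "\<And>x \<omega>. x \<in> X \<Longrightarrow> \<bar>\<omega> - z\<bar> < d \<Longrightarrow> \<bar>G' x \<omega> - G' x z\<bar> < e"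
    by (rule joint_continuity_equicontinuous[OF X G']) blast
  from tendstoD[OF q d(1)] tendstoD[OF p d(1)] less
  show "\<forall>\<^sub>F \<epsilon> in F. \<forall>x\<in>X. dist ((G x (p \<epsilon>) - G x (q \<epsilon>)) / (p \<epsilon> - q \<epsilon>)) (G' x z) < e"
  proof eventually_elim
    case (elim \<epsilon>)
    show ?case
    proof
      fix x assume x: "x \<in> X"
      obtain t where t: "q \<epsilon> < t" "t < p \<epsilon>" "G x (p \<epsilon>) - G x (q \<epsilon>) = (p \<epsilon> - q \<epsilon>) * G' x t"
        using MVT2[OF elim(3), of "G x" "G' x"] D[OF x] by auto
      have "\<bar>t - z\<bar> < d" using elim t by (auto simp: dist_real_def)
      from d(2)[OF x this] t elim(3)
      show "dist ((G x (p \<epsilon>) - G x (q \<epsilon>)) / (p \<epsilon> - q \<epsilon>)) (G' x z) < e"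
        by (simp add: dist_real_def)
    qed
  qed
qed

section \<open>Convergence of eigenvalues and eigenfunctions\<close>

lemma continuous_on_if_differentiable:
  fixes f g :: "real \<Rightarrow> real"
  assumes "\<And>x. (f has_real_derivative g x) (at x)"
  shows "continuous_on UNIV f"
  by (rule DERIV_continuous_on) (rule has_field_derivative_at_within[OF assms])

context transmission
begin

lemma zero_mem: "0 \<in> {a..0}" "0 \<in> {0..b}" using ab by auto

text \<open>The multiplicity of \<open>z\<close> as a zero of \<open>char_B\<close> equals the algebraic multiplicity. At a double zero, the
  second derivative of \<open>char_B\<close> is \<open>2 left.wd right.yd\<close>, and the two Wronskian identities give the sign that
  makes the zero split into real ones.\<close>

lemma root_count_near:
  assumes z: "char_B z = 0"
  shows "roots_near char_A char_B (root_mult z) z"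
proof -
  note D = left.y_omega[OF zero_mem(1)] left.w_omega[OF zero_mem(1)]
    right.y_omega[OF zero_mem(2)] right.w_omega[OF zero_mem(2)]
  obtain ly2 where ly2: "\<And>\<omega>. ((\<lambda>\<omega>. left.yd \<omega> 0) has_real_derivative ly2 \<omega>) (at \<omega>)" "continuous_on UNIV ly2"
    using left.yd_C1[OF zero_mem(1)] by blast
  obtain lw2 where lw2: "\<And>\<omega>. ((\<lambda>\<omega>. left.wd \<omega> 0) has_real_derivative lw2 \<omega>) (at \<omega>)" "continuous_on UNIV lw2"
    using left.wd_C1[OF zero_mem(1)] by blast
  obtain ry2 where ry2: "\<And>\<omega>. ((\<lambda>\<omega>. right.yd \<omega> 0) has_real_derivative ry2 \<omega>) (at \<omega>)" "continuous_on UNIV ry2"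
    using right.yd_C1[OF zero_mem(2)] by blast
  obtain rw2 where rw2: "\<And>\<omega>. ((\<lambda>\<omega>. right.wd \<omega> 0) has_real_derivative rw2 \<omega>) (at \<omega>)" "continuous_on UNIV rw2"
    using right.wd_C1[OF zero_mem(2)] by blast
  note cont = continuous_on_if_differentiable
  note C = cont[OF D(1)] cont[OF D(2)] cont[OF D(3)] cont[OF D(4)]
    cont[OF ly2(1)] cont[OF lw2(1)] cont[OF ry2(1)] cont[OF rw2(1)] ly2(2) lw2(2) ry2(2) rw2(2)
  let ?A' = "\<lambda>\<omega>. left.yd \<omega> 0 * right.w \<omega> 0 + left.y \<omega> 0 * right.wd \<omega> 0"
  let ?A'' = "\<lambda>\<omega>. ly2 \<omega> * right.w \<omega> 0 + 2 * (left.yd \<omega> 0 * right.wd \<omega> 0) + left.y \<omega> 0 * rw2 \<omega>"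
  let ?B' = "\<lambda>\<omega>. left.wd \<omega> 0 * right.y \<omega> 0 + left.w \<omega> 0 * right.yd \<omega> 0"
  let ?B'' = "\<lambda>\<omega>. lw2 \<omega> * right.y \<omega> 0 + 2 * (left.wd \<omega> 0 * right.yd \<omega> 0) + left.w \<omega> 0 * ry2 \<omega>"
  have A: "(char_A has_real_derivative ?A' \<omega>) (at \<omega>)" "(?A' has_real_derivative ?A'' \<omega>) (at \<omega>)" for \<omega>
    unfolding char_A_def[abs_def]
    by (rule derivative_eq_intros D ly2(1) rw2(1) refl | simp)+
  have B: "(char_B has_real_derivative ?B' \<omega>) (at \<omega>)" "(?B' has_real_derivative ?B'' \<omega>) (at \<omega>)" for \<omega>
    unfolding char_B_def[abs_def]
    by (rule derivative_eq_intros D lw2(1) ry2(1) refl | simp)+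
  have A''c: "continuous_on UNIV ?A''" and B''c: "continuous_on UNIV ?B''"
    by (intro continuous_intros C)+
  show ?thesis
  proof (cases "left.w z 0 = 0 \<and> right.y z 0 = 0")
    case True
    then have w: "left.wd z 0 * left.y z 0 < 0" "right.yd z 0 * right.w z 0 < 0"
      using left_wronskian right_wronskian by auto
    have "0 < 2 * ((left.wd z 0 * left.y z 0) * (right.yd z 0 * right.w z 0))"
      using mult_neg_neg[OF w] by simp
    also have "\<dots> = char_A z * ?B'' z" using True by (simp add: char_A_def mult_ac)
    finally have "0 < char_A z * ?B'' z" .
    moreover have "?B' z = 0" using True by simp
    ultimately have "roots_near char_A char_B 2 z"
      using double_root_splits[OF A A''c B B''c z] by blast
    then show ?thesis using True by (simp add: root_mult_def numeral_2_eq_2)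
  next
    case False
    then have m: "root_mult z = 1" and one: "left.w z 0 = 0 \<or> right.y z 0 = 0"
      using z by (auto simp: root_mult_def char_B_def)
    have "?B' z \<noteq> 0"
    proof (cases "left.w z 0 = 0")
      case True
      then show ?thesis using False left_wronskian[OF True] by auto
    next
      case False
      then have r: "right.y z 0 = 0" using one by simp
      show ?thesis using False r right_wronskian[OF r] by auto
    qed
    from simple_root_persists[OF A(1) cont[OF A(2)] B(1) cont[OF B(2)] z this] m
    show ?thesis by simp
  qed
qed

lemma char_continuous: "continuous_on UNIV char_A" "continuous_on UNIV char_B"
  unfolding char_A_def[abs_def] char_B_def[abs_def]
  by (intro continuous_on_mult continuous_on_if_differentiable[OF left.y_omega[OF zero_mem(1)]]
      continuous_on_if_differentiable[OF left.w_omega[OF zero_mem(1)]]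
      continuous_on_if_differentiable[OF right.y_omega[OF zero_mem(2)]]
      continuous_on_if_differentiable[OF right.w_omega[OF zero_mem(2)]])+

lemma family_continuous:
  "continuous_on {a..b} (eigen_family \<omega>)" "continuous_on {a..b} (eigen_family_deriv \<omega>)"
proof -
  have I: "{a..b} = {a..0} \<union> {0..b}" using ab by auto
  show "continuous_on {a..b} (eigen_family \<omega>)"
    unfolding I eigen_family_def[abs_def]
    by (rule continuous_on_If) (auto intro!: continuous_intros left.y_cont right.y_cont)
  show "continuous_on {a..b} (eigen_family_deriv \<omega>)"
    unfolding I eigen_family_deriv_def[abs_def]
    by (rule continuous_on_If)
       (auto intro!: continuous_intros left.y_cont right.y_cont left.yd_cont right.yd_cont)
qed

lemma continuous_bdd_meas:
  assumes "continuous_on {a..b} f"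
  shows "bdd_meas {a<..<b} f"
  unfolding bdd_meas_def
proof
  show "f \<in> borel_measurable (lebesgue_on {a<..<b})"
    by (rule continuous_imp_measurable_on_sets_lebesgue) (auto intro: continuous_on_subset[OF assms])
  have "bounded (f ` {a..b})"
    using assms by (intro compact_imp_bounded compact_continuous_image) auto
  then show "bounded (f ` {a<..<b})" by (rule bounded_subset) auto
qed

lemma family_joint:
  "continuous_on ({a..0} \<times> {-R..R}) (\<lambda>(x, \<omega>). right.y \<omega> 0 * left.y \<omega> x)"
  "continuous_on ({0..b} \<times> {-R..R}) (\<lambda>(x, \<omega>). left.y \<omega> 0 * right.y \<omega> x)"
  "continuous_on ({a..0} \<times> {-R..R}) (\<lambda>(x, \<omega>). right.yd \<omega> 0 * left.y \<omega> x + right.y \<omega> 0 * left.yd \<omega> x)"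
  "continuous_on ({0..b} \<times> {-R..R}) (\<lambda>(x, \<omega>). left.yd \<omega> 0 * right.y \<omega> x + left.y \<omega> 0 * right.yd \<omega> x)"
proof -
  have at0: "continuous_on (X \<times> {-R..R}) (\<lambda>z. f (snd z) 0)"
    if "continuous_on (I \<times> {-R..R}) (\<lambda>(x, \<omega>). f \<omega> x)" "0 \<in> I"
    for f :: "real \<Rightarrow> real \<Rightarrow> real" and I X :: "real set"
  proof -
    have "continuous_on (X \<times> {-R..R}) (\<lambda>z. (\<lambda>(x, \<omega>). f \<omega> x) (0, snd z))"
      by (rule continuous_on_compose2[OF that(1)]) (use that(2) in \<open>auto intro!: continuous_intros\<close>)
    then show ?thesis by simp
  qed
  note J = left.y_joint[of R] left.yd_joint[of R] right.y_joint[of R] right.yd_joint[of R]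
  note J0 = at0[OF J(1) zero_mem(1)] at0[OF J(2) zero_mem(1)] at0[OF J(3) zero_mem(2)] at0[OF J(4) zero_mem(2)]
  show "continuous_on ({a..0} \<times> {-R..R}) (\<lambda>(x, \<omega>). right.y \<omega> 0 * left.y \<omega> x)"
    "continuous_on ({0..b} \<times> {-R..R}) (\<lambda>(x, \<omega>). left.y \<omega> 0 * right.y \<omega> x)"
    "continuous_on ({a..0} \<times> {-R..R}) (\<lambda>(x, \<omega>). right.yd \<omega> 0 * left.y \<omega> x + right.y \<omega> 0 * left.yd \<omega> x)"
    "continuous_on ({0..b} \<times> {-R..R}) (\<lambda>(x, \<omega>). left.yd \<omega> 0 * right.y \<omega> x + left.y \<omega> 0 * right.yd \<omega> x)"
    unfolding case_prod_beta
    by (intro continuous_on_mult continuous_on_add J0 J[unfolded case_prod_beta])+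
qed

lemma family_uniform_limit:
  assumes q: "(q \<longlongrightarrow> z) F" and p: "(p \<longlongrightarrow> z) F" and less: "\<forall>\<^sub>F \<epsilon> in F. q \<epsilon> < p \<epsilon>"
  shows "uniform_limit {a<..<b} (\<lambda>\<epsilon>. eigen_family (q \<epsilon>)) (eigen_family z) F"
    "uniform_limit {a<..<b} (\<lambda>\<epsilon> x. (eigen_family (p \<epsilon>) x - eigen_family (q \<epsilon>) x) / (p \<epsilon> - q \<epsilon>))
       (eigen_family_deriv z) F"
proof -
  have glue: "uniform_limit {a<..<b} f l F"
    if "uniform_limit {a..0} f1 l1 F" "uniform_limit {0..b} f2 l2 F"
      "\<And>\<epsilon> x. x < 0 \<Longrightarrow> f \<epsilon> x = f1 \<epsilon> x" "\<And>\<epsilon> x. 0 \<le> x \<Longrightarrow> f \<epsilon> x = f2 \<epsilon> x"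
      "\<And>x. x < 0 \<Longrightarrow> l x = l1 x" "\<And>x. 0 \<le> x \<Longrightarrow> l x = l2 x" for f f1 f2 :: "'a \<Rightarrow> real \<Rightarrow> real" and l l1 l2
  proof (rule uniform_limitI)
    fix e :: real assume e: "0 < e"
    from uniform_limitD[OF that(1) e] uniform_limitD[OF that(2) e]
    show "\<forall>\<^sub>F \<epsilon> in F. \<forall>x\<in>{a<..<b}. dist (f \<epsilon> x) (l x) < e"
    proof eventually_elim
      case (elim \<epsilon>)
      show ?case
      proof
        fix x assume "x \<in> {a<..<b}"
        then show "dist (f \<epsilon> x) (l x) < e" using elim that(3-6) by (cases "x < 0") auto
      qed
    qed
  qed
  show "uniform_limit {a<..<b} (\<lambda>\<epsilon>. eigen_family (q \<epsilon>)) (eigen_family z) F"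
    by (rule glue[OF uniform_limit_parameter[OF compact_Icc family_joint(1) q]
          uniform_limit_parameter[OF compact_Icc family_joint(2) q]])
       (simp_all add: eigen_family_def)
  have d1: "((\<lambda>\<omega>. right.y \<omega> 0 * left.y \<omega> x) has_real_derivative
      right.yd \<omega> 0 * left.y \<omega> x + right.y \<omega> 0 * left.yd \<omega> x) (at \<omega>)" if "x \<in> {a..0}" for x \<omega>
    by (rule derivative_eq_intros left.y_omega[OF that] right.y_omega[OF zero_mem(2)] refl | simp)+
  have d2: "((\<lambda>\<omega>. left.y \<omega> 0 * right.y \<omega> x) has_real_derivative
      left.yd \<omega> 0 * right.y \<omega> x + left.y \<omega> 0 * right.yd \<omega> x) (at \<omega>)" if "x \<in> {0..b}" for x \<omega>
    by (rule derivative_eq_intros right.y_omega[OF that] left.y_omega[OF zero_mem(1)] refl | simp)+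
  show "uniform_limit {a<..<b} (\<lambda>\<epsilon> x. (eigen_family (p \<epsilon>) x - eigen_family (q \<epsilon>) x) / (p \<epsilon> - q \<epsilon>))
       (eigen_family_deriv z) F"
    by (rule glue[OF uniform_limit_divided_difference[OF compact_Icc family_joint(3) d1 q p less]
          uniform_limit_divided_difference[OF compact_Icc family_joint(4) d2 q p less]])
       (simp_all add: eigen_family_def eigen_family_deriv_def)
qed

lemma root_subspace_plane:
  assumes "left.w z 0 = 0" "right.y z 0 = 0"
  shows "root_subspace {a<..<b} op (of_real z) = plane {a<..<b} (eigen_family z) (eigen_family_deriv z)"
proof -
  note m = continuous_bdd_meas[OF family_continuous(1)[of z]] continuous_bdd_meas[OF family_continuous(2)[of z]]
  have "h \<in> L2 unweighted {a<..<b}"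
    if ae: "ae_eq {a<..<b} h (\<lambda>x. eigen_family z x *\<^sub>R c + eigen_family_deriv z x *\<^sub>R d)" (is "ae_eq _ _ ?g")
    for h and c d :: complex
  proof -
    have g: "?g \<in> L2 unweighted {a<..<b}" by (rule combination_in_L2[OF _ m]) simp
    have h: "h \<in> borel_measurable (lebesgue_on {a<..<b})"
      by (rule ae_eq_measurable[OF _ ae]) (use g in \<open>auto simp: L2_def\<close>)
    have "integrable (lebesgue_on {a<..<b}) (\<lambda>x. 1 * (cmod (h x))\<^sup>2) =
        integrable (lebesgue_on {a<..<b}) (\<lambda>x. 1 * (cmod (?g x))\<^sup>2)"
    proof (rule integrable_cong_AE)
      have sq: "(\<lambda>x. 1 * (cmod (f x))\<^sup>2) \<in> borel_measurable (lebesgue_on {a<..<b})"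
        if "f \<in> borel_measurable (lebesgue_on {a<..<b})" for f
        using that by measurable
      show "(\<lambda>x. 1 * (cmod (h x))\<^sup>2) \<in> borel_measurable (lebesgue_on {a<..<b})" by (rule sq[OF h])
      show "(\<lambda>x. 1 * (cmod (?g x))\<^sup>2) \<in> borel_measurable (lebesgue_on {a<..<b})"
        by (rule sq) (use g in \<open>simp add: L2_def\<close>)
      show "AE x in lebesgue_on {a<..<b}. 1 * (cmod (h x))\<^sup>2 = 1 * (cmod (?g x))\<^sup>2"
        using ae unfolding ae_eq_def by eventually_elim simp
    qed
    then show ?thesis using g h by (simp add: L2_def)
  qed
  then show ?thesis
    unfolding root_subspace_double[OF assms] plane_def set_eq_iff ae_span_2 by blast
qed

text \<open>Replacing the second basis vector by a divided difference does not change the plane, but keeps the basis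
  from degenerating as the two eigenvalues coalesce.\<close>

lemma L2_span_plane:
  fixes u :: "nat \<Rightarrow> real \<Rightarrow> real"
  assumes q: "\<gamma> \<noteq> 0" "\<And>x. x \<in> {a..b} \<Longrightarrow> complex_of_real (u j x) = \<gamma> * of_real (eigen_family q x)"
    and p: "\<gamma>' \<noteq> 0" "\<And>x. x \<in> {a..b} \<Longrightarrow> complex_of_real (u (j + 1) x) = \<gamma>' * of_real (eigen_family p x)"
    and qp: "q < p"
  shows "L2_span {a<..<b} (\<lambda>i x. of_real (u i x)) {j, j + 1} =
     plane {a<..<b} (eigen_family q) (\<lambda>x. (eigen_family p x - eigen_family q x) / (p - q))"
proof -
  let ?d = "\<lambda>x. (eigen_family p x - eigen_family q x) / (p - q)"
  have eq: "(\<Sum>i\<in>{j, j + 1}. c i * of_real (u i x)) =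
      eigen_family q x *\<^sub>R (c j * \<gamma> + c (j + 1) * \<gamma>') + ?d x *\<^sub>R (of_real (p - q) * (c (j + 1) * \<gamma>'))"
    if "x \<in> {a<..<b}" for x and c :: "nat \<Rightarrow> complex"
  proof -
    have x: "x \<in> {a..b}" using that by simp
    have d: "of_real (?d x) * of_real (p - q) = (of_real (eigen_family p x - eigen_family q x) :: complex)"
      unfolding of_real_mult[symmetric] using qp by simp
    have "?d x *\<^sub>R (of_real (p - q) * (c (j + 1) * \<gamma>')) =
       of_real (eigen_family p x - eigen_family q x) * (c (j + 1) * \<gamma>')"
      unfolding d[symmetric] by (simp only: scaleR_conv_of_real mult.assoc)
    then show ?thesis by (simp add: q(2)[OF x] p(2)[OF x, simplified] scaleR_conv_of_real algebra_simps)
  qed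
  have "(\<exists>c :: nat \<Rightarrow> complex. ae_eq {a<..<b} h (\<lambda>x. \<Sum>i\<in>{j, j + 1}. c i * of_real (u i x))) \<longleftrightarrow>
     (\<exists>c d. ae_eq {a<..<b} h (\<lambda>x. eigen_family q x *\<^sub>R c + ?d x *\<^sub>R d))" for h
  proof
    assume "\<exists>c :: nat \<Rightarrow> complex. ae_eq {a<..<b} h (\<lambda>x. \<Sum>i\<in>{j, j + 1}. c i * of_real (u i x))"
    then obtain c :: "nat \<Rightarrow> complex" where
      c: "ae_eq {a<..<b} h (\<lambda>x. \<Sum>i\<in>{j, j + 1}. c i * of_real (u i x))" by blast
    have "ae_eq {a<..<b} h (\<lambda>x. eigen_family q x *\<^sub>R (c j * \<gamma> + c (j + 1) * \<gamma>') +
        ?d x *\<^sub>R (of_real (p - q) * (c (j + 1) * \<gamma>')))"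
      by (rule ae_eq_trans[OF c ae_eqI[OF eq]])
    then show "\<exists>c d. ae_eq {a<..<b} h (\<lambda>x. eigen_family q x *\<^sub>R c + ?d x *\<^sub>R d)" by blast
  next
    assume "\<exists>c d. ae_eq {a<..<b} h (\<lambda>x. eigen_family q x *\<^sub>R c + ?d x *\<^sub>R d)"
    then obtain c d where cd: "ae_eq {a<..<b} h (\<lambda>x. eigen_family q x *\<^sub>R c + ?d x *\<^sub>R d)" by blast
    define c1 where "c1 = d / of_real (p - q) / \<gamma>'"
    define c0 where "c0 = (c - c1 * \<gamma>') / \<gamma>"
    let ?c = "\<lambda>i. if i = j then c0 else c1"
    have "of_real (p - q) \<noteq> (0 :: complex)" using qp by simp
    then have "?c j * \<gamma> + ?c (j + 1) * \<gamma>' = c" "of_real (p - q) * (?c (j + 1) * \<gamma>') = d"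
      using q(1) p(1) by (simp_all add: c0_def c1_def)
    note e = eq[of _ ?c, unfolded this]
    have "ae_eq {a<..<b} h (\<lambda>x. \<Sum>i\<in>{j, j + 1}. ?c i * of_real (u i x))"
      by (rule ae_eq_trans[OF cd ae_eqI]) (rule e[symmetric])
    then show "\<exists>c :: nat \<Rightarrow> complex. ae_eq {a<..<b} h (\<lambda>x. \<Sum>i\<in>{j, j + 1}. c i * of_real (u i x))"
      by (rule exI[of _ ?c])
  qed
  then show ?thesis unfolding L2_span_def plane_def by simp
qed

lemma family_gram_nonzero:
  assumes "left.w z 0 = 0" "right.y z 0 = 0"
  shows "gram_det {a<..<b} (eigen_family z) (eigen_family_deriv z) \<noteq> 0"
proof (rule gram_det_nonzero)
  fix c d :: real
  assume "AE x in lebesgue_on {a<..<b}. c * eigen_family z x + d * eigen_family_deriv z x = 0"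
  then have "ae_eq {a<..<b} (\<lambda>x. eigen_family z x *\<^sub>R of_real c + eigen_family_deriv z x *\<^sub>R of_real d)
      (\<lambda>_. 0 :: complex)"
    unfolding ae_eq_def
  proof eventually_elim
    case (elim x)
    have "eigen_family z x *\<^sub>R complex_of_real c + eigen_family_deriv z x *\<^sub>R of_real d =
      of_real (c * eigen_family z x + d * eigen_family_deriv z x)"
      by (simp add: scaleR_conv_of_real mult.commute)
    then show ?case using elim by simp
  qed
  from double_basis_independent[OF assms this] show "c = 0 \<and> d = 0" by simp
qed (auto intro: continuous_bdd_meas family_continuous)

end

section \<open>Identification of the limit plane\<close>

lemma smooth_on_C1:
  assumes "smooth_on S f"
  shows "\<exists>f'. continuous_on S f' \<and> (\<forall>x\<in>S. (f has_real_derivative f' x) (at x within S))"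
proof -
  obtain G :: "nat \<Rightarrow> real \<Rightarrow> real" where G0: "G 0 = f"
    and G: "\<And>n x. x \<in> S \<Longrightarrow> (G n has_real_derivative G (Suc n) x) (at x within S)"
    using assms unfolding smooth_on_def by blast
  have "continuous_on S (G 1)"
    by (rule DERIV_continuous_on[where D = "G 2"]) (use G[of _ 1] in \<open>simp add: numeral_2_eq_2\<close>)
  moreover have "(f has_real_derivative G 1 x) (at x within S)" if "x \<in> S" for x
    using G[OF that, of 0] G0 by simp
  ultimately show ?thesis by blast
qed

lemma sl_of_smooth:
  assumes "c < d" "s \<in> {c..d}" "smooth_on {c..d} p" "\<forall>x\<in>{c..d}. p x > 0"
    "smooth_on {c..d} q" "\<forall>x\<in>{c..d}. q x > 0"
  shows "sl c d s p q"
proof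
  show "continuous_on {c..d} q"
    using smooth_on_C1[OF assms(5)] by (metis DERIV_continuous_on)
qed (use assms smooth_on_C1[OF assms(3)] in auto)

context transmission
begin

lemma eigenvalue_multiplicity:
  assumes "enumerates_eigenvalues {a<..<b} op \<mu>"
  shows "finite {i \<in> {1..}. \<mu> i = z}" "card {i \<in> {1..}. \<mu> i = z} = root_mult z"
proof -
  have *: "{i \<in> {1..}. complex_of_real (\<mu> i) = of_real z} = {i \<in> {1..}. \<mu> i = z}" by simp
  show "finite {i \<in> {1..}. \<mu> i = z}"
    using assms unfolding enumerates_eigenvalues_def *[symmetric] by blast
  have "has_dimension {a<..<b} (root_subspace {a<..<b} op (of_real z)) (card {i \<in> {1..}. \<mu> i = z})"
    using assms unfolding enumerates_eigenvalues_def *[symmetric] by blast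
  then show "card {i \<in> {1..}. \<mu> i = z} = root_mult z"
    by (rule has_dimension_unique[OF _ root_subspace_dimension])
qed

lemma root_mult_pos_iff: "0 < root_mult z \<longleftrightarrow> char_B z = 0"
  using root_mult_eq_0_iff[of z] by auto

text \<open>Only a common zero of the two factors of \<open>char_B\<close> has multiplicity two, so the repetition \<open>\<mu> j = \<mu> (j + 1)\<close>
  makes \<open>\<mu> j\<close> a common eigenvalue of both uncoupled problems. The values listed before position \<open>j\<close> account
  for all smaller zeros.\<close>

lemma double_eigenvalue_position:
  assumes en: "enumerates_eigenvalues {a<..<b} op \<mu>" and j: "1 \<le> j" and eq: "\<mu> j = \<mu> (j + 1)"
  shows "left.w (\<mu> j) 0 = 0" "right.y (\<mu> j) 0 = 0"
    "finite {z. char_B z = 0 \<and> z < \<mu> j}" "(\<Sum>z | char_B z = 0 \<and> z < \<mu> j. root_mult z) = j - 1"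
proof -
  note mult = eigenvalue_multiplicity[OF en]
  have mono: "mono_on {1..} \<mu>" using en by (simp add: enumerates_eigenvalues_def)
  let ?J = "{i \<in> {1..}. \<mu> i = \<mu> j}"
  have sub: "{j, j + 1} \<subseteq> ?J" using j eq by auto
  have "2 \<le> card ?J" using card_mono[OF mult(1) sub] by simp
  then have "2 \<le> root_mult (\<mu> j)" using mult(2) by simp
  then show w: "left.w (\<mu> j) 0 = 0" and y: "right.y (\<mu> j) 0 = 0"
    by (auto simp: root_mult_def of_bool_def split: if_splits)
  have "card ?J = 2" using mult(2)[of "\<mu> j"] w y by (simp add: root_mult_def)
  then have J: "?J = {j, j + 1}"
    using card_subset_eq[OF mult(1) sub] by simp
  have below: "\<mu> i < \<mu> j \<longleftrightarrow> i < j" if "1 \<le> i" for i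
  proof
    assume "i < j"
    then have "\<mu> i \<le> \<mu> j" using mono_onD[OF mono, of i j] that by auto
    moreover have "i \<notin> ?J" unfolding J using \<open>i < j\<close> by auto
    ultimately show "\<mu> i < \<mu> j" using that by auto
  next
    assume "\<mu> i < \<mu> j"
    then show "i < j" using mono_onD[OF mono, of j i] that j by (auto simp: not_less[symmetric])
  qed
  let ?F = "{z. char_B z = 0 \<and> z < \<mu> j}"
  have F: "?F = \<mu> ` {1..<j}"
  proof (intro equalityI subsetI)
    fix z assume z: "z \<in> ?F"
    then have "0 < card {i \<in> {1..}. \<mu> i = z}" using mult(2) root_mult_pos_iff by simp
    then obtain i where "1 \<le> i" "\<mu> i = z" by (auto simp: card_gt_0_iff)
    then show "z \<in> \<mu> ` {1..<j}" using z below[of i] by auto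
  next
    fix z assume "z \<in> \<mu> ` {1..<j}"
    then obtain i where i: "1 \<le> i" "i < j" "z = \<mu> i" by auto
    then have "i \<in> {i \<in> {1..}. \<mu> i = z}" by simp
    then have "0 < root_mult z" using mult[of z] card_gt_0_iff by (metis empty_iff)
    then show "z \<in> ?F" using i below[of i] root_mult_pos_iff by simp
  qed
  then show fin: "finite ?F" by simp
  have "(\<Sum>z\<in>?F. root_mult z) = (\<Sum>z\<in>?F. card {i \<in> {1..}. \<mu> i = z})" by (simp only: mult(2))
  also have "\<dots> = card (\<Union>z\<in>?F. {i \<in> {1..}. \<mu> i = z})"
    by (rule card_UN_disjoint[symmetric]) (use fin mult(1) in auto)
  also have "(\<Union>z\<in>?F. {i \<in> {1..}. \<mu> i = z}) = {1..<j}"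
  proof (intro equalityI subsetI)
    fix i assume "i \<in> (\<Union>z\<in>?F. {i \<in> {1..}. \<mu> i = z})"
    then have "1 \<le> i" "\<mu> i < \<mu> j" by auto
    then show "i \<in> {1..<j}" using below[of i] by simp
  next
    fix i assume i: "i \<in> {1..<j}"
    then have "\<mu> i \<in> ?F" unfolding F by (rule imageI)
    then show "i \<in> (\<Union>z\<in>?F. {i \<in> {1..}. \<mu> i = z})" using i by (intro UN_I[of "\<mu> i"]) auto
  qed
  finally show "(\<Sum>z\<in>?F. root_mult z) = j - 1" by simp
qed

lemma scaled_spectrum:
  assumes eps: "0 < \<epsilon>"
    and im: "(\<lambda>i. complex_of_real (l i)) ` {1..} = P_spectrum a b k r \<kappa> \<rho> \<epsilon>"
  shows "(\<lambda>i. l i / \<epsilon>) ` {1..} = {\<omega>. \<epsilon> * char_A \<omega> = char_B \<omega>}"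
proof (intro equalityI subsetI)
  fix \<omega> assume "\<omega> \<in> (\<lambda>i. l i / \<epsilon>) ` {1..}"
  then obtain i where i: "i \<in> {1..}" "\<omega> = l i / \<epsilon>" by blast
  then have "complex_of_real (\<epsilon> * \<omega>) \<in> P_spectrum a b k r \<kappa> \<rho> \<epsilon>"
    unfolding im[symmetric] using eps by auto
  then show "\<omega> \<in> {\<omega>. \<epsilon> * char_A \<omega> = char_B \<omega>}" using P_spectrum_iff[OF eps] by simp
next
  fix \<omega> assume "\<omega> \<in> {\<omega>. \<epsilon> * char_A \<omega> = char_B \<omega>}"
  then have "complex_of_real (\<epsilon> * \<omega>) \<in> P_spectrum a b k r \<kappa> \<rho> \<epsilon>" using P_spectrum_iff[OF eps] by simp
  then obtain i where "i \<in> {1..}" "complex_of_real (\<epsilon> * \<omega>) = of_real (l i)"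
    unfolding im[symmetric] by blast
  then have "i \<in> {1..}" "\<epsilon> * \<omega> = l i" using of_real_eq_iff by blast+
  then show "\<omega> \<in> (\<lambda>i. l i / \<epsilon>) ` {1..}" using eps by (intro image_eqI[of _ _ i]) (auto simp: field_simps)
qed

lemma limit_plane:
  assumes spec: "\<forall>\<epsilon>>0. strict_mono_on {1..} (lam \<epsilon>) \<and>
           (\<lambda>i. complex_of_real (lam \<epsilon> i)) ` {1..} = P_spectrum a b k r \<kappa> \<rho> \<epsilon>"
    and norm: "\<forall>\<epsilon>>0. \<forall>i\<ge>1. P_normalized a b k r \<kappa> \<rho> \<epsilon> (lam \<epsilon> i) (u \<epsilon> i)"
    and en: "enumerates_eigenvalues {a<..<b} op \<mu>"
    and j: "j \<ge> 1" and eq: "\<mu> j = \<mu> (j + 1)"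
  shows "((\<lambda>\<epsilon>. op_norm {a<..<b}
            (\<lambda>f x. orth_proj {a<..<b} (L2_span {a<..<b} (\<lambda>i x. complex_of_real (u \<epsilon> i x)) {j, j + 1}) f x -
              orth_proj {a<..<b} (root_subspace {a<..<b} op (of_real (\<mu> j))) f x)) \<longlongrightarrow> 0)
           (at_right 0)"
proof -
  note z = double_eigenvalue_position[OF en j eq]
  define \<Omega> where "\<Omega> \<epsilon> i = lam \<epsilon> i / \<epsilon>" for \<epsilon> i
  have mono: "strict_mono_on {1..} (\<Omega> \<epsilon>)" if "0 < \<epsilon>" for \<epsilon>
    using spec that unfolding strict_mono_on_def \<Omega>_def by (simp add: divide_strict_right_mono)
  have image: "\<Omega> \<epsilon> ` {1..} = {\<omega>. \<epsilon> * char_A \<omega> = char_B \<omega>}" if "0 < \<epsilon>" for \<epsilon>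
    using scaled_spectrum[OF that] spec that unfolding \<Omega>_def by blast
  have M: "char_B (\<mu> j) = 0" using z by (simp add: char_B_def)
  have m: "root_mult (\<mu> j) = 2" using z by (simp add: root_mult_def)
  have lim: "((\<lambda>\<epsilon>. \<Omega> \<epsilon> i) \<longlongrightarrow> \<mu> j) (at_right 0)" if "j - 1 < i" "i \<le> j - 1 + 2" for i
  proof (rule ordered_roots_converge[OF char_continuous no_nonpositive_roots z(3) M root_count_near _ mono image z(4) that(1)])
    show "0 < root_mult z" if "char_B z = 0" for z using that root_mult_pos_iff by simp
    show "i \<le> j - 1 + root_mult (\<mu> j)" using that m by simp
  qed
  have q: "((\<lambda>\<epsilon>. \<Omega> \<epsilon> j) \<longlongrightarrow> \<mu> j) (at_right 0)" and p: "((\<lambda>\<epsilon>. \<Omega> \<epsilon> (j + 1)) \<longlongrightarrow> \<mu> j) (at_right 0)"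
    by (rule lim; use j in simp)+
  have pos: "\<forall>\<^sub>F \<epsilon> in at_right 0. (0::real) < \<epsilon>" by (rule eventually_at_right_less)
  have less: "\<forall>\<^sub>F \<epsilon> in at_right 0. \<Omega> \<epsilon> j < \<Omega> \<epsilon> (j + 1)"
    using pos by eventually_elim (use strict_mono_onD[OF mono, of _ j "j + 1"] j in auto)
  let ?S = "{a<..<b}"
  let ?E = "\<lambda>\<epsilon>. eigen_family (\<Omega> \<epsilon> j)"
  let ?D = "\<lambda>\<epsilon> x. (eigen_family (\<Omega> \<epsilon> (j + 1)) x - eigen_family (\<Omega> \<epsilon> j) x) / (\<Omega> \<epsilon> (j + 1) - \<Omega> \<epsilon> j)"
  have "((\<lambda>\<epsilon>. op_norm ?S (\<lambda>f x. orth_proj ?S (plane ?S (?E \<epsilon>) (?D \<epsilon>)) f x -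
      orth_proj ?S (plane ?S (eigen_family (\<mu> j)) (eigen_family_deriv (\<mu> j))) f x)) \<longlongrightarrow> 0) (at_right 0)"
  proof (rule projections_converge)
    show "gram_det ?S (eigen_family (\<mu> j)) (eigen_family_deriv (\<mu> j)) \<noteq> 0"
      by (rule family_gram_nonzero[OF z(1,2)])
    show "uniform_limit ?S ?E (eigen_family (\<mu> j)) (at_right 0)"
      "uniform_limit ?S ?D (eigen_family_deriv (\<mu> j)) (at_right 0)"
      by (rule family_uniform_limit[OF q p less])+
    show "\<forall>\<^sub>F \<epsilon> in at_right 0. bdd_meas ?S (?E \<epsilon>) \<and> bdd_meas ?S (?D \<epsilon>)"
      using less
    proof eventually_elim
      case (elim \<epsilon>)
      then show ?case
        by (intro conjI continuous_bdd_meas continuous_on_divide continuous_on_diff family_continuous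
            continuous_on_const ballI) auto
    qed
  qed (auto intro: continuous_bdd_meas family_continuous)
  moreover have "\<forall>\<^sub>F \<epsilon> in at_right 0. L2_span ?S (\<lambda>i x. of_real (u \<epsilon> i x)) {j, j + 1} = plane ?S (?E \<epsilon>) (?D \<epsilon>)"
  proof -
    have "left.y (\<mu> j) 0 \<noteq> 0" using left_wronskian[OF z(1)] by auto
    moreover have "isCont (\<lambda>\<omega>. left.y \<omega> 0) (\<mu> j)" by (rule DERIV_isCont[OF left.y_omega[OF zero_mem(1)]])
    ultimately have nz: "\<forall>\<^sub>F \<epsilon> in at_right 0. left.y (\<Omega> \<epsilon> i) 0 \<noteq> 0"
      if "((\<lambda>\<epsilon>. \<Omega> \<epsilon> i) \<longlongrightarrow> \<mu> j) (at_right 0)" for i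
      using tendsto_imp_eventually_ne[OF isCont_tendsto_compose[OF _ that]] by blast
    from nz[OF q] nz[OF p] less pos show ?thesis
    proof eventually_elim
      case (elim \<epsilon>)
      have ef: "P_eigenfunction a b k r \<kappa> \<rho> \<epsilon> (of_real (\<epsilon> * \<Omega> \<epsilon> i)) (\<lambda>x. of_real (u \<epsilon> i x))" if "1 \<le> i" for i
        using norm elim(4) that by (simp add: P_normalized_def \<Omega>_def)
      obtain \<gamma> where \<gamma>: "\<gamma> \<noteq> 0" "\<And>x. x \<in> {a..b} \<Longrightarrow> complex_of_real (u \<epsilon> j x) = \<gamma> * of_real (eigen_family (\<Omega> \<epsilon> j) x)"
        by (rule eigenfunction_in_family[OF ef[OF j] elim(4,1)]) blast
      obtain \<gamma>' where \<gamma>': "\<gamma>' \<noteq> 0"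
        "\<And>x. x \<in> {a..b} \<Longrightarrow> complex_of_real (u \<epsilon> (j + 1) x) = \<gamma>' * of_real (eigen_family (\<Omega> \<epsilon> (j + 1)) x)"
        by (rule eigenfunction_in_family[OF ef[of "j + 1"] elim(4,2)]) auto
      show ?case by (rule L2_span_plane[OF \<gamma> \<gamma>' elim(3)])
    qed
  qed
  ultimately show ?thesis
    unfolding root_subspace_plane[OF z(1,2)]
    by (rule Lim_transform_eventually[OF _ eventually_mono]) simp
qed

end

theorem theorem5:
  fixes a b :: real
    and k r \<kappa> \<rho> :: "real \<Rightarrow> real"
    and lam :: "real \<Rightarrow> nat \<Rightarrow> real"
    and u :: "real \<Rightarrow> nat \<Rightarrow> real \<Rightarrow> real"
    and \<mu> :: "nat \<Rightarrow> real"
    and j :: nat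
  assumes "a < 0" and "0 < b"
    and "smooth_on {a..0} k" and "\<forall>x\<in>{a..0}. k x > 0"
    and "smooth_on {a..0} r" and "\<forall>x\<in>{a..0}. r x > 0"
    and "smooth_on {0..b} \<kappa>" and "\<forall>x\<in>{0..b}. \<kappa> x > 0"
    and "smooth_on {0..b} \<rho>" and "\<forall>x\<in>{0..b}. \<rho> x > 0"
    and "\<forall>\<epsilon>>0. strict_mono_on {1..} (lam \<epsilon>) \<and>
           (\<lambda>i. complex_of_real (lam \<epsilon> i)) ` {1..} = P_spectrum a b k r \<kappa> \<rho> \<epsilon>"
    and "\<forall>\<epsilon>>0. \<forall>i\<ge>1. P_normalized a b k r \<kappa> \<rho> \<epsilon> (lam \<epsilon> i) (u \<epsilon> i)"
    and "enumerates_eigenvalues {a<..<b} (op_A a b k r \<kappa> \<rho>) \<mu>"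
    and "j \<ge> 1" and "\<mu> j = \<mu> (j + 1)"
    and "complex_of_real (\<mu> j) \<in>
           op_spectrum r {a<..<0} (op_A1 a k r) \<inter> op_spectrum \<rho> {0<..<b} (op_A2_hat b \<kappa> \<rho>)"
  defines "\<pi> \<equiv> root_subspace {a<..<b} (op_A a b k r \<kappa> \<rho>) (complex_of_real (\<mu> j))"
    and "\<pi>\<epsilon> \<equiv> \<lambda>\<epsilon>. L2_span {a<..<b} (\<lambda>i x. complex_of_real (u \<epsilon> i x)) {j, j + 1}"
  shows "((\<lambda>\<epsilon>. op_norm {a<..<b}
            (\<lambda>f x. orth_proj {a<..<b} (\<pi>\<epsilon> \<epsilon>) f x - orth_proj {a<..<b} \<pi> f x)) \<longlongrightarrow> 0)
           (at_right 0)"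
proof -
  have "sl a 0 a k r" by (rule sl_of_smooth) (use assms(1-6) in auto)
  moreover have "sl 0 b b \<kappa> \<rho>" by (rule sl_of_smooth) (use assms(2,7-10) in auto)
  ultimately interpret transmission a b k r \<kappa> \<rho> by (simp add: transmission_def)
  show ?thesis
    unfolding \<pi>_def \<pi>\<epsilon>_def by (rule limit_plane[OF assms(11-15)])
qed

end
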